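(* For all integers $n\ge 1$ and $m\ge 0$, the $\mathbb{Z}$-graded Lie superalgebra $H(2n,m)$ has no non-trivial filtered deformations; that is, every filtered deformation of $H(2n,m)$ is trivial.
   Context: All vector spaces and algebras are over $\mathbb{C}$. Filtered deformations. Let $\mathfrak{g}=\bigoplus_{j\ge -h}\mathfrak{g}_j$ ($h$ a positive integer) be a Lie superalgebra with a $\mathbb{Z}$-gradation compatible with its $\mathbb{Z}_2$-gradation, $[\mathfrak{g}_i,\mathfrak{g}_j]\subset\mathfrak{g}_{i+j}$, $\dim\mathfrak{g}_j<\infty$. Its completion is $\bar{\mathfrak{g}}=\prod_j\mathfrak{g}_j$, filtered by $\prod_{i\ge j}\mathfrak{g}_i$. A filtered Lie superalgebra of depth $h$ is a Lie superalgebra $L=L_{-h}\supset L_{-h+1}\supset\cdots\supset L_0\supset L_1\supset\cdots$ with $L_i$ subspaces compatible with the $\mathbb{Z}_2$-gradation, $[L_i,L_j]\subset L_{i+j}$, $\dim L_j/L_{j+1}<\infty$; it is assumed complete (and separated) in the topology defined by the filtration. A filtered deformation of $\mathfrak{g}$ is such an $L$ whose associated graded Lie superalgebra $\bigoplus_j L_j/L_{j+1}$ is isomorphic to $\mathfrak{g}$. It is trivial if it is isomorphic to $\bar{\mathfrak{g}}$ (as a filtered Lie superalgebra, i.e. one can choose complements $V_j$ of $L_{j+1}$ in $L_j$, identified with $\mathfrak{g}_j$, so that under $L=\prod_jV_j=\bar{\mathfrak{g}}$ the bracket of $L$ is that of $\bar{\mathfrak{g}}$). The algebra. Let $\Lambda(2n,m)=\mathbb{C}[p_1,\dots,p_n,q_1,\dots,q_n]\otimes\Lambda(\xi_1,\dots,\xi_m)$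 with $p_i,q_i$ even and $\xi_j$ odd, with the Poisson bracket $$[f,g]=\sum_{i=1}^n\Big(\frac{\partial f}{\partial p_i}\frac{\partial g}{\partial q_i}-\frac{\partial f}{\partial q_i}\frac{\partial g}{\partial p_i}\Big)-(-1)^{p(f)}\sum_{i=1}^m\frac{\partial f}{\partial\xi_i}\frac{\partial g}{\partial\xi_i}.$$ This is a Lie superalgebra and $H(2n,m)=\Lambda(2n,m)/\mathbb{C}1$ (identified with the polynomial vector fields annihilating $\sum_i dp_idq_i+\sum_i d\xi_id\xi_i$). The $\mathbb{Z}$-gradation (of depth $1$) gives a polynomial homogeneous of total degree $d$ in the $p_i,q_i,\xi_j$ the degree $d-2$. *)

theory Defs
  imports Complex_Main "HOL-Library.Poly_Mapping" "HOL-Library.Function_Algebras" "HOL-Library.Z2"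
begin

section \<open>Lie superalgebras, gradations and filtrations\<close>

text \<open>
  The underlying superspace is a subspace \<open>carr A\<close> of a complex vector space; \<open>par A a\<close> is its
  homogeneous part of parity \<open>a \<in> Z/2\<close> (the type \<^typ>\<open>bit\<close>).
\<close>

record 'a superalgebra =
  carr :: "'a set"
  smul :: "complex \<Rightarrow> 'a \<Rightarrow> 'a"
  par  :: "bit \<Rightarrow> 'a set"
  brk  :: "'a \<Rightarrow> 'a \<Rightarrow> 'a"

record 'a graded_superalgebra = "'a superalgebra" +
  comp :: "int \<Rightarrow> 'a set"

record 'a filtered_superalgebra = "'a superalgebra" +
  fil :: "int \<Rightarrow> 'a set"

definition koszul_sign :: "bit \<Rightarrow> bit \<Rightarrow> complex" where
  "koszul_sign a b = (if a = 1 \<and> b = 1 then - 1 else 1)"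

locale lie_superalgebra = vector_space "smul A"
  for A :: "('a::ab_group_add, 'z) superalgebra_scheme" +
  assumes subspace_carr: "subspace (carr A)"
    and subspace_par: "subspace (par A a)"
    and par_subset: "par A a \<subseteq> carr A"
    and par_decomp: "x \<in> carr A \<Longrightarrow> \<exists>y\<in>par A 0. \<exists>z\<in>par A 1. x = y + z"
    and par_disjoint: "par A 0 \<inter> par A 1 = {0}"
    and brk_par: "\<lbrakk>x \<in> par A a; y \<in> par A b\<rbrakk> \<Longrightarrow> brk A x y \<in> par A (a + b)"
    and brk_add_left: "\<lbrakk>x \<in> carr A; y \<in> carr A; z \<in> carr A\<rbrakk> \<Longrightarrow>
      brk A (x + y) z = brk A x z + brk A y z"
    and brk_add_right: "\<lbrakk>x \<in> carr A; y \<in> carr A; z \<in> carr A\<rbrakk> \<Longrightarrow>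
      brk A x (y + z) = brk A x y + brk A x z"
    and brk_smul_left: "\<lbrakk>x \<in> carr A; y \<in> carr A\<rbrakk> \<Longrightarrow>
      brk A (smul A c x) y = smul A c (brk A x y)"
    and brk_smul_right: "\<lbrakk>x \<in> carr A; y \<in> carr A\<rbrakk> \<Longrightarrow>
      brk A x (smul A c y) = smul A c (brk A x y)"
    and super_antisym: "\<lbrakk>x \<in> par A a; y \<in> par A b\<rbrakk> \<Longrightarrow>
      brk A x y = - smul A (koszul_sign a b) (brk A y x)"
    and super_jacobi: "\<lbrakk>x \<in> par A a; y \<in> par A b; z \<in> carr A\<rbrakk> \<Longrightarrow>
      brk A x (brk A y z) =
        brk A (brk A x y) z + smul A (koszul_sign a b) (brk A y (brk A x z))"

text \<open>
  The filtration of depth \<open>h\<close> is indexed by all integers, with \<open>L\<^sub>j = L\<close> for \<open>j \<le> -h\<close>.  Its members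
  form a countable neighbourhood basis of zero, so completeness can be expressed by sequences.
\<close>

locale filtered_lie_superalgebra = lie_superalgebra L
  for L :: "('a::ab_group_add, 'z) filtered_superalgebra_scheme" +
  fixes h :: nat
  assumes depth_pos: "h > 0"
    and fil_depth: "j \<le> - int h \<Longrightarrow> fil L j = carr L"
    and fil_decreasing: "fil L (j + 1) \<subseteq> fil L j"
    and subspace_fil: "subspace (fil L j)"
    and fil_par: "x \<in> fil L j \<Longrightarrow>
      \<exists>y\<in>fil L j \<inter> par L 0. \<exists>z\<in>fil L j \<inter> par L 1. x = y + z"
    and fil_brk: "\<lbrakk>x \<in> fil L i; y \<in> fil L j\<rbrakk> \<Longrightarrow> brk L x y \<in> fil L (i + j)"
    and fil_quotient_finite_dim: "\<exists>B. finite B \<and> fil L j = span (B \<union> fil L (j + 1))"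
    and fil_separated: "(\<Inter>j. fil L j) = {0}"
    and fil_complete: "\<lbrakk>range s \<subseteq> carr L;
        \<forall>k. \<exists>N. \<forall>r\<ge>N. \<forall>t\<ge>N. s (r::nat) - s t \<in> fil L k\<rbrakk> \<Longrightarrow>
      \<exists>l\<in>carr L. \<forall>k. \<exists>N. \<forall>r\<ge>N. s r - l \<in> fil L k"

text \<open>
  The component of degree \<open>j\<close> of the associated graded algebra is \<open>L\<^sub>j / L\<^sub>j\<^sub>+\<^sub>1\<close>, whose elements are
  the cosets \<open>fil_class L j x\<close> for \<open>x \<in> L\<^sub>j\<close>.
\<close>

definition fil_class :: "('a::ab_group_add, 'z) filtered_superalgebra_scheme \<Rightarrow> int \<Rightarrow> 'a \<Rightarrow> 'a set" where
  "fil_class L j x = {x + u | u. u \<in> fil L (j + 1)}"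

definition gr_comp :: "('a::ab_group_add, 'z) filtered_superalgebra_scheme \<Rightarrow> int \<Rightarrow> 'a set set" where
  "gr_comp L j = fil_class L j ` fil L j"

definition gr_par :: "('a::ab_group_add, 'z) filtered_superalgebra_scheme \<Rightarrow> int \<Rightarrow> bit \<Rightarrow> 'a set set" where
  "gr_par L j a = fil_class L j ` (fil L j \<inter> par L a)"

text \<open>
  An isomorphism of graded Lie superalgebras from the associated graded algebra of \<open>L\<close> onto \<open>G\<close>, given
  by its homogeneous components.  The operations on the quotients are the induced ones,
  \<open>[x + L\<^sub>i\<^sub>+\<^sub>1, y + L\<^sub>j\<^sub>+\<^sub>1] = [x, y] + L\<^sub>i\<^sub>+\<^sub>j\<^sub>+\<^sub>1\<close>.
\<close>

definition gr_iso ::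
  "(int \<Rightarrow> 'a set \<Rightarrow> 'b) \<Rightarrow> ('a::ab_group_add, 'y) filtered_superalgebra_scheme \<Rightarrow>
    ('b::ab_group_add, 'z) graded_superalgebra_scheme \<Rightarrow> bool" where
  "gr_iso \<phi> L G \<longleftrightarrow>
    (\<forall>j. bij_betw (\<phi> j) (gr_comp L j) (comp G j)) \<and>
    (\<forall>j a. \<phi> j ` gr_par L j a = comp G j \<inter> par G a) \<and>
    (\<forall>j. \<forall>x\<in>fil L j. \<forall>y\<in>fil L j.
      \<phi> j (fil_class L j (x + y)) = \<phi> j (fil_class L j x) + \<phi> j (fil_class L j y)) \<and>
    (\<forall>j c. \<forall>x\<in>fil L j. \<phi> j (fil_class L j (smul L c x)) = smul G c (\<phi> j (fil_class L j x))) \<and>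
    (\<forall>i j. \<forall>x\<in>fil L i. \<forall>y\<in>fil L j.
      \<phi> (i + j) (fil_class L (i + j) (brk L x y)) =
        brk G (\<phi> i (fil_class L i x)) (\<phi> j (fil_class L j y)))"

definition filtered_deformation ::
  "nat \<Rightarrow> ('b::ab_group_add, 'z) graded_superalgebra_scheme \<Rightarrow>
    ('a::ab_group_add, 'y) filtered_superalgebra_scheme \<Rightarrow> bool" where
  "filtered_deformation h G L \<longleftrightarrow> filtered_lie_superalgebra L h \<and> (\<exists>\<phi>. gr_iso \<phi> L G)"

text \<open>
  The completion \<open>\<Prod>\<^sub>j G\<^sub>j\<close> of a graded algebra of depth \<open>h\<close>: as \<open>G\<^sub>i = 0\<close> for \<open>i < -h\<close>, the component
  of degree \<open>k\<close> of a bracket involves only the finitely many \<open>i\<close> with \<open>-h \<le> i\<close> and \<open>-h \<le> k - i\<close>.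
\<close>

definition completion ::
  "nat \<Rightarrow> ('b::ab_group_add, 'z) graded_superalgebra_scheme \<Rightarrow> (int \<Rightarrow> 'b) filtered_superalgebra" where
  "completion h G =
    \<lparr>carr = {x. \<forall>j. x j \<in> comp G j},
     smul = (\<lambda>c x j. smul G c (x j)),
     par = (\<lambda>a. {x. \<forall>j. x j \<in> comp G j \<inter> par G a}),
     brk = (\<lambda>x y k. \<Sum>i\<in>{- int h..k + int h}. brk G (x i) (y (k - i))),
     fil = (\<lambda>j. {x. (\<forall>i. x i \<in> comp G i) \<and> (\<forall>i<j. x i = 0)})\<rparr>"

definition filtered_iso ::
  "('a \<Rightarrow> 'b) \<Rightarrow> ('a::ab_group_add, 'y) filtered_superalgebra_scheme \<Rightarrow>
    ('b::ab_group_add, 'z) filtered_superalgebra_scheme \<Rightarrow> bool" where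
  "filtered_iso \<phi> L M \<longleftrightarrow>
    bij_betw \<phi> (carr L) (carr M) \<and>
    (\<forall>x\<in>carr L. \<forall>y\<in>carr L. \<phi> (x + y) = \<phi> x + \<phi> y) \<and>
    (\<forall>c. \<forall>x\<in>carr L. \<phi> (smul L c x) = smul M c (\<phi> x)) \<and>
    (\<forall>a. \<phi> ` par L a = par M a) \<and>
    (\<forall>x\<in>carr L. \<forall>y\<in>carr L. \<phi> (brk L x y) = brk M (\<phi> x) (\<phi> y)) \<and>
    (\<forall>j. \<phi> ` fil L j = fil M j)"

definition trivial_deformation ::
  "nat \<Rightarrow> ('b::ab_group_add, 'z) graded_superalgebra_scheme \<Rightarrow>
    ('a::ab_group_add, 'y) filtered_superalgebra_scheme \<Rightarrow> bool" where
  "trivial_deformation h G L \<longleftrightarrow> (\<exists>\<phi>. filtered_iso \<phi> L (completion h G))"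


section \<open>The Poisson superalgebra\<close>

text \<open>
  The even variables are \<open>Pvar i\<close>, \<open>Qvar i\<close>.  An element \<open>\<Sum>\<^sub>I f\<^sub>I \<xi>\<^sub>I\<close> of the polynomial superalgebra
  is the function \<open>I \<mapsto> f\<^sub>I\<close>, where \<open>\<xi>\<^sub>I\<close> is the product of the \<open>\<xi>\<^sub>i\<close>, \<open>i \<in> I\<close>, in increasing order.
  Indices start from 0.
\<close>

datatype evar = Pvar nat | Qvar nat

type_synonym epoly = "(evar \<Rightarrow>\<^sub>0 nat) \<Rightarrow>\<^sub>0 complex"

type_synonym spoly = "nat set \<Rightarrow> epoly"

definition mdeg :: "(evar \<Rightarrow>\<^sub>0 nat) \<Rightarrow> nat" where
  "mdeg a = (\<Sum>v\<in>Poly_Mapping.keys a. Poly_Mapping.lookup a v)"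

definition Lam :: "nat \<Rightarrow> nat \<Rightarrow> spoly set" where
  "Lam n m = {f. \<forall>I. f I \<noteq> 0 \<longrightarrow> I \<subseteq> {..<m} \<and>
     (\<forall>a\<in>Poly_Mapping.keys (f I). Poly_Mapping.keys a \<subseteq> Pvar ` {..<n} \<union> Qvar ` {..<n})}"

definition Lam_par :: "nat \<Rightarrow> nat \<Rightarrow> bit \<Rightarrow> spoly set" where
  "Lam_par n m b = {f \<in> Lam n m. \<forall>I. f I \<noteq> 0 \<longrightarrow> of_nat (card I) = b}"

definition Lam_hom :: "nat \<Rightarrow> nat \<Rightarrow> int \<Rightarrow> spoly set" where
  "Lam_hom n m d = {f \<in> Lam n m. \<forall>I. \<forall>a\<in>Poly_Mapping.keys (f I). int (mdeg a + card I) = d}"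

text \<open>
  The sign is that of \<open>\<xi>\<^sub>I \<xi>\<^sub>J = \<plusminus> \<xi>\<^bsub>I \<union> J\<^esub>\<close> for disjoint \<open>I\<close>, \<open>J\<close>.
\<close>

definition smult_poly :: "spoly \<Rightarrow> spoly \<Rightarrow> spoly" (infixl "\<star>" 70) where
  "f \<star> g = (\<lambda>K. \<Sum>I\<in>Pow K. (- 1) ^ card {(i, j). i \<in> I \<and> j \<in> K - I \<and> j < i} * f I * g (K - I))"

definition pderiv_even :: "evar \<Rightarrow> epoly \<Rightarrow> epoly" where
  "pderiv_even v f = (\<Sum>a\<in>Poly_Mapping.keys f.
     Poly_Mapping.single (a - Poly_Mapping.single v 1)
       (of_nat (Poly_Mapping.lookup a v) * Poly_Mapping.lookup f a))"

definition ediff :: "evar \<Rightarrow> spoly \<Rightarrow> spoly" where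
  "ediff v f = (\<lambda>I. pderiv_even v (f I))"

text \<open>The left derivative with respect to \<open>\<xi>\<^sub>j\<close>.\<close>

definition odiff :: "nat \<Rightarrow> spoly \<Rightarrow> spoly" where
  "odiff j f = (\<lambda>I. if j \<in> I then 0 else (- 1) ^ card {i \<in> I. i < j} * f (insert j I))"

text \<open>The linear map that is multiplication by \<open>(-1)\<^bsup>p(f)\<^esup>\<close> on homogeneous \<open>f\<close>.\<close>

definition parity_twist :: "spoly \<Rightarrow> spoly" where
  "parity_twist f = (\<lambda>I. (- 1) ^ card I * f I)"

definition poisson :: "nat \<Rightarrow> nat \<Rightarrow> spoly \<Rightarrow> spoly \<Rightarrow> spoly" where
  "poisson n m f g =
     (\<Sum>i<n. ediff (Pvar i) f \<star> ediff (Qvar i) g - ediff (Qvar i) f \<star> ediff (Pvar i) g)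
     - (\<Sum>j<m. odiff j (parity_twist f) \<star> odiff j g)"

definition sconst :: "complex \<Rightarrow> spoly" where
  "sconst c = (\<lambda>I. if I = {} then Poly_Mapping.single 0 c else 0)"

definition sscale :: "complex \<Rightarrow> spoly \<Rightarrow> spoly" where
  "sscale c f = (\<lambda>I. Poly_Mapping.map ((*) c) (f I))"


section \<open>The quotient by the constants\<close>

lemma sconst_add: "sconst (c + d) = sconst c + sconst d"
  by (auto simp: sconst_def fun_eq_iff single_add)

lemma sconst_diff: "sconst (c - d) = sconst c - sconst d"
  by (auto simp: sconst_def fun_eq_iff single_diff)

lemma sconst_0: "sconst 0 = 0"
  by (auto simp: sconst_def fun_eq_iff)

lemma lookup_sscale [simp]: "Poly_Mapping.lookup (sscale c f I) a = c * Poly_Mapping.lookup (f I) a"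
  by (simp add: sscale_def map.rep_eq when_def)

lemma sscale_sconst: "sscale c (sconst d) = sconst (c * d)"
  by (intro ext poly_mapping_eqI) (simp add: sconst_def lookup_single when_def)

lemma sscale_diff: "sscale c (f - g) = sscale c f - sscale c g"
  by (intro ext poly_mapping_eqI) (simp add: lookup_minus algebra_simps)

lemma sscale_add: "sscale c (f + g) = sscale c f + sscale c g"
  by (intro ext poly_mapping_eqI) (simp add: lookup_add algebra_simps)

definition const_rel :: "spoly \<Rightarrow> spoly \<Rightarrow> bool" where
  "const_rel f g \<longleftrightarrow> (\<exists>c. f - g = sconst c)"

lemma equivp_const_rel: "equivp const_rel"
proof (rule equivpI)
  show "reflp const_rel"
    unfolding reflp_def const_rel_def by (metis diff_self sconst_0)
  show "symp const_rel"
    unfolding symp_def const_rel_def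
  proof (intro allI impI)
    fix f g assume "\<exists>c. f - g = sconst c"
    then obtain c where "f - g = sconst c" by blast
    moreover have "g - f = 0 - (f - g)" by simp
    ultimately have "g - f = sconst (0 - c)" by (simp only: sconst_diff sconst_0)
    then show "\<exists>c. g - f = sconst c" by blast
  qed
  show "transp const_rel"
    unfolding transp_def const_rel_def
  proof (intro allI impI)
    fix f g h assume "\<exists>c. f - g = sconst c" "\<exists>c. g - h = sconst c"
    then obtain c d where "f - g = sconst c" "g - h = sconst d" by blast
    moreover have "f - h = (f - g) + (g - h)" by simp
    ultimately have "f - h = sconst (c + d)" by (simp only: sconst_add)
    then show "\<exists>c. f - h = sconst c" by blast
  qed
qed

text \<open>
  The quotient is formed for all variables simultaneously; \<open>H(2n,m)\<close> is the image in it of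
  \<open>\<Lambda>(2n,m)\<close>, which contains the constants.
\<close>

quotient_type hamiltonian = spoly / const_rel
  by (rule equivp_const_rel)

instantiation hamiltonian :: ab_group_add
begin

lift_definition zero_hamiltonian :: hamiltonian is "0 :: spoly" .

lift_definition plus_hamiltonian :: "hamiltonian \<Rightarrow> hamiltonian \<Rightarrow> hamiltonian" is "(+)"
proof -
  fix f f' g g' assume "const_rel f f'" "const_rel g g'"
  then obtain c d where "f - f' = sconst c" "g - g' = sconst d"
    unfolding const_rel_def by blast
  moreover have "(f + g) - (f' + g') = (f - f') + (g - g')" by (simp add: algebra_simps)
  ultimately have "(f + g) - (f' + g') = sconst (c + d)" by (simp only: sconst_add)
  then show "const_rel (f + g) (f' + g')"
    unfolding const_rel_def by blast
qed

lift_definition minus_hamiltonian :: "hamiltonian \<Rightarrow> hamiltonian \<Rightarrow> hamiltonian" is "(-)"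
proof -
  fix f f' g g' assume "const_rel f f'" "const_rel g g'"
  then obtain c d where "f - f' = sconst c" "g - g' = sconst d"
    unfolding const_rel_def by blast
  moreover have "(f - g) - (f' - g') = (f - f') - (g - g')" by (simp add: algebra_simps)
  ultimately have "(f - g) - (f' - g') = sconst (c - d)" by (simp only: sconst_diff)
  then show "const_rel (f - g) (f' - g')"
    unfolding const_rel_def by blast
qed

lift_definition uminus_hamiltonian :: "hamiltonian \<Rightarrow> hamiltonian" is "uminus"
proof -
  fix f f' assume "const_rel f f'"
  then obtain c where "f - f' = sconst c"
    unfolding const_rel_def by blast
  moreover have "- f - - f' = 0 - (f - f')" by simp
  ultimately have "- f - - f' = sconst (0 - c)" by (simp only: sconst_diff sconst_0)
  then show "const_rel (- f) (- f')"
    unfolding const_rel_def by blast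
qed

instance
proof
  have refl: "const_rel f f" for f
    using equivp_const_rel by (rule equivp_reflp)
  fix a b c :: hamiltonian
  show "a + b + c = a + (b + c)" by transfer (simp add: refl add.assoc)
  show "a + b = b + a" by transfer (simp add: refl add.commute)
  show "0 + a = a" by transfer (simp add: refl)
  show "- a + a = 0" by transfer (simp add: refl)
  show "a - b = a + - b" by transfer (simp add: refl)
qed

end

lift_definition ham_scale :: "complex \<Rightarrow> hamiltonian \<Rightarrow> hamiltonian" is sscale
  unfolding const_rel_def by (metis sscale_diff sscale_sconst)

lemma vector_space_ham_scale: "vector_space ham_scale"
proof
  have refl: "const_rel f f" for f
    using equivp_const_rel by (rule equivp_reflp)
  fix a b :: complex and x y :: hamiltonian
  show "ham_scale a (x + y) = ham_scale a x + ham_scale a y"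
    by transfer (simp add: refl sscale_add)
  show "ham_scale (a + b) x = ham_scale a x + ham_scale b x"
  proof transfer
    fix a b f
    have "sscale (a + b) f = sscale a f + sscale b f"
      by (intro ext poly_mapping_eqI) (simp add: lookup_add algebra_simps)
    then show "const_rel (sscale (a + b) f) (sscale a f + sscale b f)" by (simp add: refl)
  qed
  show "ham_scale a (ham_scale b x) = ham_scale (a * b) x"
  proof transfer
    fix a b f
    have "sscale a (sscale b f) = sscale (a * b) f"
      by (intro ext poly_mapping_eqI) (simp add: algebra_simps)
    then show "const_rel (sscale a (sscale b f)) (sscale (a * b) f)" by (simp add: refl)
  qed
  show "ham_scale 1 x = x"
  proof transfer
    fix f
    have "sscale 1 f = f"
      by (intro ext poly_mapping_eqI) simp
    then show "const_rel (sscale 1 f) f" by (simp add: refl)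
  qed
qed

lemma lookup_pderiv_even:
  "Poly_Mapping.lookup (pderiv_even v f) a =
     of_nat (Poly_Mapping.lookup a v + 1) * Poly_Mapping.lookup f (a + Poly_Mapping.single v 1)"
proof -
  let ?e = "Poly_Mapping.single v (1::nat)"
  have "Poly_Mapping.lookup (pderiv_even v f) a =
      (\<Sum>b\<in>Poly_Mapping.keys f.
        (of_nat (Poly_Mapping.lookup b v) * Poly_Mapping.lookup f b when b - ?e = a))"
    by (simp add: pderiv_even_def lookup_sum lookup_single)
  also have "\<dots> = (\<Sum>b\<in>Poly_Mapping.keys f.
        (of_nat (Poly_Mapping.lookup b v) * Poly_Mapping.lookup f b when b = a + ?e))"
  proof (rule sum.cong[OF refl])
    fix b
    have "b = a + ?e" if "b - ?e = a" "Poly_Mapping.lookup b v \<noteq> 0"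
    proof (rule poly_mapping_eqI)
      fix w
      show "Poly_Mapping.lookup b w = Poly_Mapping.lookup (a + ?e) w"
        using that by (auto simp: lookup_add lookup_minus lookup_single when_def)
    qed
    then have "b - ?e = a \<longleftrightarrow> b = a + ?e" if "Poly_Mapping.lookup b v \<noteq> 0"
      using that by (metis add_diff_cancel_right')
    then show "(of_nat (Poly_Mapping.lookup b v) * Poly_Mapping.lookup f b when b - ?e = a) =
        (of_nat (Poly_Mapping.lookup b v) * Poly_Mapping.lookup f b when b = a + ?e)"
      by (cases "Poly_Mapping.lookup b v = 0") (simp_all only: of_nat_0 mult_zero_left when_def if_cancel not_False_eq_True simp_thms)
  qed
  also have "\<dots> = (if a + ?e \<in> Poly_Mapping.keys f
      then of_nat (Poly_Mapping.lookup (a + ?e) v) * Poly_Mapping.lookup f (a + ?e) else 0)"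
    unfolding when_def by (rule sum.delta) (rule finite_keys)
  also have "\<dots> = of_nat (Poly_Mapping.lookup a v + 1) * Poly_Mapping.lookup f (a + ?e)"
    by (simp add: lookup_add in_keys_iff)
  finally show ?thesis .
qed

lemma ediff_add_sconst: "ediff v (f + sconst c) = ediff v f"
proof (intro ext poly_mapping_eqI)
  fix I a
  have "0 \<noteq> a + Poly_Mapping.single v (1::nat)"
    by (metis add_is_0 lookup_add lookup_single_eq lookup_zero one_neq_zero)
  then show "Poly_Mapping.lookup (ediff v (f + sconst c) I) a = Poly_Mapping.lookup (ediff v f I) a"
    by (simp add: ediff_def lookup_pderiv_even lookup_add sconst_def lookup_single when_def)
qed

lemma odiff_add_sconst: "odiff j (f + sconst c) = odiff j f"
  by (auto simp: odiff_def sconst_def)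

lemma parity_twist_add_sconst: "parity_twist (f + sconst c) = parity_twist f + sconst c"
  by (auto simp: parity_twist_def sconst_def algebra_simps)

lemma poisson_add_sconst: "poisson n m (f + sconst c) (g + sconst d) = poisson n m f g"
  by (simp add: poisson_def ediff_add_sconst odiff_add_sconst parity_twist_add_sconst)

lift_definition ham_brk :: "nat \<Rightarrow> nat \<Rightarrow> hamiltonian \<Rightarrow> hamiltonian \<Rightarrow> hamiltonian" is poisson
proof -
  fix n m f f' g g' assume "const_rel f f'" "const_rel g g'"
  then obtain c d where "f - f' = sconst c" "g - g' = sconst d"
    unfolding const_rel_def by blast
  then have "f = f' + sconst c" "g = g' + sconst d"
    by (simp_all add: diff_eq_eq add.commute)
  then have "poisson n m f g = poisson n m f' g'"
    by (simp only: poisson_add_sconst)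
  then show "const_rel (poisson n m f g) (poisson n m f' g')"
    using equivp_const_rel by (simp add: equivp_reflp)
qed

definition ham_algebra :: "nat \<Rightarrow> nat \<Rightarrow> hamiltonian graded_superalgebra" where
  "ham_algebra n m =
    \<lparr>carr = abs_hamiltonian ` Lam n m,
     smul = ham_scale,
     par = (\<lambda>a. abs_hamiltonian ` Lam_par n m a),
     brk = ham_brk n m,
     comp = (\<lambda>j. abs_hamiltonian ` Lam_hom n m (j + 2))\<rparr>"

end

theory Submission
  imports Defs
begin

text \<open>
  Write \<open>G = \<Oplus>\<^sub>j G\<^sub>j\<close> for \<open>H(2n,m)\<close> and
  \<open>L\<close> for a filtered deformation. The identification of
  \<open>L\<^sub>j / L\<^sub>j\<^sub>+\<^sub>1\<close> with \<open>G\<^sub>j\<close> assigns to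
  \<open>x \<in> L\<^sub>j\<close> its symbol in \<open>G\<^sub>j\<close>. The component
  \<open>G\<^sub>-\<^sub>1\<close> consists of the linear functions; it has a basis
  \<open>e\<^sub>i\<close>, indexed by the variables, such that \<open>[e\<^sub>i, f]\<close> is the
  partial derivative of \<open>f\<close> with respect to the variable \<open>i\<close>. So
  \<open>G\<close> is governed by two Poincare lemmas for polynomials in even and odd variables,
  both proved with the Euler identity
  \<open>\<Sum>\<^sub>i z\<^sub>i \<partial>\<^sub>i f = deg(f) f\<close>: a family
  \<open>f\<^sub>i\<close> with supersymmetric derivatives is a gradient
  (\<open>poincare_1\<close>), and a closed two-form \<open>f\<^sub>i\<^sub>j\<close> is exact
  (\<open>poincare_2\<close>).

  It is enough to find lifts \<open>X\<^sub>i \<in> L\<close> of the \<open>e\<^sub>i\<close> that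
  still supercommute. Given these, an element \<open>y \<in> L\<close> has a Taylor expansion: its
  component of degree \<open>-1\<close> is its symbol, and the component of degree \<open>j\<close>
  is the element of \<open>G\<^sub>j\<close> whose derivative along \<open>e\<^sub>i\<close> is the
  component of degree \<open>j - 1\<close> of \<open>[X\<^sub>i, y]\<close>. For
  \<open>j \<ge> 1\<close> it exists by the first Poincare lemma, because the
  \<open>X\<^sub>i\<close> commute, and for \<open>j = 0\<close> it is the symbol of
  \<open>y\<close> less a combination of the \<open>X\<^sub>i\<close>; and it is unique because a
  function without derivatives is constant. The expansion respects brackets since both sides of the
  asserted identity satisfy the same recursion; its leading term is the symbol, so by completeness
  it is an isomorphism of \<open>L\<close> onto the completion of \<open>G\<close>
  (\<open>filtered_iso_taylor_series\<close>).

  Commuting lifts are obtained by successive approximation (\<open>commuting_lifts\<close>). If all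
  \<open>[X\<^sub>i, X\<^sub>j]\<close> lie in \<open>L\<^sub>d\<close>, their symbols form a
  two-form, closed by the Jacobi identity, hence the exterior derivative of a one-form, and
  subtracting a lift of this one-form from the \<open>X\<^sub>i\<close> moves the brackets into
  \<open>L\<^sub>d\<^sub>+\<^sub>1\<close>. The one exceptional step is \<open>d = -1\<close>. There
  the Jacobi identity takes values in constants, which vanish in \<open>G\<close>, and says nothing.
  The obstruction to closedness is an even trilinear form on \<open>G\<^sub>-\<^sub>1\<close>, the
  torsion, and it is invariant under
  \<open>h = \<Sum>\<^sub>k p\<^sub>k q\<^sub>k \<in> G\<^sub>0\<close>. As the form is even, it is
  nonzero only on triples with an odd number of even variables; each even variable has weight
  \<open>\<plusminus>1\<close> under \<open>h\<close> and each odd one weight 0, so the total weight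
  is odd. An invariant form vanishes in nonzero total weight, so the torsion is zero
  (\<open>torsion_closed\<close>).
\<close>

section \<open>Symbols of elements of a filtered deformation\<close>

locale deformation = filtered_lie_superalgebra L 1 + G: vector_space "smul G"
  for L :: "('a::ab_group_add, 'z) filtered_superalgebra_scheme"
    and G :: "('b::ab_group_add, 'y) graded_superalgebra_scheme" +
  fixes \<phi> :: "int \<Rightarrow> 'a set \<Rightarrow> 'b"
  assumes gr_iso: "gr_iso \<phi> L G"
begin

definition symbol :: "int \<Rightarrow> 'a \<Rightarrow> 'b" where
  "symbol j x = \<phi> j (fil_class L j x)"

lemma fil_mono: "i \<le> j \<Longrightarrow> fil L j \<subseteq> fil L i"
proof (induction j rule: int_ge_induct)
  case (step j)
  then show ?case using fil_decreasing[of j] by blast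
qed simp

lemma fil_carr: "fil L j \<subseteq> carr L"
  using fil_mono[of "min j (-1)" j] fil_depth[of "min j (-1)"] by auto

lemma fil_carrD: "x \<in> fil L j \<Longrightarrow> x \<in> carr L"
  using fil_carr by blast

lemma fil_minus1: "fil L (-1) = carr L"
  by (rule fil_depth) simp

lemma par_carrD: "x \<in> par L a \<Longrightarrow> x \<in> carr L"
  using par_subset by blast

lemmas fil_add = subspace_add[OF subspace_fil]
  and fil_diff = subspace_diff[OF subspace_fil]
  and fil_scale = subspace_scale[OF subspace_fil]
  and fil_sum = subspace_sum[OF subspace_fil]
  and fil_0 = subspace_0[OF subspace_fil]
  and fil_neg = subspace_neg[OF subspace_fil]
  and carr_diff = subspace_diff[OF subspace_carr]
  and carr_scale = subspace_scale[OF subspace_carr]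
  and carr_sum = subspace_sum[OF subspace_carr]
  and carr_0 = subspace_0[OF subspace_carr]
  and par_add = subspace_add[OF subspace_par]
  and par_diff = subspace_diff[OF subspace_par]
  and par_0 = subspace_0[OF subspace_par]
  and par_neg = subspace_neg[OF subspace_par]

lemma brk_carr: "\<lbrakk>x \<in> carr L; y \<in> carr L\<rbrakk> \<Longrightarrow> brk L x y \<in> carr L"
  using fil_brk[of x "-1" y "-1"] fil_carrD by (simp add: fil_minus1)

lemma brk_0_left: "x \<in> carr L \<Longrightarrow> brk L 0 x = 0"
  using brk_add_left[of 0 0 x] carr_0 by simp

lemma brk_0_right: "x \<in> carr L \<Longrightarrow> brk L x 0 = 0"
  using brk_add_right[of x 0 0] carr_0 by simp

lemma brk_diff_right: "\<lbrakk>x \<in> carr L; y \<in> carr L; z \<in> carr L\<rbrakk> \<Longrightarrow>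
    brk L x (y - z) = brk L x y - brk L x z"
  using brk_add_right[of x "y - z" z] carr_diff by simp

lemma brk_diff_left: "\<lbrakk>x \<in> carr L; y \<in> carr L; z \<in> carr L\<rbrakk> \<Longrightarrow>
    brk L (x - y) z = brk L x z - brk L y z"
  using brk_add_left[of "x - y" y z] carr_diff by simp

lemma brk_sum_right:
  "\<lbrakk>x \<in> carr L; \<And>i. i \<in> S \<Longrightarrow> y i \<in> carr L\<rbrakk> \<Longrightarrow>
    brk L x (\<Sum>i\<in>S. y i) = (\<Sum>i\<in>S. brk L x (y i))"
  by (induction S rule: infinite_finite_induct) (simp_all add: brk_0_right brk_add_right carr_sum)

lemma brk_sum_left:
  "\<lbrakk>x \<in> carr L; \<And>i. i \<in> S \<Longrightarrow> y i \<in> carr L\<rbrakk> \<Longrightarrow>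
    brk L (\<Sum>i\<in>S. y i) x = (\<Sum>i\<in>S. brk L (y i) x)"
  by (induction S rule: infinite_finite_induct) (simp_all add: brk_0_left brk_add_left carr_sum)

lemma par_disjointD: "\<lbrakk>x \<in> par L a; x \<in> par L (a + 1)\<rbrakk> \<Longrightarrow> x = 0"
  using par_disjoint by (cases a) auto

text \<open>
  The filtration is graded by parity, and the decomposition into an even and an odd part is unique;
  so the parts of an element of the filtration stay in it.
\<close>

lemma fil_par_component:
  assumes "x \<in> par L a" "y \<in> par L (a + 1)" "x + y \<in> fil L j"
  shows "x \<in> fil L j"
proof -
  obtain v w where vw: "v \<in> fil L j" "v \<in> par L 0" "w \<in> fil L j" "w \<in> par L 1" "x + y = v + w"
    using fil_par[OF assms(3)] by blast
  \<comment> \<open>the parity decomposition inside the filtration, sorted so that the part of parity \<open>a\<close> comes first\<close>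
  obtain v' w' where v: "v' \<in> fil L j" "v' \<in> par L a" and w: "w' \<in> par L (a + 1)" and s: "x + y = v' + w'"
  proof (cases a)
    case zero
    then show ?thesis using that[of v w] vw by simp
  next
    case one
    then show ?thesis using that[of w v] vw by (simp add: add.commute)
  qed
  have e: "x - v' = w' - y" using s by (simp add: algebra_simps)
  have "x - v' \<in> par L a" using assms(1) v(2) by (rule par_diff)
  moreover have "x - v' \<in> par L (a + 1)" unfolding e using w assms(2) by (rule par_diff)
  ultimately have "x - v' = 0" by (rule par_disjointD)
  then show ?thesis using v by simp
qed

lemma fil_class_eq_iff: "fil_class L j x = fil_class L j y \<longleftrightarrow> x - y \<in> fil L (j + 1)"
proof
  assume "fil_class L j x = fil_class L j y"
  moreover have "x \<in> fil_class L j x" unfolding fil_class_def using fil_0 by force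
  ultimately obtain u where "u \<in> fil L (j + 1)" "x = y + u" unfolding fil_class_def by blast
  then show "x - y \<in> fil L (j + 1)" by simp
next
  have sub: "fil_class L j x \<subseteq> fil_class L j y" if d: "x - y \<in> fil L (j + 1)" for x y
  proof
    fix z assume "z \<in> fil_class L j x"
    then obtain u where "u \<in> fil L (j + 1)" "z = x + u" unfolding fil_class_def by blast
    then have "z = y + ((x - y) + u)" "(x - y) + u \<in> fil L (j + 1)"
      using d fil_add by auto
    then show "z \<in> fil_class L j y" unfolding fil_class_def by blast
  qed
  assume "x - y \<in> fil L (j + 1)"
  moreover from this have "y - x \<in> fil L (j + 1)" using fil_neg by fastforce
  ultimately show "fil_class L j x = fil_class L j y" using sub by blast
qed

lemma symbol_in: "x \<in> fil L j \<Longrightarrow> symbol j x \<in> comp G j"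
  using gr_iso unfolding gr_iso_def symbol_def bij_betw_def gr_comp_def by blast

lemma symbol_add: "\<lbrakk>x \<in> fil L j; y \<in> fil L j\<rbrakk> \<Longrightarrow> symbol j (x + y) = symbol j x + symbol j y"
  using gr_iso unfolding gr_iso_def symbol_def by blast

lemma symbol_scale: "x \<in> fil L j \<Longrightarrow> symbol j (smul L c x) = smul G c (symbol j x)"
  using gr_iso unfolding gr_iso_def symbol_def by blast

lemma symbol_brk: "\<lbrakk>x \<in> fil L i; y \<in> fil L j\<rbrakk> \<Longrightarrow>
    symbol (i + j) (brk L x y) = brk G (symbol i x) (symbol j y)"
  using gr_iso unfolding gr_iso_def symbol_def by blast

lemma symbol_par_image: "symbol j ` (fil L j \<inter> par L a) = comp G j \<inter> par G a"
proof -
  have "\<phi> j ` gr_par L j a = comp G j \<inter> par G a"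
    using gr_iso unfolding gr_iso_def by blast
  then show ?thesis unfolding gr_par_def image_image symbol_def .
qed

lemma symbol_par: "\<lbrakk>x \<in> fil L j; x \<in> par L a\<rbrakk> \<Longrightarrow> symbol j x \<in> par G a"
  using symbol_par_image by blast

lemma lift_parE:
  assumes "u \<in> comp G j" "u \<in> par G a"
  obtains x where "x \<in> fil L j" "x \<in> par L a" "u = symbol j x"
proof -
  have "u \<in> symbol j ` (fil L j \<inter> par L a)" using assms symbol_par_image by simp
  then show thesis using that by blast
qed

lemma liftE:
  assumes "u \<in> comp G j"
  obtains x where "x \<in> fil L j" "u = symbol j x"
proof -
  have "u \<in> \<phi> j ` gr_comp L j"
    using gr_iso assms unfolding gr_iso_def bij_betw_def by simp
  then show thesis using that unfolding gr_comp_def symbol_def by blast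
qed

lemma symbol_eq_iff:
  assumes "x \<in> fil L j" "y \<in> fil L j"
  shows "symbol j x = symbol j y \<longleftrightarrow> x - y \<in> fil L (j + 1)"
proof -
  have "inj_on (\<phi> j) (gr_comp L j)"
    using gr_iso unfolding gr_iso_def bij_betw_def by blast
  then show ?thesis
    using assms unfolding symbol_def fil_class_eq_iff[symmetric] gr_comp_def by (auto dest: inj_onD)
qed

lemma symbol_0: "symbol j 0 = 0"
  using symbol_add[of 0 j 0] fil_0 by simp

lemma symbol_eq_0_iff: "x \<in> fil L j \<Longrightarrow> symbol j x = 0 \<longleftrightarrow> x \<in> fil L (j + 1)"
  using symbol_eq_iff[of x j 0] fil_0 symbol_0 by simp

lemma symbol_diff: "\<lbrakk>x \<in> fil L j; y \<in> fil L j\<rbrakk> \<Longrightarrow> symbol j (x - y) = symbol j x - symbol j y"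
  using symbol_add[of "x - y" j y] fil_diff by simp

lemma symbol_neg: "x \<in> fil L j \<Longrightarrow> symbol j (- x) = - symbol j x"
  using symbol_diff[of 0 j x] fil_0 symbol_0 by simp

text \<open>
  The degree is a separate variable because the sum of the two degrees rarely appears in the
  syntactic form \<open>i + j\<close>.
\<close>

lemma symbol_brk': "\<lbrakk>x \<in> fil L i; y \<in> fil L j; k = i + j\<rbrakk> \<Longrightarrow>
    symbol k (brk L x y) = brk G (symbol i x) (symbol j y)"
  using symbol_brk by simp

lemma symbol_sum:
  "(\<And>i. i \<in> S \<Longrightarrow> x i \<in> fil L j) \<Longrightarrow> symbol j (\<Sum>i\<in>S. x i) = (\<Sum>i\<in>S. symbol j (x i))"
  by (induction S rule: infinite_finite_induct) (simp_all add: symbol_0 symbol_add fil_sum)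

text \<open>
  The identities of a graded Lie superalgebra hold on homogeneous elements of \<open>G\<close>,
  because these are symbols of elements of \<open>L\<close>; the following lemmas record them.
\<close>

lemma subspace_comp: "G.subspace (comp G j)"
proof (rule G.subspaceI)
  show "0 \<in> comp G j" using symbol_in[OF fil_0] symbol_0 by simp
next
  fix u v assume "u \<in> comp G j" "v \<in> comp G j"
  then show "u + v \<in> comp G j"
    by (elim liftE) (simp add: symbol_add[symmetric] symbol_in fil_add)
next
  fix c u assume "u \<in> comp G j"
  then show "smul G c u \<in> comp G j"
    by (elim liftE) (simp add: symbol_scale[symmetric] symbol_in fil_scale)
qed

lemmas comp_add = G.subspace_add[OF subspace_comp]
  and comp_diff = G.subspace_diff[OF subspace_comp]
  and comp_scale = G.subspace_scale[OF subspace_comp]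
  and comp_sum = G.subspace_sum[OF subspace_comp]
  and comp_0 = G.subspace_0[OF subspace_comp]

lemma comp_brk: "\<lbrakk>u \<in> comp G i; v \<in> comp G j; k = i + j\<rbrakk> \<Longrightarrow> brk G u v \<in> comp G k"
  by (elim liftE) (simp add: symbol_brk[symmetric] symbol_in fil_brk)

lemma G_par_brk:
  assumes "u \<in> comp G i" "u \<in> par G a" "v \<in> comp G j" "v \<in> par G b"
  shows "brk G u v \<in> par G (a + b)"
proof -
  obtain x y where "x \<in> fil L i" "x \<in> par L a" "u = symbol i x"
    "y \<in> fil L j" "y \<in> par L b" "v = symbol j y"
    using lift_parE[OF assms(1,2)] lift_parE[OF assms(3,4)] by metis
  then show ?thesis using symbol_brk[of x i y j] symbol_par[OF fil_brk brk_par] by metis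
qed

lemma G_brk_add_right:
  "\<lbrakk>u \<in> comp G i; v \<in> comp G j; w \<in> comp G j\<rbrakk> \<Longrightarrow>
    brk G u (v + w) = brk G u v + brk G u w"
  by (elim liftE)
    (simp add: symbol_brk[symmetric] symbol_add[symmetric] fil_add fil_brk brk_add_right fil_carrD)

lemma G_brk_add_left:
  "\<lbrakk>u \<in> comp G i; v \<in> comp G j; w \<in> comp G j\<rbrakk> \<Longrightarrow>
    brk G (v + w) u = brk G v u + brk G w u"
  by (elim liftE)
    (simp add: symbol_brk[symmetric] symbol_add[symmetric] fil_add fil_brk brk_add_left fil_carrD)

lemma G_brk_scale_right:
  "\<lbrakk>u \<in> comp G i; v \<in> comp G j\<rbrakk> \<Longrightarrow> brk G u (smul G c v) = smul G c (brk G u v)"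
  by (elim liftE)
    (simp add: symbol_brk[symmetric] symbol_scale[symmetric] fil_scale fil_brk brk_smul_right fil_carrD)

lemma G_brk_scale_left:
  "\<lbrakk>u \<in> comp G i; v \<in> comp G j\<rbrakk> \<Longrightarrow> brk G (smul G c u) v = smul G c (brk G u v)"
  by (elim liftE)
    (simp add: symbol_brk[symmetric] symbol_scale[symmetric] fil_scale fil_brk brk_smul_left fil_carrD)

lemma G_brk_diff_right:
  assumes "u \<in> comp G i" "v \<in> comp G j" "w \<in> comp G j"
  shows "brk G u (v - w) = brk G u v - brk G u w"
  using G_brk_add_right[of u i "v - w" j w] assms comp_diff by simp

lemma G_brk_0_right: "u \<in> comp G i \<Longrightarrow> brk G u 0 = 0"
  using G_brk_add_right[of u i 0 0 0] comp_0 by simp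

lemma G_brk_0_left: "u \<in> comp G i \<Longrightarrow> brk G 0 u = 0"
  using G_brk_add_left[of u i 0 0 0] comp_0 by simp

lemma G_brk_sum_right:
  assumes "u \<in> comp G i" "\<And>s. s \<in> S \<Longrightarrow> v s \<in> comp G j"
  shows "brk G u (\<Sum>s\<in>S. v s) = (\<Sum>s\<in>S. brk G u (v s))"
  using assms(2)
proof (induction S rule: infinite_finite_induct)
  case (insert s S)
  then have "brk G u (v s + sum v S) = brk G u (v s) + brk G u (sum v S)"
    by (intro G_brk_add_right[OF assms(1)] comp_sum) auto
  moreover have "brk G u (sum v S) = (\<Sum>s\<in>S. brk G u (v s))"
    using insert.IH insert.prems by blast
  ultimately show ?case using insert.hyps by simp
qed (simp_all add: G_brk_0_right[OF assms(1)])

text \<open>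
  In the application this is the Jacobi identity of the Poisson bracket modulo constants, inherited
  from \<open>L\<close>.
\<close>

lemma G_jacobi:
  assumes "u \<in> comp G i" "u \<in> par G a" "v \<in> comp G j" "v \<in> par G b" "w \<in> comp G k"
  shows "brk G u (brk G v w) =
    brk G (brk G u v) w + smul G (koszul_sign a b) (brk G v (brk G u w))"
proof -
  obtain x y where x: "x \<in> fil L i" "x \<in> par L a" "u = symbol i x"
    and y: "y \<in> fil L j" "y \<in> par L b" "v = symbol j y"
    using lift_parE[OF assms(1,2)] lift_parE[OF assms(3,4)] by metis
  obtain z where z: "z \<in> fil L k" "w = symbol k z" using liftE[OF assms(5)] by metis
  have J: "brk L x (brk L y z) =
        brk L (brk L x y) z + smul L (koszul_sign a b) (brk L y (brk L x z))"
    using x y z super_jacobi fil_carrD by blast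
  let ?d = "i + j + k"
  have m: "brk L x y \<in> fil L (i + j)" "brk L y z \<in> fil L (j + k)" "brk L x z \<in> fil L (i + k)"
    using x y z fil_brk by blast+
  have m2: "brk L x (brk L y z) \<in> fil L ?d" "brk L (brk L x y) z \<in> fil L ?d"
     "brk L y (brk L x z) \<in> fil L ?d"
    using fil_brk[OF x(1) m(2)] fil_brk[OF m(1) z(1)] fil_brk[OF y(1) m(3)]
    by (simp_all add: algebra_simps)
  have "brk G u (brk G v w) = symbol ?d (brk L x (brk L y z))"
    using symbol_brk'[OF x(1) m(2), of ?d] symbol_brk[OF y(1) z(1)] x y z by simp
  also have "\<dots> = symbol ?d (brk L (brk L x y) z) +
      smul G (koszul_sign a b) (symbol ?d (brk L y (brk L x z)))"
    unfolding J using m2 fil_scale by (simp add: symbol_add symbol_scale)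
  also have "\<dots> = brk G (brk G u v) w + smul G (koszul_sign a b) (brk G v (brk G u w))"
    using symbol_brk'[OF m(1) z(1), of ?d] symbol_brk'[OF y(1) m(3), of ?d]
      symbol_brk[OF x(1) y(1)] symbol_brk[OF x(1) z(1)] x y z by simp
  finally show ?thesis .
qed

lemma G_par_decomp:
  assumes "u \<in> comp G j"
  obtains v w where "v \<in> comp G j" "v \<in> par G a" "w \<in> comp G j" "w \<in> par G (a + 1)" "u = v + w"
proof -
  obtain x where x: "x \<in> fil L j" "u = symbol j x" using assms by (elim liftE)
  obtain y z where y: "y \<in> fil L j" "y \<in> par L 0" and z: "z \<in> fil L j" "z \<in> par L 1"
    and xs: "x = y + z"
    using fil_par[OF x(1)] by blast
  have u: "u = symbol j y + symbol j z" "u = symbol j z + symbol j y"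
    using x xs y z symbol_add by (simp_all add: add.commute)
  note m = symbol_in[OF y(1)] symbol_in[OF z(1)] symbol_par[OF y] symbol_par[OF z]
  show thesis
  proof (cases a)
    case zero
    then show ?thesis using that[OF m(1) _ m(2) _ u(1)] m by simp
  next
    case one
    then show ?thesis using that[OF m(2) _ m(1) _ u(2)] m by simp
  qed
qed

lemma G_par_disjoint:
  assumes "u \<in> comp G j" "u \<in> par G a" "u \<in> par G (a + 1)"
  shows "u = 0"
proof -
  obtain x y where x: "x \<in> fil L j" "x \<in> par L a" "u = symbol j x"
    and y: "y \<in> fil L j" "y \<in> par L (a + 1)" "u = symbol j y"
    using lift_parE[OF assms(1,2)] lift_parE[OF assms(1,3)] by metis
  have "x - y \<in> fil L (j + 1)" using symbol_eq_iff x y by metis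
  then have "x \<in> fil L (j + 1)"
    using fil_par_component[of x a "- y" "j + 1"] x y par_neg by simp
  then show ?thesis using x symbol_eq_0_iff by simp
qed

lemma G_par_diff:
  assumes "u \<in> comp G j" "u \<in> par G a" "v \<in> comp G j" "v \<in> par G a"
  shows "u - v \<in> par G a"
proof -
  obtain x y where "x \<in> fil L j" "x \<in> par L a" "u = symbol j x"
    "y \<in> fil L j" "y \<in> par L a" "v = symbol j y"
    using lift_parE[OF assms(1,2)] lift_parE[OF assms(3,4)] by metis
  then show ?thesis using symbol_diff[of x j y] symbol_par[OF fil_diff par_diff] by metis
qed

end

section \<open>Completeness of the filtration\<close>

context deformation
begin

lemma fil_monoD: "\<lbrakk>x \<in> fil L j; i \<le> j\<rbrakk> \<Longrightarrow> x \<in> fil L i"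
  using fil_mono by blast

lemma separated:
  assumes "\<And>k. x \<in> fil L (int k)"
  shows "x = 0"
proof -
  have "x \<in> fil L j" for j
    by (rule fil_monoD[OF assms[of "nat j"]]) simp
  then show ?thesis using fil_separated by blast
qed

text \<open>
  The shift \<open>c\<close> lets the same lemma serve iterations whose first correction has an
  arbitrary degree.
\<close>

lemma limit:
  assumes carr: "\<And>r. s r \<in> carr L"
    and step: "\<And>r. s (Suc r) - s r \<in> fil L (int r + c)"
  shows "\<exists>l\<in>carr L. \<forall>r. s r - l \<in> fil L (int r + c)"
proof -
  have tail: "s t - s r \<in> fil L (int r + c)" if "r \<le> t" for r t
    using that
  proof (induction t rule: dec_induct)
    case base
    then show ?case using fil_0 by simp
  next
    case (step t)
    have "s (Suc t) - s t \<in> fil L (int r + c)"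
      using assms(2)[of t] fil_mono[of "int r + c" "int t + c"] step by auto
    then have "(s (Suc t) - s t) + (s t - s r) \<in> fil L (int r + c)"
      using step fil_add by blast
    then show ?case by simp
  qed
  have "\<exists>l\<in>carr L. \<forall>k. \<exists>N. \<forall>r\<ge>N. s r - l \<in> fil L k"
  proof (rule fil_complete)
    show "range s \<subseteq> carr L" using carr by blast
    show "\<forall>k. \<exists>N. \<forall>r\<ge>N. \<forall>t\<ge>N. s r - s t \<in> fil L k"
    proof
      fix k
      let ?N = "nat (k - c)"
      have "s r - s ?N \<in> fil L k" if "r \<ge> ?N" for r
        by (rule fil_monoD[OF tail[OF that]]) simp
      then have "(s r - s ?N) - (s t - s ?N) \<in> fil L k" if "r \<ge> ?N" "t \<ge> ?N" for r t
        using that fil_diff by blast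
      then show "\<exists>N. \<forall>r\<ge>N. \<forall>t\<ge>N. s r - s t \<in> fil L k" by auto
    qed
  qed
  then obtain l where l: "l \<in> carr L" "\<And>k. \<exists>N. \<forall>r\<ge>N. s r - l \<in> fil L k" by blast
  have "s r - l \<in> fil L (int r + c)" for r
  proof -
    obtain N where "\<And>t. t \<ge> N \<Longrightarrow> s t - l \<in> fil L (int r + c)" using l(2) by blast
    then have "s (max N r) - l \<in> fil L (int r + c)" by simp
    moreover have "s (max N r) - s r \<in> fil L (int r + c)" using tail by simp
    ultimately have "(s (max N r) - l) - (s (max N r) - s r) \<in> fil L (int r + c)"
      using fil_diff by blast
    then show ?thesis by simp
  qed
  then show ?thesis using l by blast
qed

text \<open>
  The part of \<open>l\<close> of the wrong parity is also a part of every difference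
  \<open>s r - l\<close>, hence lies arbitrarily deep in the filtration.
\<close>

lemma par_closed:
  assumes "l \<in> carr L" "\<And>r. s r \<in> par L a" "\<And>r. s r - l \<in> fil L (int r + c)"
  shows "l \<in> par L a"
proof -
  obtain y z where yz: "y \<in> par L a" "z \<in> par L (a + 1)" "l = y + z"
  proof -
    obtain y z where "y \<in> par L 0" "z \<in> par L 1" "l = y + z" using par_decomp assms(1) by blast
    moreover from this have "l = z + y" by (simp add: add.commute)
    ultimately show thesis using that[of y z] that[of z y] by (cases a) auto
  qed
  have "z \<in> fil L (int r + c)" for r
  proof -
    have "- z + (s r - y) \<in> fil L (int r + c)" using assms(3)[of r] yz by (simp add: algebra_simps)
    moreover have "- z \<in> par L (a + 1)" "s r - y \<in> par L (a + 1 + 1)"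
      using yz assms(2) par_neg par_diff by (auto simp: add.assoc)
    ultimately have "- z \<in> fil L (int r + c)" using fil_par_component by blast
    then show ?thesis using fil_neg by fastforce
  qed
  then have "z \<in> fil L (int k)" for k
    by (rule fil_monoD[of _ "int (nat (int k - c)) + c"]) simp
  then have "z = 0" by (rule separated)
  then show ?thesis using yz by simp
qed

lemma fil_closed:
  assumes "\<And>r. s r \<in> fil L j" "\<And>r. s r - l \<in> fil L (int r + c)"
  shows "l \<in> fil L j"
proof -
  have "s (nat (j - c)) - l \<in> fil L j"
    by (rule fil_monoD[OF assms(2)]) simp
  then have "s (nat (j - c)) - (s (nat (j - c)) - l) \<in> fil L j" using assms(1) fil_diff by blast
  then show ?thesis by simp
qed

end

section \<open>Supercommuting lifts of the part of degree -1\<close>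

lemma koszul_sign_commute: "koszul_sign a b = koszul_sign b a"
  by (auto simp: koszul_sign_def)

lemma koszul_sign_square [simp]: "koszul_sign a b * koszul_sign a b = 1"
  by (auto simp: koszul_sign_def)

text \<open>
  The properties of \<open>H(2n,m)\<close> that force its deformations to be trivial. In the
  application \<open>i \<in> I\<close> runs through the variables, bracketing with
  \<open>e i\<close> is the derivative in the direction \<open>i\<close>, and families indexed by
  \<open>I\<close> and \<open>I \<times> I\<close> are one-forms and two-forms. Thus
  \<open>transitive\<close> says that a function with vanishing derivatives is constant, and
  \<open>closed_1_exact\<close> and \<open>closed_2_exact\<close> are Poincare lemmas, stated for
  the degrees in which no constant can interfere. In \<open>torsion_exact\<close> the values have
  degree -1, and closedness could not be expressed by brackets, because derivatives of linear
  functions are zero in \<open>G\<close>; it is replaced by the equation that expresses the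
  invariance of \<open>F\<close> under \<open>h\<close> up to the exterior derivative of some
  \<open>a\<close>.
\<close>

locale prolongation = deformation L G \<phi>
  for L :: "('a::ab_group_add, 'z) filtered_superalgebra_scheme"
    and G :: "('b::ab_group_add, 'y) graded_superalgebra_scheme" and \<phi> +
  fixes I :: "'i set" and e :: "'i \<Rightarrow> 'b" and pr :: "'i \<Rightarrow> bit"
    and h :: 'b and u :: "'i \<Rightarrow> complex"
  assumes finite_I: "finite I"
    and e_comp: "i \<in> I \<Longrightarrow> e i \<in> comp G (- 1)"
    and e_par: "i \<in> I \<Longrightarrow> e i \<in> par G (pr i)"
    and e_span: "v \<in> comp G (- 1) \<Longrightarrow> \<exists>c. v = (\<Sum>i\<in>I. smul G (c i) (e i))"
    and comp_trivial: "j < - 1 \<Longrightarrow> comp G j = {0}"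
    and transitive: "\<lbrakk>0 \<le> j; v \<in> comp G j; \<And>i. i \<in> I \<Longrightarrow> brk G (e i) v = 0\<rbrakk> \<Longrightarrow> v = 0"
    and closed_1_exact: "\<lbrakk>1 \<le> j; \<And>i. i \<in> I \<Longrightarrow> f i \<in> comp G (j - 1);
        \<And>i k. \<lbrakk>i \<in> I; k \<in> I\<rbrakk> \<Longrightarrow>
          brk G (e i) (f k) = smul G (koszul_sign (pr i) (pr k)) (brk G (e k) (f i))\<rbrakk> \<Longrightarrow>
        \<exists>v\<in>comp G j. \<forall>i\<in>I. brk G (e i) v = f i"
    and closed_2_exact: "\<lbrakk>0 \<le> d;
        \<And>i j. \<lbrakk>i \<in> I; j \<in> I\<rbrakk> \<Longrightarrow> F i j \<in> comp G d \<inter> par G (pr i + pr j);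
        \<And>i j. \<lbrakk>i \<in> I; j \<in> I\<rbrakk> \<Longrightarrow> F i j = - smul G (koszul_sign (pr i) (pr j)) (F j i);
        \<And>i j k. \<lbrakk>i \<in> I; j \<in> I; k \<in> I\<rbrakk> \<Longrightarrow>
          brk G (e i) (F j k) - smul G (koszul_sign (pr i) (pr j)) (brk G (e j) (F i k))
            + smul G (koszul_sign (pr i + pr j) (pr k)) (brk G (e k) (F i j)) = 0\<rbrakk> \<Longrightarrow>
        \<exists>T. (\<forall>i\<in>I. T i \<in> comp G (d + 1) \<inter> par G (pr i)) \<and>
          (\<forall>i\<in>I. \<forall>j\<in>I. brk G (e i) (T j)
              - smul G (koszul_sign (pr i) (pr j)) (brk G (e j) (T i)) = F i j)"
    and h_comp: "h \<in> comp G 0"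
    and h_par: "h \<in> par G 0"
    and h_weight: "i \<in> I \<Longrightarrow> brk G (e i) h = smul G (u i) (e i)"
    and torsion_exact: "\<lbrakk>
        \<And>i j. \<lbrakk>i \<in> I; j \<in> I\<rbrakk> \<Longrightarrow> F i j \<in> comp G (- 1) \<inter> par G (pr i + pr j);
        \<And>i j. \<lbrakk>i \<in> I; j \<in> I\<rbrakk> \<Longrightarrow> F i j = - smul G (koszul_sign (pr i) (pr j)) (F j i);
        \<And>i. i \<in> I \<Longrightarrow> a i \<in> comp G 0;
        \<And>i j. \<lbrakk>i \<in> I; j \<in> I\<rbrakk> \<Longrightarrow>
          brk G (F i j) h = smul G (u i + u j) (F i j)
            + (brk G (e i) (a j) - smul G (koszul_sign (pr i) (pr j)) (brk G (e j) (a i)))\<rbrakk> \<Longrightarrow>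
        \<exists>T. (\<forall>i\<in>I. T i \<in> comp G 0 \<inter> par G (pr i)) \<and>
          (\<forall>i\<in>I. \<forall>j\<in>I. brk G (e i) (T j)
              - smul G (koszul_sign (pr i) (pr j)) (brk G (e j) (T i)) = F i j)"
begin

text \<open>
  The order \<open>d\<close> measures how far the lifts of the \<open>e i\<close> are from
  supercommuting.
\<close>

definition flat_to_order :: "int \<Rightarrow> ('i \<Rightarrow> 'a) \<Rightarrow> bool" where
  "flat_to_order d X \<longleftrightarrow> (\<forall>i\<in>I. X i \<in> par L (pr i) \<and> symbol (- 1) (X i) = e i) \<and>
     (\<forall>i\<in>I. \<forall>j\<in>I. brk L (X i) (X j) \<in> fil L d)"

text \<open>
  The Jacobi identity of three lifts, read off in degree \<open>d - 1\<close>, is the closedness of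
  the two-form of the symbols of their brackets.
\<close>

lemma flat_to_order_closed:
  assumes X: "flat_to_order d X" and "0 \<le> d" and I: "i \<in> I" "j \<in> I" "k \<in> I"
  defines "F \<equiv> \<lambda>i j. symbol d (brk L (X i) (X j))"
  shows "brk G (e i) (F j k) - smul G (koszul_sign (pr i) (pr j)) (brk G (e j) (F i k))
            + smul G (koszul_sign (pr i + pr j) (pr k)) (brk G (e k) (F i j)) = 0"
proof -
  have par: "X l \<in> par L (pr l)" and sym: "symbol (-1) (X l) = e l" if "l \<in> I" for l
    using X that unfolding flat_to_order_def by auto
  have carr: "X l \<in> fil L (-1)" if "l \<in> I" for l
    using par_carrD[OF par] that by (simp add: fil_minus1)
  have br: "brk L (X l) (X l') \<in> fil L d" if "l \<in> I" "l' \<in> I" for l l'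
    using X that unfolding flat_to_order_def by auto
  have br2: "brk L (X l) (brk L (X l') (X l'')) \<in> fil L (d - 1)" if "l \<in> I" "l' \<in> I" "l'' \<in> I" for l l' l''
    using fil_brk[OF carr br, of l l' l''] that by simp
  have sb: "symbol (d - 1) (brk L (X l) (brk L (X l') (X l''))) = brk G (e l) (F l' l'')"
    if "l \<in> I" "l' \<in> I" "l'' \<in> I" for l l' l''
    using symbol_brk'[OF carr br, of l l' l'' "d - 1"] that sym by (simp add: F_def)
  have "brk L (X i) (brk L (X j) (X k)) =
      brk L (brk L (X i) (X j)) (X k) + smul L (koszul_sign (pr i) (pr j)) (brk L (X j) (brk L (X i) (X k)))"
    using super_jacobi[OF par par] I par par_carrD by blast
  moreover have "brk L (brk L (X i) (X j)) (X k) =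
      - smul L (koszul_sign (pr i + pr j) (pr k)) (brk L (X k) (brk L (X i) (X j)))"
    using super_antisym[OF brk_par[OF par par] par] I by blast
  ultimately have "brk L (X i) (brk L (X j) (X k)) - smul L (koszul_sign (pr i) (pr j)) (brk L (X j) (brk L (X i) (X k)))
      + smul L (koszul_sign (pr i + pr j) (pr k)) (brk L (X k) (brk L (X i) (X j))) = 0"
    by simp
  then have "symbol (d - 1) (brk L (X i) (brk L (X j) (X k)) - smul L (koszul_sign (pr i) (pr j)) (brk L (X j) (brk L (X i) (X k)))
      + smul L (koszul_sign (pr i + pr j) (pr k)) (brk L (X k) (brk L (X i) (X j)))) = 0"
    by (simp only: symbol_0)
  then show ?thesis
    using I by (simp add: symbol_add symbol_diff symbol_scale fil_diff fil_scale br2 sb)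
qed

text \<open>
  Let \<open>H\<close> lift \<open>h\<close>. As \<open>e i\<close> is an eigenvector of
  \<open>h\<close>, the lift \<open>X i\<close> is one of \<open>H\<close> up to an error
  \<open>A i \<in> L\<^sub>0\<close>, and the errors enter the Jacobi identity of
  \<open>X i\<close>, \<open>X j\<close>, \<open>H\<close> only through derivatives of their
  symbols.
\<close>

lemma flat_to_order_torsion:
  assumes X: "flat_to_order (-1) X"
  defines "F \<equiv> \<lambda>i j. symbol (-1) (brk L (X i) (X j))"
  shows "\<exists>a. (\<forall>i\<in>I. a i \<in> comp G 0) \<and> (\<forall>i\<in>I. \<forall>j\<in>I.
     brk G (F i j) h = smul G (u i + u j) (F i j)
        + (brk G (e i) (a j) - smul G (koszul_sign (pr i) (pr j)) (brk G (e j) (a i))))"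
proof -
  have par: "X l \<in> par L (pr l)" and sym: "symbol (-1) (X l) = e l" if "l \<in> I" for l
    using X that unfolding flat_to_order_def by auto
  have carr: "X l \<in> fil L (-1)" if "l \<in> I" for l
    using par_carrD[OF par] that by (simp add: fil_minus1)
  note carr' = carr[unfolded fil_minus1]
  obtain H where H: "H \<in> fil L 0" "H \<in> par L 0" "h = symbol 0 H"
    using lift_parE[OF h_comp h_par] by blast
  have Hc: "H \<in> carr L" using H fil_carrD by blast
  define A where "A i = brk L (X i) H - smul L (u i) (X i)" for i
  have A: "A i \<in> fil L 0" if "i \<in> I" for i
  proof -
    have "brk L (X i) H \<in> fil L (-1)" using fil_brk[OF carr H(1)] that by simp
    moreover have "symbol (-1) (brk L (X i) H) = symbol (-1) (smul L (u i) (X i))"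
      using symbol_brk'[OF carr H(1), of i "-1"] that h_weight[OF that] sym carr symbol_scale H
      by simp
    ultimately show ?thesis unfolding A_def
      using symbol_eq_iff[of _ "-1"] carr[OF that] fil_scale by auto
  qed
  have Ac: "A i \<in> carr L" if "i \<in> I" for i using A that fil_carrD by blast
  have XH: "brk L (X i) H = smul L (u i) (X i) + A i" for i unfolding A_def by simp
  have "brk G (F i j) h = smul G (u i + u j) (F i j)
        + (brk G (e i) (symbol 0 (A j)) - smul G (koszul_sign (pr i) (pr j)) (brk G (e j) (symbol 0 (A i))))"
    if I: "i \<in> I" "j \<in> I" for i j
  proof -
    let ?k = "koszul_sign (pr i) (pr j)"
    have J: "brk L (X i) (brk L (X j) H) =
      brk L (brk L (X i) (X j)) H + smul L ?k (brk L (X j) (brk L (X i) H))"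
      using super_jacobi[OF par par Hc] I by blast
    have as: "smul L ?k (brk L (X j) (X i)) = - brk L (X i) (X j)"
      using super_antisym[OF par[OF I(1)] par[OF I(2)]] by simp
    have ad_XH: "brk L (X k) (brk L (X l) H) = smul L (u l) (brk L (X k) (X l)) + brk L (X k) (A l)"
      if "k \<in> I" "l \<in> I" for k l
      unfolding XH brk_add_right[OF carr'[OF that(1)] carr_scale[OF carr'[OF that(2)]] Ac[OF that(2)]]
      by (simp only: brk_smul_right[OF carr'[OF that(1)] carr'[OF that(2)]])
    note e1 = ad_XH[OF I]
    have "smul L ?k (brk L (X j) (brk L (X i) H))
        = smul L ?k (smul L (u i) (brk L (X j) (X i))) + smul L ?k (brk L (X j) (A i))"
      by (simp only: ad_XH[OF I(2,1)] scale_right_distrib)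
    also have "smul L ?k (smul L (u i) (brk L (X j) (X i))) = smul L (u i) (smul L ?k (brk L (X j) (X i)))"
      by (simp only: scale_scale mult.commute)
    also have "\<dots> = - smul L (u i) (brk L (X i) (X j))" unfolding as by (simp only: scale_minus_right)
    finally have e2: "smul L ?k (brk L (X j) (brk L (X i) H)) =
       - smul L (u i) (brk L (X i) (X j)) + smul L ?k (brk L (X j) (A i))" .
    have "brk L (brk L (X i) (X j)) H = brk L (X i) (brk L (X j) H) - smul L ?k (brk L (X j) (brk L (X i) H))"
      using J by simp
    also have "\<dots> = smul L (u i + u j) (brk L (X i) (X j)) + (brk L (X i) (A j) - smul L ?k (brk L (X j) (A i)))"
      unfolding e1 e2 by (simp add: scale_left_distrib)
    finally have E: "brk L (brk L (X i) (X j)) H = \<dots>" .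
    have m: "brk L (X i) (X j) \<in> fil L (-1)" "brk L (X i) (A j) \<in> fil L (-1)" "brk L (X j) (A i) \<in> fil L (-1)"
      using fil_brk[OF carr A] I brk_carr carr' by (auto simp: fil_minus1)
    have "brk G (F i j) h = symbol (-1) (brk L (brk L (X i) (X j)) H)"
      using symbol_brk'[OF m(1) H(1), of "-1"] H by (simp add: F_def)
    also have "\<dots> = smul G (u i + u j) (F i j) + (symbol (-1) (brk L (X i) (A j)) - smul G ?k (symbol (-1) (brk L (X j) (A i))))"
      unfolding E using m by (simp add: symbol_add symbol_diff symbol_scale fil_diff fil_scale F_def)
    also have "symbol (-1) (brk L (X i) (A j)) = brk G (e i) (symbol 0 (A j))"
      using symbol_brk'[OF carr A, of i j "-1"] I sym by simp
    also have "symbol (-1) (brk L (X j) (A i)) = brk G (e j) (symbol 0 (A i))"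
      using symbol_brk'[OF carr A, of j i "-1"] I sym by simp
    finally show ?thesis .
  qed
  then show ?thesis using A symbol_in by (intro exI[of _ "\<lambda>i. symbol 0 (A i)"]) blast
qed

text \<open>
  If \<open>T\<close> is a primitive of the two-form of the symbols of the brackets and
  \<open>S\<close> lifts \<open>T\<close>, the terms \<open>[X i, S j]\<close> and
  \<open>[S i, X j]\<close> cancel these symbols, while \<open>[S i, S j]\<close> has degree at
  least \<open>2d + 2 \<ge> d + 1\<close>.
\<close>

lemma flat_to_order_improve:
  assumes X: "flat_to_order d X" and d: "- 1 \<le> d"
  shows "\<exists>X'. flat_to_order (d + 1) X' \<and> (\<forall>i\<in>I. X' i - X i \<in> fil L (d + 1))"
proof -
  define F where "F i j = symbol d (brk L (X i) (X j))" for i j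
  have par: "X l \<in> par L (pr l)" and sym: "symbol (-1) (X l) = e l" if "l \<in> I" for l
    using X that unfolding flat_to_order_def by auto
  have carr: "X l \<in> fil L (-1)" if "l \<in> I" for l
    using par_carrD[OF par] that by (simp add: fil_minus1)
  note carr' = carr[unfolded fil_minus1]
  have br: "brk L (X i) (X j) \<in> fil L d" if "i \<in> I" "j \<in> I" for i j
    using X that unfolding flat_to_order_def by auto
  have F1: "F i j \<in> comp G d \<inter> par G (pr i + pr j)" if "i \<in> I" "j \<in> I" for i j
    unfolding F_def using symbol_in[OF br] symbol_par[OF br brk_par[OF par par]] that by blast
  have F2: "F i j = - smul G (koszul_sign (pr i) (pr j)) (F j i)" if "i \<in> I" "j \<in> I" for i j
  proof -
    have "F i j = symbol d (- smul L (koszul_sign (pr i) (pr j)) (brk L (X j) (X i)))"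
      unfolding F_def using super_antisym[OF par[OF that(1)] par[OF that(2)]] by (rule arg_cong)
    then show ?thesis
      unfolding F_def using br[OF that(2,1)] by (simp add: symbol_neg symbol_scale fil_scale)
  qed
  obtain T where T: "\<And>i. i \<in> I \<Longrightarrow> T i \<in> comp G (d + 1)" "\<And>i. i \<in> I \<Longrightarrow> T i \<in> par G (pr i)"
    "\<And>i j. \<lbrakk>i \<in> I; j \<in> I\<rbrakk> \<Longrightarrow> brk G (e i) (T j)
              - smul G (koszul_sign (pr i) (pr j)) (brk G (e j) (T i)) = F i j"
  proof (cases "d = -1")
    case True
    obtain a where a: "\<And>i. i \<in> I \<Longrightarrow> a i \<in> comp G 0"
      "\<And>i j. \<lbrakk>i \<in> I; j \<in> I\<rbrakk> \<Longrightarrow> brk G (F i j) h = smul G (u i + u j) (F i j)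
        + (brk G (e i) (a j) - smul G (koszul_sign (pr i) (pr j)) (brk G (e j) (a i)))"
      using flat_to_order_torsion[of X] X True unfolding F_def by blast
    have "\<exists>T. (\<forall>i\<in>I. T i \<in> comp G 0 \<inter> par G (pr i)) \<and>
          (\<forall>i\<in>I. \<forall>j\<in>I. brk G (e i) (T j)
              - smul G (koszul_sign (pr i) (pr j)) (brk G (e j) (T i)) = F i j)"
      using torsion_exact[OF F1[unfolded True] F2 a] by blast
    then show ?thesis using that True by auto
  next
    case False
    then have "0 \<le> d" using d by simp
    have "\<exists>T. (\<forall>i\<in>I. T i \<in> comp G (d + 1) \<inter> par G (pr i)) \<and>
          (\<forall>i\<in>I. \<forall>j\<in>I. brk G (e i) (T j)
              - smul G (koszul_sign (pr i) (pr j)) (brk G (e j) (T i)) = F i j)"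
      by (rule closed_2_exact[OF \<open>0 \<le> d\<close> F1 F2 flat_to_order_closed[OF X \<open>0 \<le> d\<close>, folded F_def]])
    then show ?thesis using that by auto
  qed
  have "\<exists>s. s \<in> fil L (d + 1) \<and> s \<in> par L (pr i) \<and> symbol (d + 1) s = T i" if "i \<in> I" for i
    using lift_parE[OF T(1,2)] that by metis
  then obtain S where S: "\<And>i. i \<in> I \<Longrightarrow> S i \<in> fil L (d + 1)" "\<And>i. i \<in> I \<Longrightarrow> S i \<in> par L (pr i)"
    "\<And>i. i \<in> I \<Longrightarrow> symbol (d + 1) (S i) = T i" by metis
  have Sc: "S i \<in> carr L" if "i \<in> I" for i using S(1) that fil_carrD by blast
  have S0: "S i \<in> fil L 0" if "i \<in> I" for i using S(1) that fil_mono[of 0 "d + 1"] d by auto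
  have "brk L (X i - S i) (X j - S j) \<in> fil L (d + 1)" if I: "i \<in> I" "j \<in> I" for i j
  proof -
    let ?k = "koszul_sign (pr i) (pr j)"
    let ?B = "brk L (X i) (X j) - (brk L (X i) (S j) - smul L ?k (brk L (X j) (S i)))"
    have m: "brk L (X i) (S j) \<in> fil L d" "brk L (X j) (S i) \<in> fil L d"
      using fil_brk[OF carr[OF I(1)] S(1)[OF I(2)]] fil_brk[OF carr[OF I(2)] S(1)[OF I(1)]] by simp_all
    have sm: "symbol d (brk L (X i) (S j)) = brk G (e i) (T j)"
      "symbol d (brk L (X j) (S i)) = brk G (e j) (T i)"
      using symbol_brk'[OF carr[OF I(1)] S(1)[OF I(2)], of d]
        symbol_brk'[OF carr[OF I(2)] S(1)[OF I(1)], of d] I sym S(3) by simp_all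
    have "symbol d ?B = F i j - (brk G (e i) (T j) - smul G ?k (brk G (e j) (T i)))"
      using m br I by (simp add: symbol_diff symbol_scale fil_diff fil_scale sm F_def)
    then have "symbol d ?B = 0" using T(3) I by simp
    moreover have "?B \<in> fil L d" by (intro fil_diff fil_scale m br I)
    ultimately have "?B \<in> fil L (d + 1)" using symbol_eq_0_iff by blast
    moreover have "brk L (S i) (S j) \<in> fil L (d + 1)"
      using fil_brk[OF S0 S(1), of i j] I by simp
    moreover have "brk L (X i - S i) (X j - S j) = ?B + brk L (S i) (S j)"
    proof -
      have "brk L (S i) (X j) = - smul L ?k (brk L (X j) (S i))"
        by (rule super_antisym[OF S(2)[OF I(1)] par[OF I(2)]])
      then show ?thesis
        using carr'[OF I(1)] carr'[OF I(2)] Sc[OF I(1)] Sc[OF I(2)]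
        by (simp add: brk_diff_left brk_diff_right carr_diff)
    qed
    ultimately show ?thesis using fil_add by simp
  qed
  moreover have "X i - S i \<in> par L (pr i)" if "i \<in> I" for i
    using par S(2) that par_diff by blast
  moreover have "symbol (-1) (X i - S i) = e i" if "i \<in> I" for i
  proof -
    have "X i - S i \<in> fil L (-1)" using carr'[OF that] Sc[OF that] carr_diff by (simp add: fil_minus1)
    then have "symbol (-1) (X i - S i) = symbol (-1) (X i)"
      using symbol_eq_iff[of "X i - S i" "-1" "X i"] carr[OF that] fil_neg[OF S0[OF that]] by simp
    then show ?thesis using sym that by simp
  qed
  ultimately have "flat_to_order (d + 1) (\<lambda>i. X i - S i)" unfolding flat_to_order_def by blast
  moreover have "(X i - S i) - X i \<in> fil L (d + 1)" if "i \<in> I" for i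
    using fil_neg[OF S(1)[OF that]] by simp
  ultimately show ?thesis by blast
qed

lemma commuting_lifts:
  obtains X where "\<And>i. i \<in> I \<Longrightarrow> X i \<in> par L (pr i)" "\<And>i. i \<in> I \<Longrightarrow> symbol (- 1) (X i) = e i"
    "\<And>i j. \<lbrakk>i \<in> I; j \<in> I\<rbrakk> \<Longrightarrow> brk L (X i) (X j) = 0"
proof -
  have "\<exists>x. x \<in> par L (pr i) \<and> symbol (-1) x = e i" if "i \<in> I" for i
    using lift_parE[OF e_comp e_par] that by metis
  then obtain X0 where X0: "\<And>i. i \<in> I \<Longrightarrow> X0 i \<in> par L (pr i) \<and> symbol (-1) (X0 i) = e i" by metis
  moreover from this have "X0 i \<in> carr L" if "i \<in> I" for i using that par_carrD by blast
  ultimately have "flat_to_order (-1) X0"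
    unfolding flat_to_order_def by (simp add: fil_minus1 brk_carr)
  then have "\<exists>Y. \<forall>r. flat_to_order (int r - 1) (Y r) \<and> (\<forall>i\<in>I. Y (Suc r) i - Y r i \<in> fil L (int r))"
    using flat_to_order_improve[of "int _ - 1"] by (intro dependent_nat_choice) auto
  then obtain Y where Y: "\<And>r. flat_to_order (int r - 1) (Y r)"
    "\<And>r. \<forall>i\<in>I. Y (Suc r) i - Y r i \<in> fil L (int r)" by blast
  have Yp: "Y r i \<in> par L (pr i)" "symbol (-1) (Y r i) = e i" if "i \<in> I" for r i
    using Y(1)[of r] that unfolding flat_to_order_def by auto
  have Yc: "Y r i \<in> carr L" if "i \<in> I" for r i using Yp that par_carrD by blast
  have "\<exists>l\<in>carr L. \<forall>r. Y r i - l \<in> fil L (int r + 0)" if "i \<in> I" for i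
    using Y(2) Yc that by (intro limit) auto
  then obtain X where X: "\<And>i. i \<in> I \<Longrightarrow> X i \<in> carr L" "\<And>i r. i \<in> I \<Longrightarrow> Y r i - X i \<in> fil L (int r)"
    by simp metis
  show thesis
  proof (rule that)
    fix i assume i: "i \<in> I"
    show "X i \<in> par L (pr i)"
      using par_closed[of "X i" "\<lambda>r. Y r i" "pr i" 0] X Yp i by simp
    have "Y 0 i - X i \<in> fil L (-1 + 1)" using X(2)[OF i, of 0] by simp
    then show "symbol (-1) (X i) = e i"
      using symbol_eq_iff[of "Y 0 i" "-1" "X i"] Yc[OF i] X(1)[OF i] Yp(2)[OF i, of 0] by (simp add: fil_minus1)
  next
    fix i j assume I: "i \<in> I" "j \<in> I"
    have "brk L (X i) (X j) \<in> fil L (int k)" for k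
    proof -
      let ?r = "Suc k"
      define V where "V i = Y ?r i - X i" for i
      have V: "V i \<in> fil L (int k + 1)" if "i \<in> I" for i
        using X(2)[OF that, of ?r] by (simp add: V_def algebra_simps)
      have Xe: "X i = Y ?r i - V i" for i unfolding V_def by simp
      have Vc: "V i \<in> carr L" if "i \<in> I" for i using V that fil_carrD by blast
      have V0: "V i \<in> fil L 0" if "i \<in> I" for i using V that fil_mono[of 0 "int k + 1"] by auto
      have Yf: "Y ?r i \<in> fil L (-1)" if "i \<in> I" for i using Yc that by (simp add: fil_minus1)
      have m: "brk L (Y ?r i) (Y ?r j) \<in> fil L (int k)"
        using Y(1)[of ?r] I unfolding flat_to_order_def by simp
      have m2: "brk L (Y ?r i) (V j) \<in> fil L (int k)" "brk L (V i) (Y ?r j) \<in> fil L (int k)"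
        using fil_brk[OF Yf V, of i j] fil_brk[OF V Yf, of i j] I by auto
      have m3: "brk L (V i) (V j) \<in> fil L (int k)"
        using fil_brk[OF V0 V, of i j] I fil_mono[of "int k" "int k + 1"] by auto
      have "brk L (X i) (X j) = brk L (Y ?r i) (Y ?r j) - brk L (Y ?r i) (V j)
          - (brk L (V i) (Y ?r j) - brk L (V i) (V j))"
        unfolding Xe using I Vc Yc by (simp add: brk_diff_left brk_diff_right carr_diff)
      then show ?thesis using m m2 m3 fil_diff by simp
    qed
    then show "brk L (X i) (X j) = 0" by (rule separated)
  qed
qed

end

section \<open>Taylor expansion along supercommuting lifts\<close>

locale flat_frame = prolongation L G \<phi> I e pr h u
  for L :: "('a::ab_group_add, 'z) filtered_superalgebra_scheme"
    and G :: "('b::ab_group_add, 'y) graded_superalgebra_scheme" and \<phi>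
    and I :: "'i set" and e pr h u +
  fixes X :: "'i \<Rightarrow> 'a"
  assumes X_par: "i \<in> I \<Longrightarrow> X i \<in> par L (pr i)"
    and X_symbol: "i \<in> I \<Longrightarrow> symbol (- 1) (X i) = e i"
    and X_commute: "\<lbrakk>i \<in> I; j \<in> I\<rbrakk> \<Longrightarrow> brk L (X i) (X j) = 0"
begin

lemma X_carr: "i \<in> I \<Longrightarrow> X i \<in> carr L"
  using X_par par_carrD by blast

lemma X_fil: "i \<in> I \<Longrightarrow> X i \<in> fil L (- 1)"
  using X_carr by (simp add: fil_minus1)

lemma X_brk_carr: "\<lbrakk>i \<in> I; y \<in> carr L\<rbrakk> \<Longrightarrow> brk L (X i) y \<in> carr L"
  using X_carr brk_carr by blast

text \<open>
  The index is shifted by one: \<open>taylor k y\<close> is the component of degree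
  \<open>k - 1\<close>. Its existence and uniqueness are established below, so the description
  operator is only a convenience.
\<close>

primrec taylor :: "nat \<Rightarrow> 'a \<Rightarrow> 'b" where
  "taylor 0 y = symbol (- 1) y"
| "taylor (Suc k) y =
    (THE v. v \<in> comp G (int k) \<and> (\<forall>i\<in>I. brk G (e i) v = taylor k (brk L (X i) y)))"

declare taylor.simps [simp del]

lemma taylor_SucI:
  assumes "v \<in> comp G (int k)" "\<And>i. i \<in> I \<Longrightarrow> brk G (e i) v = taylor k (brk L (X i) y)"
  shows "taylor (Suc k) y = v"
  unfolding taylor.simps(2)
proof (rule the_equality)
  show "v \<in> comp G (int k) \<and> (\<forall>i\<in>I. brk G (e i) v = taylor k (brk L (X i) y))"
    using assms by blast
  fix w assume w: "w \<in> comp G (int k) \<and> (\<forall>i\<in>I. brk G (e i) w = taylor k (brk L (X i) y))"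
  have "w - v = 0"
  proof (rule transitive)
    show "w - v \<in> comp G (int k)" using w assms comp_diff by blast
    show "brk G (e i) (w - v) = 0" if "i \<in> I" for i
      using G_brk_diff_right[OF e_comp[OF that] conjunct1[OF w] assms(1)] w assms(2) that by simp
  qed simp
  then show "w = v" by simp
qed

text \<open>
  The symbol of degree -1 vanishes exactly on \<open>L\<^sub>0\<close>, so the lifts span a
  complement of \<open>L\<^sub>0\<close> in \<open>L\<close>.
\<close>

lemma carr_decomp:
  assumes "y \<in> carr L"
  obtains c y' where "y' \<in> fil L 0" "y = (\<Sum>i\<in>I. smul L (c i) (X i)) + y'"
proof -
  have "symbol (-1) y \<in> comp G (-1)" using symbol_in assms by (simp add: fil_minus1)
  then obtain c where c: "symbol (-1) y = (\<Sum>i\<in>I. smul G (c i) (e i))" using e_span by blast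
  let ?s = "\<Sum>i\<in>I. smul L (c i) (X i)"
  have s: "?s \<in> fil L (-1)" by (intro fil_sum fil_scale X_fil)
  have "symbol (-1) ?s = (\<Sum>i\<in>I. smul G (c i) (e i))"
    using X_fil X_symbol by (simp add: symbol_sum symbol_scale fil_scale)
  then have "y - ?s \<in> fil L 0"
    using symbol_eq_iff[of y "-1" ?s] assms s c by (simp add: fil_minus1)
  then show thesis using that[of "y - ?s" c] by simp
qed

text \<open>
  Existence and linearity are proved together, since the closedness that yields existence in degree
  \<open>k\<close> comes from \<open>[X i, [X j, y]] = \<plusminus> [X j, [X i, y]]\<close> and
  needs \<open>taylor k\<close> to respect the sign. The lowest degree is separate: there
  \<open>closed_1_exact\<close> is not available, as a closed one-form with values in
  \<open>G\<^sub>-\<^sub>1\<close> need not be a derivative of an element of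
  \<open>G\<^sub>0\<close>. Instead, the symbol of the part of \<open>y\<close> in
  \<open>L\<^sub>0\<close> is a solution.
\<close>

lemma taylor_exists_linear:
  "(\<forall>y\<in>carr L. \<exists>v\<in>comp G (int k). \<forall>i\<in>I. brk G (e i) v = taylor k (brk L (X i) y)) \<and>
   (\<forall>y\<in>carr L. \<forall>z\<in>carr L. taylor k (y + z) = taylor k y + taylor k z) \<and>
   (\<forall>y\<in>carr L. \<forall>c. taylor k (smul L c y) = smul G c (taylor k y))"
proof (induction k)
  case 0
  have "\<exists>v\<in>comp G 0. \<forall>i\<in>I. brk G (e i) v = symbol (-1) (brk L (X i) y)" if y: "y \<in> carr L" for y
  proof -
    obtain c y' where y': "y' \<in> fil L 0" and yeq: "y = (\<Sum>i\<in>I. smul L (c i) (X i)) + y'"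
      using carr_decomp[OF y] .
    have sc: "(\<Sum>j\<in>I. smul L (c j) (X j)) \<in> carr L" by (intro carr_sum carr_scale X_carr)
    have "brk G (e i) (symbol 0 y') = symbol (-1) (brk L (X i) y)" if i: "i \<in> I" for i
    proof -
      have "brk L (X i) (\<Sum>j\<in>I. smul L (c j) (X j)) = 0"
        using i X_carr carr_scale X_commute by (simp add: brk_sum_right brk_smul_right)
      then have "brk L (X i) y = brk L (X i) y'"
        unfolding yeq using brk_add_right[OF X_carr[OF i] sc fil_carrD[OF y']] by simp
      then show ?thesis using symbol_brk'[OF X_fil[OF i] y', of "-1"] X_symbol[OF i] by simp
    qed
    then show ?thesis using symbol_in[OF y'] by blast
  qed
  then show ?case by (simp add: taylor.simps(1) symbol_add symbol_scale fil_minus1)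
next
  case (Suc k)
  have ex: "\<And>y. y \<in> carr L \<Longrightarrow> \<exists>v\<in>comp G (int k). \<forall>i\<in>I. brk G (e i) v = taylor k (brk L (X i) y)"
    by (rule bspec[OF conjunct1[OF Suc]])
  have add: "\<And>y z. \<lbrakk>y \<in> carr L; z \<in> carr L\<rbrakk> \<Longrightarrow> taylor k (y + z) = taylor k y + taylor k z"
    by (rule bspec[OF bspec[OF conjunct1[OF conjunct2[OF Suc]]]])
  have scale: "\<And>y c. y \<in> carr L \<Longrightarrow> taylor k (smul L c y) = smul G c (taylor k y)"
    by (rule spec[OF bspec[OF conjunct2[OF conjunct2[OF Suc]]]])
  have T: "taylor (Suc k) y \<in> comp G (int k) \<and>
      (\<forall>i\<in>I. brk G (e i) (taylor (Suc k) y) = taylor k (brk L (X i) y))" if y: "y \<in> carr L" for y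
  proof -
    obtain v where "v \<in> comp G (int k)" "\<forall>i\<in>I. brk G (e i) v = taylor k (brk L (X i) y)"
      using ex[OF y] by blast
    moreover from this have "taylor (Suc k) y = v" by (intro taylor_SucI) auto
    ultimately show ?thesis by simp
  qed
  have "\<exists>v\<in>comp G (int (Suc k)). \<forall>i\<in>I. brk G (e i) v = taylor (Suc k) (brk L (X i) y)"
    if y: "y \<in> carr L" for y
  proof (rule closed_1_exact)
    show "1 \<le> int (Suc k)" by simp
    show "taylor (Suc k) (brk L (X i) y) \<in> comp G (int (Suc k) - 1)" if "i \<in> I" for i
      using T[OF X_brk_carr[OF that y]] by simp
    fix i j assume I: "i \<in> I" "j \<in> I"
    let ?k = "koszul_sign (pr i) (pr j)"
    have "brk L (X i) (brk L (X j) y) = smul L ?k (brk L (X j) (brk L (X i) y))"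
      using super_jacobi[OF X_par X_par y, of i j] I X_commute y by (simp add: brk_0_left)
    then have "taylor k (brk L (X i) (brk L (X j) y)) = smul G ?k (taylor k (brk L (X j) (brk L (X i) y)))"
      using scale[OF X_brk_carr[OF I(2) X_brk_carr[OF I(1) y]]] by simp
    then show "brk G (e i) (taylor (Suc k) (brk L (X j) y)) =
        smul G ?k (brk G (e j) (taylor (Suc k) (brk L (X i) y)))"
      using T[OF X_brk_carr[OF I(1) y]] T[OF X_brk_carr[OF I(2) y]] I by simp
  qed
  moreover have "taylor (Suc k) (y + z) = taylor (Suc k) y + taylor (Suc k) z"
    if yz: "y \<in> carr L" "z \<in> carr L" for y z
  proof (rule taylor_SucI)
    show "taylor (Suc k) y + taylor (Suc k) z \<in> comp G (int k)" using T yz comp_add by blast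
    fix i assume i: "i \<in> I"
    have "brk G (e i) (taylor (Suc k) y + taylor (Suc k) z) =
        taylor k (brk L (X i) y) + taylor k (brk L (X i) z)"
      using G_brk_add_right[OF e_comp[OF i], of "taylor (Suc k) y" "int k" "taylor (Suc k) z"] T[OF yz(1)] T[OF yz(2)] i
      by simp
    then show "brk G (e i) (taylor (Suc k) y + taylor (Suc k) z) = taylor k (brk L (X i) (y + z))"
      using brk_add_right[OF X_carr[OF i] yz] add X_brk_carr i yz by simp
  qed
  moreover have "taylor (Suc k) (smul L c y) = smul G c (taylor (Suc k) y)" if y: "y \<in> carr L" for y c
  proof (rule taylor_SucI)
    show "smul G c (taylor (Suc k) y) \<in> comp G (int k)" using T[OF y] comp_scale by blast
    fix i assume i: "i \<in> I"
    show "brk G (e i) (smul G c (taylor (Suc k) y)) = taylor k (brk L (X i) (smul L c y))"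
      using G_brk_scale_right[OF e_comp[OF i], of "taylor (Suc k) y" "int k"] T[OF y] i
        brk_smul_right[OF X_carr[OF i] y] scale[OF X_brk_carr[OF i y]] by simp
  qed
  ultimately show ?case by blast
qed

lemma taylor_add: "\<lbrakk>y \<in> carr L; z \<in> carr L\<rbrakk> \<Longrightarrow> taylor k (y + z) = taylor k y + taylor k z"
  using taylor_exists_linear by blast

lemma taylor_scale: "y \<in> carr L \<Longrightarrow> taylor k (smul L c y) = smul G c (taylor k y)"
  using taylor_exists_linear by blast

lemma taylor_Suc:
  assumes "y \<in> carr L"
  shows "taylor (Suc k) y \<in> comp G (int k)"
    and "i \<in> I \<Longrightarrow> brk G (e i) (taylor (Suc k) y) = taylor k (brk L (X i) y)"
proof -
  obtain v where v: "v \<in> comp G (int k)" "\<forall>i\<in>I. brk G (e i) v = taylor k (brk L (X i) y)"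
    using taylor_exists_linear assms by meson
  then have "taylor (Suc k) y = v" by (intro taylor_SucI) auto
  then show "taylor (Suc k) y \<in> comp G (int k)"
    and "i \<in> I \<Longrightarrow> brk G (e i) (taylor (Suc k) y) = taylor k (brk L (X i) y)"
    using v by auto
qed

lemma taylor_comp:
  assumes "y \<in> carr L"
  shows "taylor k y \<in> comp G (int k - 1)"
proof (cases k)
  case 0
  then show ?thesis using symbol_in[of y "-1"] assms by (simp add: taylor.simps(1) fil_minus1)
next
  case (Suc k')
  then show ?thesis using taylor_Suc(1)[OF assms, of k'] by simp
qed

lemma taylor_0: "taylor k 0 = 0"
  using taylor_add[of 0 0 k] carr_0 by simp

lemma taylor_diff: "\<lbrakk>y \<in> carr L; z \<in> carr L\<rbrakk> \<Longrightarrow> taylor k (y - z) = taylor k y - taylor k z"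
  using taylor_add[of "y - z" z k] carr_diff by simp

text \<open>
  A component of the wrong parity would have derivatives of the wrong parity, which vanish by
  induction; so it vanishes by transitivity.
\<close>

lemma taylor_par: "y \<in> par L a \<Longrightarrow> taylor k y \<in> par G a"
proof (induction k arbitrary: y a)
  case 0
  then show ?case using symbol_par[of y "-1"] par_carrD by (simp add: taylor.simps(1) fil_minus1)
next
  case (Suc k)
  have y: "y \<in> carr L" using Suc.prems par_carrD by blast
  obtain v w where v: "v \<in> comp G (int k)" "v \<in> par G a"
    and w: "w \<in> comp G (int k)" "w \<in> par G (a + 1)" and s: "taylor (Suc k) y = v + w"
    using G_par_decomp[OF taylor_Suc(1)[OF y]] .
  have "w = 0"
  proof (rule transitive)
    fix i assume i: "i \<in> I"
    have we: "brk G (e i) w = taylor k (brk L (X i) y) - brk G (e i) v"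
      using taylor_Suc(2)[OF y i, of k] G_brk_add_right[OF e_comp[OF i] v(1) w(1)] s
      by (simp add: eq_diff_eq add.commute)
    have wc: "brk G (e i) w \<in> comp G (int k - 1)" and vc: "brk G (e i) v \<in> comp G (int k - 1)"
      using comp_brk[OF e_comp[OF i]] v w by auto
    have "taylor k (brk L (X i) y) \<in> par G (pr i + a)"
      using Suc.IH brk_par[OF X_par[OF i] Suc.prems] .
    then have "brk G (e i) w \<in> par G (pr i + a)"
      unfolding we using G_par_diff[OF taylor_comp[OF X_brk_carr[OF i y]] _ vc]
        G_par_brk[OF e_comp[OF i] e_par[OF i] v] by blast
    moreover have "brk G (e i) w \<in> par G (pr i + a + 1)"
      using G_par_brk[OF e_comp[OF i] e_par[OF i] w] by (simp add: add.assoc)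
    ultimately show "brk G (e i) w = 0" using G_par_disjoint[OF wc] by blast
  qed (use w in auto)
  then show ?case using s v by simp
qed

text \<open>
  The symbol satisfies the recursion of the Taylor components, because bracketing with
  \<open>X i\<close> induces bracketing with \<open>e i\<close> on symbols.
\<close>

lemma taylor_fil: "y \<in> fil L (int k - 1) \<Longrightarrow> taylor k y = symbol (int k - 1) y"
proof (induction k arbitrary: y)
  case 0
  then show ?case by (simp add: taylor.simps(1))
next
  case (Suc k)
  then have y: "y \<in> fil L (int k)" by simp
  have "taylor (Suc k) y = symbol (int k) y"
  proof (rule taylor_SucI)
    show "symbol (int k) y \<in> comp G (int k)" using symbol_in[OF y] .
    fix i assume i: "i \<in> I"
    have "brk L (X i) y \<in> fil L (int k - 1)" using fil_brk[OF X_fil[OF i] y] by simp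
    then show "brk G (e i) (symbol (int k) y) = taylor k (brk L (X i) y)"
      using Suc.IH symbol_brk'[OF X_fil[OF i] y, of "int k - 1"] X_symbol[OF i] by simp
  qed
  then show ?case by simp
qed

lemma taylor_vanish: "y \<in> fil L (int k) \<Longrightarrow> taylor k y = 0"
  using taylor_fil[of y k] symbol_eq_0_iff[of y "int k - 1"] fil_monoD[of y "int k" "int k - 1"] by simp

lemma taylor_X: "i \<in> I \<Longrightarrow> taylor (Suc k) (X i) = 0"
  by (rule taylor_SucI) (simp_all add: comp_0 G_brk_0_right[OF e_comp] X_commute taylor_0)

lemma taylor_sum: "(\<And>i. i \<in> S \<Longrightarrow> y i \<in> carr L) \<Longrightarrow> taylor k (\<Sum>i\<in>S. y i) = (\<Sum>i\<in>S. taylor k (y i))"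
  by (induction S rule: infinite_finite_induct) (simp_all add: taylor_0 taylor_add carr_sum)

text \<open>
  The component of degree \<open>s - 2\<close> of the bracket of two Taylor expansions, by the shift
  of the index.
\<close>

definition convolution :: "nat \<Rightarrow> 'a \<Rightarrow> 'a \<Rightarrow> 'b" where
  "convolution s y z = (\<Sum>a\<le>s. brk G (taylor a y) (taylor (s - a) z))"

lemma brk_taylor_comp:
  assumes "y \<in> carr L" "z \<in> carr L" "a \<le> s"
  shows "brk G (taylor a y) (taylor (s - a) z) \<in> comp G (int s - 2)"
  using comp_brk[OF taylor_comp[OF assms(1), of a] taylor_comp[OF assms(2), of "s - a"], of "int s - 2"]
    assms(3) by (simp add: of_nat_diff)

lemma convolution_comp: "\<lbrakk>y \<in> carr L; z \<in> carr L\<rbrakk> \<Longrightarrow> convolution s y z \<in> comp G (int s - 2)"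
  unfolding convolution_def by (intro comp_sum brk_taylor_comp) auto

lemma convolution_add_left:
  assumes "y \<in> carr L" "y' \<in> carr L" "z \<in> carr L"
  shows "convolution s (y + y') z = convolution s y z + convolution s y' z"
  unfolding convolution_def sum.distrib[symmetric]
  by (intro sum.cong refl)
    (simp add: taylor_add assms G_brk_add_left[OF taylor_comp taylor_comp taylor_comp])

text \<open>
  By bilinearity \<open>y\<close> may be taken to be some \<open>X i\<close>, whose expansion is
  just \<open>e i\<close>, or to lie in \<open>L\<^sub>0\<close>, where the symbol of degree -1 of
  the bracket only depends on the symbol of degree 0 of \<open>y\<close>.
\<close>

lemma symbol_brk_convolution:
  assumes y: "y \<in> carr L" and z: "z \<in> carr L"
  shows "taylor 0 (brk L y z) = convolution (Suc 0) y z"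
proof -
  obtain c y' where y': "y' \<in> fil L 0" and yeq: "y = (\<Sum>i\<in>I. smul L (c i) (X i)) + y'"
    using carr_decomp[OF y] .
  let ?s = "\<Sum>i\<in>I. smul L (c i) (X i)"
  have Xc: "smul L (c i) (X i) \<in> carr L" if "i \<in> I" for i by (rule carr_scale[OF X_carr[OF that]])
  have sc: "?s \<in> carr L" by (intro carr_sum Xc)
  have y'c: "y' \<in> carr L" using y' fil_carrD by blast
  have Xz: "brk L (X i) z \<in> carr L" if "i \<in> I" for i by (rule X_brk_carr[OF that z])
  have D: "convolution (Suc 0) w z = brk G (taylor 0 w) (taylor 1 z) + brk G (taylor 1 w) (taylor 0 z)" for w
    unfolding convolution_def by simp
  have "taylor 1 ?s = 0"
    using Xc X_carr by (simp add: taylor_sum taylor_scale taylor_X)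
  moreover have "taylor 0 ?s = (\<Sum>i\<in>I. smul G (c i) (e i))"
    using Xc X_carr X_symbol by (simp add: taylor_sum taylor_scale) (simp add: taylor.simps(1))
  moreover have "brk G (\<Sum>i\<in>I. smul G (c i) (e i)) (taylor 1 z) = (\<Sum>i\<in>I. smul G (c i) (taylor 0 (brk L (X i) z)))"
  proof -
    have t: "taylor 1 z \<in> comp G 0" using taylor_comp[OF z, of 1] by simp
    have "brk G (\<Sum>i\<in>S. smul G (c i) (e i)) (taylor 1 z) =
        (\<Sum>i\<in>S. smul G (c i) (brk G (e i) (taylor 1 z)))" if "S \<subseteq> I" for S
      using finite_subset[OF that finite_I] that
    proof (induction S rule: finite_induct)
      case empty
      then show ?case using G_brk_0_left[OF t] by simp
    next
      case (insert i S)
      have "(\<Sum>i\<in>S. smul G (c i) (e i)) \<in> comp G (-1)"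
        using insert.prems by (intro comp_sum comp_scale e_comp) auto
      moreover have "e i \<in> comp G (-1)" using insert.prems e_comp by blast
      ultimately show ?case
        using insert G_brk_add_left[OF t, of "smul G (c i) (e i)" "-1"] G_brk_scale_left[OF _ t, of "e i" "-1"]
          comp_scale by simp
    qed
    then show ?thesis using taylor_Suc(2)[OF z, of _ 0] by simp
  qed
  moreover have "taylor 0 (brk L ?s z) = (\<Sum>i\<in>I. smul G (c i) (taylor 0 (brk L (X i) z)))"
    using Xc X_carr z Xz carr_scale
    by (simp add: brk_sum_left brk_smul_left taylor_sum taylor_scale)
  ultimately have 1: "taylor 0 (brk L ?s z) = convolution (Suc 0) ?s z"
    unfolding D using G_brk_0_left[OF taylor_comp[OF z, of 0]] by simp
  have z1: "z \<in> fil L (-1)" using z by (simp add: fil_minus1)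
  have "taylor 0 (brk L y' z) = brk G (taylor 1 y') (taylor 0 z)"
    using symbol_brk'[OF y' z1, of "-1"] taylor_fil[of y' 1] y' by (simp add: taylor.simps(1))
  moreover have "taylor 0 y' = 0" using taylor_vanish[of y' 0] y' by simp
  ultimately have 2: "taylor 0 (brk L y' z) = convolution (Suc 0) y' z"
    unfolding D using G_brk_0_left[OF taylor_comp[OF z, of 1]] by simp
  show ?thesis
    unfolding yeq
    by (simp only: convolution_add_left[OF sc y'c z] brk_add_left[OF sc y'c z]
        taylor_add[OF brk_carr[OF sc z] brk_carr[OF y'c z]] 1 2)
qed

text \<open>
  The Leibniz rule for the derivative along \<open>e i\<close>, combined with the recursion for
  Taylor components.
\<close>

lemma brk_e_convolution:
  assumes i: "i \<in> I" and y: "y \<in> par L a" and z: "z \<in> carr L"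
  shows "brk G (e i) (convolution (Suc s) y z) = convolution s (brk L (X i) y) z
    + smul G (koszul_sign (pr i) a) (convolution s y (brk L (X i) z))"
proof -
  let ?k = "koszul_sign (pr i) a"
  have yc: "y \<in> carr L" using y par_carrD by blast
  have e0: "brk G (e i) (taylor 0 w) = 0" if "w \<in> carr L" for w
    using comp_brk[OF e_comp[OF i] taylor_comp[OF that, of 0], of "-2"] comp_trivial[of "-2"]
    by simp
  have "brk G (e i) (convolution (Suc s) y z) =
      (\<Sum>b\<le>Suc s. brk G (e i) (brk G (taylor b y) (taylor (Suc s - b) z)))"
    unfolding convolution_def
    by (rule G_brk_sum_right[OF e_comp[OF i] brk_taylor_comp[OF yc z]]) simp
  also have "\<dots> = (\<Sum>b\<le>Suc s. brk G (brk G (e i) (taylor b y)) (taylor (Suc s - b) z)) +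
      (\<Sum>b\<le>Suc s. smul G ?k (brk G (taylor b y) (brk G (e i) (taylor (Suc s - b) z))))"
    unfolding sum.distrib[symmetric]
    by (intro sum.cong refl G_jacobi[OF e_comp[OF i] e_par[OF i] taylor_comp[OF yc] taylor_par[OF y] taylor_comp[OF z]])
  also have "(\<Sum>b\<le>Suc s. brk G (brk G (e i) (taylor b y)) (taylor (Suc s - b) z)) =
      convolution s (brk L (X i) y) z"
    unfolding convolution_def sum.atMost_Suc_shift
    using e0[OF yc] G_brk_0_left[OF taylor_comp[OF z]] taylor_Suc(2)[OF yc i]
    by simp
  also have "(\<Sum>b\<le>Suc s. smul G ?k (brk G (taylor b y) (brk G (e i) (taylor (Suc s - b) z)))) =
      smul G ?k (convolution s y (brk L (X i) z))"
  proof -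
    have "brk G (e i) (taylor (Suc s - b) z) = taylor (s - b) (brk L (X i) z)" if "b \<le> s" for b
      using taylor_Suc(2)[OF z i, of "s - b"] that by (simp add: Suc_diff_le)
    then show ?thesis
      unfolding convolution_def sum.atMost_Suc
      using e0[OF z] G_brk_0_right[OF taylor_comp[OF yc]]
      by (simp add: G.scale_sum_right)
  qed
  finally show ?thesis .
qed

text \<open>
  By the two Leibniz rules, for \<open>X i\<close> in \<open>L\<close> and for \<open>e i\<close> in
  \<open>G\<close>, both sides have the same derivatives as soon as the identity holds one degree
  lower.
\<close>

lemma taylor_brk_homogeneous:
  assumes "y \<in> par L a" "z \<in> carr L"
  shows "taylor k (brk L y z) = convolution (Suc k) y z"
  using assms
proof (induction k arbitrary: y z a)
  case 0
  then show ?case using symbol_brk_convolution par_carrD by blast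
next
  case (Suc k)
  have y: "y \<in> carr L" using Suc.prems par_carrD by blast
  show ?case
  proof (rule taylor_SucI)
    show "convolution (Suc (Suc k)) y z \<in> comp G (int k)"
      using convolution_comp[OF y Suc.prems(2), of "Suc (Suc k)"] by simp
    fix i assume i: "i \<in> I"
    note Xy = X_brk_carr[OF i y] and Xz = X_brk_carr[OF i Suc.prems(2)]
    have "taylor k (brk L (X i) (brk L y z)) = taylor k (brk L (brk L (X i) y) z)
        + smul G (koszul_sign (pr i) a) (taylor k (brk L y (brk L (X i) z)))"
      unfolding super_jacobi[OF X_par[OF i] Suc.prems]
      using brk_carr[OF Xy Suc.prems(2)] brk_carr[OF y Xz] carr_scale
      by (simp add: taylor_add taylor_scale)
    then show "brk G (e i) (convolution (Suc (Suc k)) y z) = taylor k (brk L (X i) (brk L y z))"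
      using brk_e_convolution[OF i Suc.prems, of "Suc k"]
        Suc.IH[OF brk_par[OF X_par[OF i] Suc.prems(1)] Suc.prems(2)] Suc.IH[OF Suc.prems(1) Xz]
      by simp
  qed
qed

lemma taylor_brk:
  assumes "y \<in> carr L" "z \<in> carr L"
  shows "taylor k (brk L y z) = convolution (Suc k) y z"
proof -
  obtain v w where v: "v \<in> par L 0" and w: "w \<in> par L 1" and y: "y = v + w"
    using par_decomp assms(1) by blast
  note c = par_carrD[OF v] par_carrD[OF w]
  show ?thesis
    unfolding y
    by (simp only: brk_add_left[OF c assms(2)] taylor_add[OF brk_carr[OF c(1) assms(2)] brk_carr[OF c(2) assms(2)]]
      convolution_add_left[OF c assms(2)] taylor_brk_homogeneous[OF v assms(2)] taylor_brk_homogeneous[OF w assms(2)])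
qed

lemma taylor_determines_fil:
  assumes "y \<in> carr L" "\<And>k. k < N \<Longrightarrow> taylor k y = 0"
  shows "y \<in> fil L (int N - 1)"
  using assms(2)
proof (induction N)
  case 0
  then show ?case using assms(1) by (simp add: fil_minus1)
next
  case (Suc N)
  then have "y \<in> fil L (int N - 1)" "taylor N y = 0" by auto
  then show ?case using taylor_fil symbol_eq_0_iff[of y "int N - 1"] by simp
qed

lemma taylor_injective:
  assumes "y \<in> carr L" "\<And>k. taylor k y = 0"
  shows "y = 0"
proof (rule separated)
  fix k show "y \<in> fil L (int k)" using taylor_determines_fil[of y "Suc k"] assms by simp
qed

text \<open>
  Elements with the prescribed first \<open>r\<close> components are corrected one degree at a time
  by a lift of the missing component; completeness provides the limit.
\<close>

lemma taylor_surjective: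
  assumes g: "\<And>k. g k \<in> comp G (int k - 1)" "\<And>k. g k \<in> par G a"
    and vanish: "\<And>k. k < N \<Longrightarrow> g k = 0"
  shows "\<exists>y\<in>fil L (int N - 1) \<inter> par L a. \<forall>k. taylor k y = g k"
proof -
  let ?P = "\<lambda>r y. y \<in> fil L (int N - 1) \<and> y \<in> par L a \<and> (\<forall>k<r. taylor k y = g k)"
  have "\<exists>Y. \<forall>r. ?P r (Y r) \<and> Y (Suc r) - Y r \<in> fil L (int r - 1)"
  proof (rule dependent_nat_choice)
    show "\<exists>y. ?P 0 y" using fil_0 par_0 by auto
  next
    fix y r assume y: "?P r y"
    have yc: "y \<in> carr L" using y par_carrD by blast
    have "\<exists>x. x \<in> fil L (int N - 1) \<and> x \<in> fil L (int r - 1) \<and> x \<in> par L a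
        \<and> taylor r x = g r - taylor r y"
    \<comment> \<open>below degree \<open>N - 1\<close> nothing is missing, and a zero correction keeps the iterates in the filtration\<close>
    proof (cases "r < N")
      case True
      then have "y \<in> fil L (int r)" using y fil_monoD[of y "int N - 1" "int r"] by simp
      then have "g r - taylor r y = 0" using taylor_vanish vanish[OF True] by simp
      then show ?thesis using fil_0 par_0 taylor_0 by auto
    next
      case False
      have m: "g r - taylor r y \<in> comp G (int r - 1)" using g(1) taylor_comp[OF yc] comp_diff by blast
      have "g r - taylor r y \<in> par G a"
        using G_par_diff[OF g(1,2) taylor_comp[OF yc] taylor_par] y by blast
      then obtain x where x: "x \<in> fil L (int r - 1)" "x \<in> par L a" "g r - taylor r y = symbol (int r - 1) x"
        using lift_parE[OF m] by blast
      moreover have "x \<in> fil L (int N - 1)" using fil_monoD[OF x(1)] False by simp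
      ultimately show ?thesis using taylor_fil by auto
    qed
    then obtain x where x: "x \<in> fil L (int N - 1)" "x \<in> fil L (int r - 1)" "x \<in> par L a"
      "taylor r x = g r - taylor r y" by blast
    have xc: "x \<in> carr L" using x par_carrD by blast
    have "taylor k (y + x) = g k" if "k < Suc r" for k
    proof (cases "k = r")
      case True
      then show ?thesis using x(4) taylor_add[OF yc xc] by simp
    next
      case False
      then have "x \<in> fil L (int k)" using fil_monoD[OF x(2)] that by simp
      then show ?thesis using taylor_vanish taylor_add[OF yc xc] y that False by simp
    qed
    moreover have "y + x \<in> fil L (int N - 1)" "y + x \<in> par L a"
      using y fil_add[OF _ x(1)] par_add[OF _ x(3)] by simp_all
    ultimately have "?P (Suc r) (y + x)" by simp
    moreover have "(y + x) - y \<in> fil L (int r - 1)" using x by simp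
    ultimately show "\<exists>y'. ?P (Suc r) y' \<and> y' - y \<in> fil L (int r - 1)" by blast
  qed
  then obtain Y where Y0: "\<forall>r. ?P r (Y r) \<and> Y (Suc r) - Y r \<in> fil L (int r - 1)" by (elim exE)
  then have Y: "\<And>r. Y r \<in> fil L (int N - 1)" "\<And>r. Y r \<in> par L a"
    "\<And>r k. k < r \<Longrightarrow> taylor k (Y r) = g k" "\<And>r. Y (Suc r) - Y r \<in> fil L (int r + - 1)"
    by simp_all
  have Yc: "Y r \<in> carr L" for r using Y(2) par_carrD by blast
  obtain l where l: "l \<in> carr L" "\<And>r. Y r - l \<in> fil L (int r + - 1)"
    using limit[OF Yc Y(4)] by blast
  have "l \<in> fil L (int N - 1)" using fil_closed[OF Y(1) l(2)] .
  moreover have "l \<in> par L a" using par_closed[OF l(1) Y(2) l(2)] .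
  moreover have "taylor k l = g k" for k
  proof -
    have "Y (Suc k) - l \<in> fil L (int k)" using l(2)[of "Suc k"] by simp
    then have "taylor k (Y (Suc k) - l) = 0" by (rule taylor_vanish)
    then show ?thesis using taylor_diff[OF Yc l(1)] Y(3)[of k "Suc k"] by simp
  qed
  ultimately show ?thesis by blast
qed

definition taylor_series :: "'a \<Rightarrow> int \<Rightarrow> 'b" where
  "taylor_series y j = (if j < - 1 then 0 else taylor (nat (j + 1)) y)"

lemma taylor_series_comp: "y \<in> carr L \<Longrightarrow> taylor_series y j \<in> comp G j"
  using taylor_comp[of y "nat (j + 1)"] by (cases "j < -1") (simp_all add: taylor_series_def comp_0)

lemma taylor_series_add:
  "\<lbrakk>x \<in> carr L; y \<in> carr L\<rbrakk> \<Longrightarrow> taylor_series (x + y) = taylor_series x + taylor_series y"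
  by (auto simp: taylor_series_def fun_eq_iff taylor_add)

lemma taylor_series_par_surj:
  assumes g: "\<And>j. g j \<in> comp G j" "\<And>j. g j \<in> par G a" and vanish: "\<And>j. j < d \<Longrightarrow> g j = 0"
  shows "\<exists>y\<in>fil L d \<inter> par L a. taylor_series y = g"
proof -
  let ?N = "nat (d + 1)"
  have "\<exists>y\<in>fil L (int ?N - 1) \<inter> par L a. \<forall>k. taylor k y = g (int k - 1)"
    using g vanish by (intro taylor_surjective) auto
  then obtain y where y: "y \<in> fil L (int ?N - 1)" "y \<in> par L a" "\<And>k. taylor k y = g (int k - 1)"
    by blast
  have "y \<in> fil L d"
  proof (cases "d < -1")
    case True
    then show ?thesis using fil_depth[of d] y(2) par_carrD by auto
  next
    case False
    then show ?thesis using y(1) by simp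
  qed
  moreover have "taylor_series y = g"
  proof
    fix j
    show "taylor_series y j = g j"
      using y(3)[of "nat (j + 1)"] comp_trivial[of j] g(1)[of j]
      by (auto simp: taylor_series_def)
  qed
  ultimately show ?thesis using y by blast
qed

lemma taylor_series_surj:
  assumes g: "\<And>j. g j \<in> comp G j" and vanish: "\<And>j. j < d \<Longrightarrow> g j = 0"
  shows "\<exists>y\<in>fil L d. taylor_series y = g"
proof -
  have "\<exists>v w. v \<in> comp G j \<and> v \<in> par G 0 \<and> w \<in> comp G j \<and> w \<in> par G 1 \<and> g j = v + w
      \<and> (j < d \<longrightarrow> v = 0 \<and> w = 0)" for j
  proof (cases "j < d")
    case True
    have "0 \<in> par G b" for b using symbol_par[OF fil_0[of j] par_0, of b] symbol_0 by simp
    then show ?thesis using comp_0 vanish[OF True] by (intro exI[of _ 0]) simp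
  next
    case False
    then show ?thesis using G_par_decomp[OF g, of j 0] by (metis add_0)
  qed
  then obtain v w where vw: "\<And>j. v j \<in> comp G j" "\<And>j. v j \<in> par G 0" "\<And>j. w j \<in> comp G j"
    "\<And>j. w j \<in> par G 1" "\<And>j. g j = v j + w j" "\<And>j. j < d \<Longrightarrow> v j = 0" "\<And>j. j < d \<Longrightarrow> w j = 0"
    by metis
  obtain y z where y: "y \<in> fil L d" "taylor_series y = v" and z: "z \<in> fil L d" "taylor_series z = w"
    using taylor_series_par_surj[OF vw(1,2,6)] taylor_series_par_surj[OF vw(3,4,7)] by blast
  have "taylor_series (y + z) = g"
    using taylor_series_add[of y z] fil_carrD y z vw(5) by (auto simp: fun_eq_iff)
  then show ?thesis using y z fil_add by blast
qed

lemma taylor_series_vanish: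
  assumes "y \<in> fil L d" "j < d"
  shows "taylor_series y j = 0"
proof (cases "j < -1")
  case False
  then have "y \<in> fil L (int (nat (j + 1)))" using fil_monoD[OF assms(1)] assms(2) by simp
  then have "taylor (nat (j + 1)) y = 0" by (rule taylor_vanish)
  with False show ?thesis by (simp add: taylor_series_def)
qed (simp add: taylor_series_def)

lemma taylor_series_brk:
  assumes "y \<in> carr L" "z \<in> carr L"
  shows "taylor_series (brk L y z) k = (\<Sum>i\<in>{- 1..k + 1}. brk G (taylor_series y i) (taylor_series z (k - i)))"
proof (cases "k < -1")
  case True
  have "brk G (taylor_series y i) (taylor_series z (k - i)) = 0" for i
    using comp_brk[OF taylor_series_comp[OF assms(1)] taylor_series_comp[OF assms(2)], of k i "k - i"]
      comp_trivial[OF True] by simp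
  then have "(\<Sum>i\<in>{- 1..k + 1}. brk G (taylor_series y i) (taylor_series z (k - i))) = 0" by simp
  then show ?thesis using True by (simp add: taylor_series_def)
next
  case False
  define s where "s = nat (k + 2)"
  have s: "int s = k + 2" "Suc (nat (k + 1)) = s" using False unfolding s_def by auto
  have "(\<Sum>i\<in>{- 1..k + 1}. brk G (taylor_series y i) (taylor_series z (k - i))) =
      (\<Sum>a\<le>s. brk G (taylor a y) (taylor (s - a) z))"
  proof (rule sum.reindex_bij_witness[of _ "\<lambda>a. int a - 1" "\<lambda>i. nat (i + 1)"])
    fix i assume i: "i \<in> {-1..k + 1}"
    then show "nat (i + 1) \<in> {..s}" "int (nat (i + 1)) - 1 = i" using s by auto
    have "nat (k - i + 1) = s - nat (i + 1)"
      unfolding s_def using i False by (simp add: nat_diff_distrib'[symmetric])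
    then show "brk G (taylor (nat (i + 1)) y) (taylor (s - nat (i + 1)) z) =
        brk G (taylor_series y i) (taylor_series z (k - i))"
      using i by (simp add: taylor_series_def)
  next
    fix a assume "a \<in> {..s}"
    then show "nat (int a - 1 + 1) = a" "int a - 1 \<in> {-1..k + 1}" using s by auto
  qed
  also have "\<dots> = taylor (nat (k + 1)) (brk L y z)"
    using taylor_brk[OF assms, of "nat (k + 1)"] s by (simp add: convolution_def)
  finally show ?thesis using False by (simp add: taylor_series_def)
qed

lemma filtered_iso_taylor_series: "filtered_iso taylor_series L (completion 1 G)"
proof -
  have comp: "{x. \<forall>j. x j \<in> comp G j} = taylor_series ` carr L"
  proof safe
    fix g assume g: "\<forall>j. g j \<in> comp G j"
    then have "g j = 0" if "j < -1" for j using comp_trivial[OF that] by blast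
    then show "g \<in> taylor_series ` carr L"
      using taylor_series_surj[of g "-1"] g by (auto simp: fil_minus1)
  qed (use taylor_series_comp in auto)
  have inj: "inj_on taylor_series (carr L)"
  proof (rule inj_onI)
    fix x y assume xy: "x \<in> carr L" "y \<in> carr L" "taylor_series x = taylor_series y"
    have "taylor k (x - y) = 0" for k
      using taylor_diff[OF xy(1,2)] fun_cong[OF xy(3), of "int k - 1"]
      by (simp add: taylor_series_def)
    then show "x = y" using taylor_injective[of "x - y"] carr_diff xy by simp
  qed
  have par: "taylor_series ` par L a = {x. \<forall>j. x j \<in> comp G j \<inter> par G a}" for a
  proof safe
    fix g assume g: "\<forall>j. g j \<in> comp G j \<inter> par G a"
    then have "g j = 0" if "j < -1" for j using comp_trivial[OF that] by blast
    then show "g \<in> taylor_series ` par L a"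
      using taylor_series_par_surj[of g a "-1"] g by auto
  next
    fix y j assume y: "y \<in> par L a"
    then show "taylor_series y j \<in> comp G j" using taylor_series_comp par_carrD by blast
    have "0 \<in> par G a" using symbol_par[OF fil_0[of 0] par_0] symbol_0 by simp
    then show "taylor_series y j \<in> par G a"
      using taylor_par[OF y] by (simp add: taylor_series_def)
  qed
  have fil: "taylor_series ` fil L d = {x. (\<forall>i. x i \<in> comp G i) \<and> (\<forall>i<d. x i = 0)}" for d
  proof safe
    fix g assume "\<forall>i. g i \<in> comp G i" "\<forall>i<d. g i = 0"
    then show "g \<in> taylor_series ` fil L d" using taylor_series_surj[of g d] by auto
  qed (use taylor_series_comp fil_carrD taylor_series_vanish in auto)
  show ?thesis
    unfolding filtered_iso_def completion_def bij_betw_def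
    using inj comp taylor_series_add par fil taylor_series_brk
    by (auto simp: fun_eq_iff taylor_series_def taylor_scale)
qed

end

theorem (in prolongation) trivial: "trivial_deformation 1 G L"
proof -
  obtain X where "\<And>i. i \<in> I \<Longrightarrow> X i \<in> par L (pr i)" "\<And>i. i \<in> I \<Longrightarrow> symbol (- 1) (X i) = e i"
    "\<And>i j. \<lbrakk>i \<in> I; j \<in> I\<rbrakk> \<Longrightarrow> brk L (X i) (X j) = 0"
    using commuting_lifts by blast
  then interpret flat_frame L G \<phi> I e pr h u X by unfold_locales
  show ?thesis unfolding trivial_deformation_def using filtered_iso_taylor_series by blast
qed

section \<open>Derivatives of polynomials in even and odd variables\<close>

text \<open>
  Exponents of a single variable are written \<open>1\<close> throughout; rewriting them to
  \<open>Suc 0\<close> would separate monomials in goals from those in the rules about them.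
\<close>

declare One_nat_def [simp del]

text \<open>
  Uniform names for the variables: \<open>Inl v\<close> is the even variable \<open>v\<close>, and
  \<open>Inr j\<close> is \<open>\<xi>\<^sub>j\<close>.
\<close>

type_synonym svar = "evar + nat"

definition even_vars :: "nat \<Rightarrow> evar set" where
  "even_vars n = Pvar ` {..<n} \<union> Qvar ` {..<n}"

definition svars :: "nat \<Rightarrow> nat \<Rightarrow> svar set" where
  "svars n m = Inl ` even_vars n \<union> Inr ` {..<m}"

fun vpar :: "svar \<Rightarrow> bit" where
  "vpar (Inl v) = 0"
| "vpar (Inr j) = 1"

abbreviation vsign :: "svar \<Rightarrow> svar \<Rightarrow> complex" where
  "vsign i j \<equiv> koszul_sign (vpar i) (vpar j)"

definition evar_mult :: "evar \<Rightarrow> epoly \<Rightarrow> epoly" where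
  "evar_mult v p = (\<Sum>b\<in>Poly_Mapping.keys p.
     Poly_Mapping.single (b + Poly_Mapping.single v 1) (Poly_Mapping.lookup p b))"

fun pd :: "svar \<Rightarrow> spoly \<Rightarrow> spoly" where
  "pd (Inl v) f = ediff v f"
| "pd (Inr j) f = odiff j f"

text \<open>
  Left multiplication by a variable, given on coefficients so that its commutation with derivatives
  can be compared monomial by monomial. The sign is the one needed to move
  \<open>\<xi>\<^sub>j\<close> to its place in the increasing product.
\<close>

fun mul :: "svar \<Rightarrow> spoly \<Rightarrow> spoly" where
  "mul (Inl v) f = (\<lambda>I. evar_mult v (f I))"
| "mul (Inr j) f = (\<lambda>I. if j \<in> I then (- 1) ^ card {i \<in> I. i < j} * f (I - {j}) else 0)"

abbreviation coef :: "spoly \<Rightarrow> nat set \<Rightarrow> (evar \<Rightarrow>\<^sub>0 nat) \<Rightarrow> complex" where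
  "coef f I a \<equiv> Poly_Mapping.lookup (f I) a"

definition osign :: "nat \<Rightarrow> nat set \<Rightarrow> complex" where
  "osign j I = (- 1) ^ card {i \<in> I. i < j}"

lemma spoly_eqI: "(\<And>I a. coef f I a = coef g I a) \<Longrightarrow> f = g"
  by (intro ext poly_mapping_eqI)

lemma lookup_sign_mult: "Poly_Mapping.lookup ((- 1) ^ k * p) a = (- 1) ^ k * Poly_Mapping.lookup (p :: epoly) a"
  by (cases "even k") simp_all

lemma sum_spoly_apply: "(\<Sum>s\<in>S. f s) I = (\<Sum>s\<in>S. (f s I :: epoly))"
  by (induction S rule: infinite_finite_induct) simp_all

lemma coef_sum: "coef (\<Sum>s\<in>S. f s) I a = (\<Sum>s\<in>S. coef (f s) I a)"
  by (simp add: sum_spoly_apply lookup_sum)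

lemma lookup_evar_mult:
  "Poly_Mapping.lookup (evar_mult v p) a =
     (if 0 < Poly_Mapping.lookup a v then Poly_Mapping.lookup p (a - Poly_Mapping.single v 1) else 0)"
proof -
  let ?e = "Poly_Mapping.single v (1::nat)"
  have "b + ?e = a \<longleftrightarrow> 0 < Poly_Mapping.lookup a v \<and> b = a - ?e" for b
  proof
    assume "0 < Poly_Mapping.lookup a v \<and> b = a - ?e"
    then show "b + ?e = a"
      by (intro poly_mapping_eqI) (auto simp: lookup_add lookup_minus lookup_single when_def)
  qed (auto simp: lookup_add)
  then have "Poly_Mapping.lookup (evar_mult v p) a =
      (\<Sum>b\<in>Poly_Mapping.keys p. if b = a - ?e then
        (if 0 < Poly_Mapping.lookup a v then Poly_Mapping.lookup p b else 0) else 0)"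
    unfolding evar_mult_def lookup_sum lookup_single when_def by (intro sum.cong) auto
  then show ?thesis by (simp add: in_keys_iff)
qed

lemma coef_pd_even:
  "coef (pd (Inl v) f) I a = of_nat (Poly_Mapping.lookup a v + 1) * coef f I (a + Poly_Mapping.single v 1)"
  by (simp add: ediff_def lookup_pderiv_even del: of_nat_add)

lemma coef_pd_odd:
  "coef (pd (Inr j) f) I a = (if j \<in> I then 0 else osign j I * coef f (insert j I) a)"
  by (simp add: odiff_def lookup_sign_mult osign_def)

lemma coef_mul_even:
  "coef (mul (Inl v) f) I a =
    (if 0 < Poly_Mapping.lookup a v then coef f I (a - Poly_Mapping.single v 1) else 0)"
  by (simp add: lookup_evar_mult)

lemma coef_mul_odd:
  "coef (mul (Inr j) f) I a = (if j \<in> I then osign j I * coef f (I - {j}) a else 0)"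
  by (simp add: lookup_sign_mult osign_def)

lemmas coef_pd = coef_pd_even coef_pd_odd
  and coef_mul = coef_mul_even coef_mul_odd

declare pd.simps [simp del] mul.simps [simp del]

lemma osign_insert: "i \<notin> I \<Longrightarrow> osign j (insert i I) = (if i < j then - osign j I else osign j I)"
proof -
  assume "i \<notin> I"
  moreover have "{k \<in> insert i I. k < j} = (if i < j then insert i {k \<in> I. k < j} else {k \<in> I. k < j})"
    by auto
  ultimately show ?thesis by (simp add: osign_def)
qed

lemma osign_remove: "i \<in> I \<Longrightarrow> osign j (I - {i}) = (if i < j then - osign j I else osign j I)"
  using osign_insert[of i "I - {i}" j] by (auto simp: insert_absorb)

lemma osign_square [simp]: "osign j I * osign j I = 1" "osign j I * (osign j I * c) = c"
  by (simp_all add: osign_def mult.assoc[symmetric] flip: power_mult_distrib)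

lemma pd_commute: "pd i (pd j f) = sscale (vsign i j) (pd j (pd i f))"
proof (rule spoly_eqI)
  fix I a
  show "coef (pd i (pd j f)) I a = coef (sscale (vsign i j) (pd j (pd i f))) I a"
  proof (cases i; cases j)
    fix k l assume "i = Inr k" "j = Inr l"
    then show ?thesis
      by (cases "k < l"; cases "k = l") (auto simp: coef_pd koszul_sign_def osign_insert insert_commute)
  next
    fix v w assume "i = Inl v" "j = Inl w"
    then show ?thesis
      by (cases "v = w") (auto simp: coef_pd koszul_sign_def lookup_add lookup_single add_ac)
  qed (auto simp: coef_pd koszul_sign_def)
qed

text \<open>
  Multiplications and derivatives generate a Weyl-Clifford algebra; this commutation rule drives
  both Poincare lemmas.
\<close>

lemma pd_mul: "pd i (mul j f) = (if i = j then f else 0) + sscale (vsign i j) (mul j (pd i f))"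
proof (rule spoly_eqI)
  fix I a
  show "coef (pd i (mul j f)) I a =
      coef ((if i = j then f else 0) + sscale (vsign i j) (mul j (pd i f))) I a"
  proof (cases i; cases j)
    fix k l assume "i = Inr k" "j = Inr l"
    moreover have "insert k (I - {l}) = insert k I - {l}" if "k \<noteq> l" using that by auto
    ultimately show ?thesis
      by (cases "k < l"; cases "k = l")
        (auto simp: coef_pd coef_mul koszul_sign_def osign_insert osign_remove lookup_add insert_absorb)
  next
    fix v w assume ij: "i = Inl v" "j = Inl w"
    show ?thesis
    proof (cases "v = w")
      case True
      have "a - Poly_Mapping.single w 1 + Poly_Mapping.single w 1 = a" if "0 < Poly_Mapping.lookup a w"
        using that by (intro poly_mapping_eqI) (auto simp: lookup_add lookup_minus lookup_single when_def)
      then show ?thesis using True ij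
        by (auto simp: coef_pd coef_mul koszul_sign_def lookup_add lookup_minus lookup_single algebra_simps)
    next
      case False
      have "a - Poly_Mapping.single w 1 + Poly_Mapping.single v 1 = a + Poly_Mapping.single v 1 - Poly_Mapping.single w 1"
        using False by (intro poly_mapping_eqI) (auto simp: lookup_add lookup_minus lookup_single when_def)
      then show ?thesis using False ij
        by (auto simp: coef_pd coef_mul koszul_sign_def lookup_add lookup_minus lookup_single)
    qed
  qed (auto simp: coef_pd coef_mul koszul_sign_def lookup_add)
qed

lemma pd_add: "pd i (f + g) = pd i f + pd i g"
  by (rule spoly_eqI, cases i) (auto simp: coef_pd lookup_add algebra_simps)

lemma pd_diff: "pd i (f - g) = pd i f - pd i g"
  by (rule spoly_eqI, cases i) (auto simp: coef_pd lookup_minus algebra_simps)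

lemma pd_scale: "pd i (sscale c f) = sscale c (pd i f)"
  by (rule spoly_eqI, cases i) (auto simp: coef_pd)

lemma pd_0: "pd i 0 = 0"
  by (rule spoly_eqI, cases i) (auto simp: coef_pd)

lemma pd_sum: "pd i (\<Sum>s\<in>S. f s) = (\<Sum>s\<in>S. pd i (f s))"
  by (induction S rule: infinite_finite_induct) (simp_all only: sum.infinite sum.empty sum.insert not_False_eq_True pd_0 pd_add)

lemma mul_diff: "mul i (f - g) = mul i f - mul i g"
  by (rule spoly_eqI, cases i) (auto simp: coef_mul lookup_minus algebra_simps)

lemma mul_scale: "mul i (sscale c f) = sscale c (mul i f)"
  by (rule spoly_eqI, cases i) (auto simp: coef_mul)

lemma mul_0: "mul i 0 = 0"
  by (rule spoly_eqI, cases i) (auto simp: coef_mul)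

interpretation spoly: vector_space sscale
  by unfold_locales (auto intro!: spoly_eqI simp: lookup_add algebra_simps)

lemma finite_svars: "finite (svars n m)"
  by (simp add: svars_def even_vars_def)

lemma mdeg_superset:
  assumes "finite S" "Poly_Mapping.keys a \<subseteq> S"
  shows "mdeg a = (\<Sum>v\<in>S. Poly_Mapping.lookup a v)"
  unfolding mdeg_def using assms by (intro sum.mono_neutral_left) (auto simp: in_keys_iff)

lemma keys_add_single: "Poly_Mapping.keys (a + Poly_Mapping.single v (1::nat)) = insert v (Poly_Mapping.keys a)"
  by (auto simp: in_keys_iff lookup_add lookup_single when_def split: if_splits)

lemma mdeg_add_single: "mdeg (a + Poly_Mapping.single v 1) = mdeg a + 1"
proof -
  let ?S = "insert v (Poly_Mapping.keys a)"
  have "mdeg (a + Poly_Mapping.single v 1) = (\<Sum>w\<in>?S. Poly_Mapping.lookup a w + (if w = v then 1 else 0))"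
    by (subst mdeg_superset[of ?S])
      (auto simp: keys_add_single lookup_add lookup_single when_def intro!: sum.cong)
  also have "\<dots> = mdeg a + 1"
    by (subst mdeg_superset[of ?S a]) (auto simp: sum.distrib)
  finally show ?thesis .
qed

text \<open>
  The condition on a single monomial \<open>\<xi>\<^sub>I z\<^sup>a\<close> that it lies in
  \<open>\<Lambda>(2n,m)\<close>. It makes the subspaces of polynomials of a given degree or parity
  conditions on the monomials that occur.
\<close>

definition in_vars :: "nat \<Rightarrow> nat \<Rightarrow> nat set \<Rightarrow> (evar \<Rightarrow>\<^sub>0 nat) \<Rightarrow> bool" where
  "in_vars n m I a \<longleftrightarrow> I \<subseteq> {..<m} \<and> Poly_Mapping.keys a \<subseteq> even_vars n"

lemma spoly_nonzero_iff: "f I \<noteq> 0 \<longleftrightarrow> (\<exists>a. coef f I a \<noteq> 0)"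
  by (metis lookup_zero poly_mapping_eqI)

lemma Lam_iff: "f \<in> Lam n m \<longleftrightarrow> (\<forall>I a. coef f I a \<noteq> 0 \<longrightarrow> in_vars n m I a)"
  unfolding Lam_def in_vars_def even_vars_def spoly_nonzero_iff mem_Collect_eq Ball_def in_keys_iff by blast

lemma Lam_hom_iff: "f \<in> Lam_hom n m d \<longleftrightarrow>
    (\<forall>I a. coef f I a \<noteq> 0 \<longrightarrow> in_vars n m I a \<and> int (mdeg a + card I) = d)"
  unfolding Lam_hom_def mem_Collect_eq Lam_iff Ball_def in_keys_iff by blast

lemma Lam_par_iff: "f \<in> Lam_par n m b \<longleftrightarrow>
    (\<forall>I a. coef f I a \<noteq> 0 \<longrightarrow> in_vars n m I a \<and> of_nat (card I) = b)"
  unfolding Lam_par_def mem_Collect_eq Lam_iff spoly_nonzero_iff by blast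

lemma Lam_homD: "f \<in> Lam_hom n m d \<Longrightarrow> f \<in> Lam n m"
  by (simp add: Lam_hom_def)

text \<open>
  Every monomial of a derivative comes from a monomial of \<open>f\<close> of degree one more and of
  parity shifted by that of the variable; this gives at once how derivatives act on degree and
  parity.
\<close>

lemma coef_pd_nonzero:
  assumes "coef (pd i f) I a \<noteq> 0"
  shows "\<exists>I' a'. coef f I' a' \<noteq> 0 \<and> (in_vars n m I' a' \<longrightarrow> in_vars n m I a \<and>
    mdeg a' + card I' = mdeg a + card I + 1 \<and> (of_nat (card I') :: bit) = of_nat (card I) + vpar i)"
proof (cases i)
  case (Inl v)
  then show ?thesis using assms
    by (intro exI[of _ I] exI[of _ "a + Poly_Mapping.single v 1"])
      (auto simp: coef_pd mdeg_add_single in_vars_def keys_add_single)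
next
  case (Inr j)
  have "card (insert j I) = card I + 1" if "j \<notin> I" "I \<subseteq> {..<m}"
    using that finite_subset[of I "{..<m}"] by simp
  then show ?thesis using assms Inr
    by (intro exI[of _ "insert j I"] exI[of _ a]) (auto simp: coef_pd in_vars_def split: if_splits)
qed

lemma coef_mul_nonzero:
  assumes "coef (mul i f) I a \<noteq> 0" "i \<in> svars n m"
  shows "\<exists>I' a'. coef f I' a' \<noteq> 0 \<and> (in_vars n m I' a' \<longrightarrow> in_vars n m I a \<and>
    mdeg a' + card I' + 1 = mdeg a + card I \<and> (of_nat (card I) :: bit) = of_nat (card I') + vpar i)"
proof (cases i)
  case (Inl v)
  let ?a = "a - Poly_Mapping.single v 1"
  have "0 < Poly_Mapping.lookup a v" using assms Inl by (auto simp: coef_mul split: if_splits)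
  then have a: "a = ?a + Poly_Mapping.single v 1"
    by (intro poly_mapping_eqI) (auto simp: lookup_add lookup_minus lookup_single when_def)
  have "mdeg a = mdeg ?a + 1" "Poly_Mapping.keys a = insert v (Poly_Mapping.keys ?a)"
    by (subst a, simp only: mdeg_add_single, subst a, simp only: keys_add_single)
  then show ?thesis using assms Inl
    by (intro exI[of _ I] exI[of _ ?a]) (auto simp: coef_mul in_vars_def svars_def split: if_splits)
next
  case (Inr j)
  have "card I = card (I - {j}) + 1" if "j \<in> I" "I \<subseteq> {..<m}"
    using that card.remove[of I j] finite_subset[of I "{..<m}"] by simp
  moreover have "I \<subseteq> {..<m}" if "I - {j} \<subseteq> {..<m}" using that assms Inr by (auto simp: svars_def)
  ultimately show ?thesis using assms Inr
    by (intro exI[of _ "I - {j}"] exI[of _ a]) (auto simp: coef_mul in_vars_def split: if_splits)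
qed

lemma pd_hom: "f \<in> Lam_hom n m d \<Longrightarrow> pd i f \<in> Lam_hom n m (d - 1)"
  unfolding Lam_hom_iff using coef_pd_nonzero[of i f _ _ n m] by fastforce

lemma pd_par: "f \<in> Lam_par n m b \<Longrightarrow> pd i f \<in> Lam_par n m (b + vpar i)"
  unfolding Lam_par_iff using coef_pd_nonzero[of i f _ _ n m] by (fastforce simp: add.assoc)

lemma mul_hom: "\<lbrakk>f \<in> Lam_hom n m d; i \<in> svars n m\<rbrakk> \<Longrightarrow> mul i f \<in> Lam_hom n m (d + 1)"
  unfolding Lam_hom_iff using coef_mul_nonzero[of i f _ _ n m] by fastforce

lemma mul_par: "\<lbrakk>f \<in> Lam_par n m b; i \<in> svars n m\<rbrakk> \<Longrightarrow> mul i f \<in> Lam_par n m (b + vpar i)"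
  unfolding Lam_par_iff using coef_mul_nonzero[of i f _ _ n m] by fastforce

lemma coef_add_nonzero: "coef (f + g) I a \<noteq> 0 \<Longrightarrow> coef f I a \<noteq> 0 \<or> coef g I a \<noteq> 0"
  by (auto simp: lookup_add)

lemma coef_scale_nonzero: "coef (sscale c f) I a \<noteq> 0 \<Longrightarrow> coef f I a \<noteq> 0"
  by auto

lemma subspace_Lam_hom: "spoly.subspace (Lam_hom n m d)"
proof (rule spoly.subspaceI)
  show "f + g \<in> Lam_hom n m d" if "f \<in> Lam_hom n m d" "g \<in> Lam_hom n m d" for f g
    using that coef_add_nonzero unfolding Lam_hom_iff by blast
  show "sscale c f \<in> Lam_hom n m d" if "f \<in> Lam_hom n m d" for c f
    using that coef_scale_nonzero unfolding Lam_hom_iff by blast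
qed (simp add: Lam_hom_iff)

lemma subspace_Lam_par: "spoly.subspace (Lam_par n m b)"
proof (rule spoly.subspaceI)
  show "f + g \<in> Lam_par n m b" if "f \<in> Lam_par n m b" "g \<in> Lam_par n m b" for f g
    using that coef_add_nonzero unfolding Lam_par_iff by blast
  show "sscale c f \<in> Lam_par n m b" if "f \<in> Lam_par n m b" for c f
    using that coef_scale_nonzero unfolding Lam_par_iff by blast
qed (simp add: Lam_par_iff)

lemma euler:
  assumes f: "f \<in> Lam_hom n m (int d)"
  shows "(\<Sum>i\<in>svars n m. mul i (pd i f)) = sscale (of_nat d) f"
proof (rule spoly_eqI)
  fix I a
  have even: "coef (mul (Inl v) (pd (Inl v) f)) I a = of_nat (Poly_Mapping.lookup a v) * coef f I a" for v
  proof (cases "0 < Poly_Mapping.lookup a v")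
    case True
    then have "a - Poly_Mapping.single v 1 + Poly_Mapping.single v 1 = a"
      by (intro poly_mapping_eqI) (auto simp: lookup_add lookup_minus lookup_single when_def)
    with True show ?thesis by (simp add: coef_pd coef_mul lookup_minus)
  qed (simp add: coef_mul)
  have odd: "coef (mul (Inr j) (pd (Inr j) f)) I a = (if j \<in> I then coef f I a else 0)" for j
    by (auto simp: coef_pd coef_mul osign_remove insert_absorb)
  have "coef (\<Sum>i\<in>svars n m. mul i (pd i f)) I a =
      (\<Sum>v\<in>even_vars n. of_nat (Poly_Mapping.lookup a v) * coef f I a) +
      (\<Sum>j<m. if j \<in> I then coef f I a else 0)"
    unfolding coef_sum svars_def
    by (subst sum.union_disjoint) (auto simp: even_vars_def sum.reindex even odd)
  also have "\<dots> = of_nat ((\<Sum>v\<in>even_vars n. Poly_Mapping.lookup a v) + card ({..<m} \<inter> I)) * coef f I a"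
  proof -
    have "(\<Sum>j<m. if j \<in> I then coef f I a else 0) = of_nat (card ({..<m} \<inter> I)) * coef f I a"
      by (simp flip: sum.inter_restrict)
    then show ?thesis by (simp add: sum_distrib_right distrib_right)
  qed
  also have "\<dots> = of_nat d * coef f I a"
  proof (cases "coef f I a = 0")
    case False
    then have "in_vars n m I a" and d: "mdeg a + card I = d"
      using f unfolding Lam_hom_iff by (blast, metis of_nat_eq_iff)
    then have "{..<m} \<inter> I = I" "mdeg a = (\<Sum>v\<in>even_vars n. Poly_Mapping.lookup a v)"
      unfolding in_vars_def by (auto intro: mdeg_superset simp: even_vars_def)
    then show ?thesis using d by simp
  qed simp
  finally show "coef (\<Sum>i\<in>svars n m. mul i (pd i f)) I a = coef (sscale (of_nat d) f) I a" by simp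
qed

section \<open>Poincare lemmas\<close>

lemma pd_sum_mul:
  assumes "i \<in> svars n m"
  shows "pd i (\<Sum>k\<in>svars n m. mul k (f k)) = f i + (\<Sum>k\<in>svars n m. sscale (vsign i k) (mul k (pd i (f k))))"
proof -
  have "pd i (\<Sum>k\<in>svars n m. mul k (f k)) =
      (\<Sum>k\<in>svars n m. (if i = k then f k else 0) + sscale (vsign i k) (mul k (pd i (f k))))"
    unfolding pd_sum by (intro sum.cong refl pd_mul)
  also have "\<dots> = (\<Sum>k\<in>svars n m. if i = k then f k else 0) +
      (\<Sum>k\<in>svars n m. sscale (vsign i k) (mul k (pd i (f k))))"
    by (rule sum.distrib)
  also have "(\<Sum>k\<in>svars n m. if i = k then f k else 0) = f i"
    using assms by (subst sum.delta') (auto simp: finite_svars)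
  finally show ?thesis .
qed

text \<open>
  By closedness, differentiating \<open>\<Sum>\<^sub>k z\<^sub>k f\<^sub>k\<close> in the direction
  \<open>i\<close> gives
  \<open>f\<^sub>i + \<Sum>\<^sub>k z\<^sub>k \<partial>\<^sub>k f\<^sub>i\<close>, which is
  \<open>(d + 1) f\<^sub>i\<close> by the Euler identity.
\<close>

lemma poincare_1:
  assumes f: "\<And>i. i \<in> svars n m \<Longrightarrow> f i \<in> Lam_hom n m (int d)"
    and closed: "\<And>i k. \<lbrakk>i \<in> svars n m; k \<in> svars n m\<rbrakk> \<Longrightarrow> pd i (f k) = sscale (vsign i k) (pd k (f i))"
    and i: "i \<in> svars n m"
  shows "pd i (sscale (1 / of_nat (d + 1)) (\<Sum>k\<in>svars n m. mul k (f k))) = f i"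
proof -
  have "(\<Sum>k\<in>svars n m. sscale (vsign i k) (mul k (pd i (f k)))) = (\<Sum>k\<in>svars n m. mul k (pd k (f i)))"
    using closed[OF i] by (intro sum.cong refl) (simp add: mul_scale)
  also have "\<dots> = sscale (of_nat d) (f i)" using euler[OF f[OF i]] .
  finally have "pd i (\<Sum>k\<in>svars n m. mul k (f k)) = sscale 1 (f i) + sscale (of_nat d) (f i)"
    unfolding pd_sum_mul[OF i] by simp
  also have "\<dots> = sscale (of_nat (d + 1)) (f i)"
    unfolding spoly.scale_left_distrib[symmetric] by (simp add: add.commute)
  finally show ?thesis by (simp add: pd_scale del: of_nat_add)
qed

lemma koszul_sign_add: "koszul_sign (a + b) c = koszul_sign a c * koszul_sign b c"
  by (cases a; cases b; cases c) (simp_all add: koszul_sign_def)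

lemma sscale_diff_swap: "sscale c f - sscale k (sscale c g) = sscale c (f - sscale k g)"
  by (rule spoly_eqI) (simp add: lookup_minus algebra_simps)

text \<open>
  For the contraction \<open>\<Sum>\<^sub>k z\<^sub>k f\<^sub>k\<^sub>j\<close> of the two-form with
  the Euler field, skew-symmetry contributes \<open>2 f\<^sub>i\<^sub>j\<close> to the exterior
  derivative, and closedness together with the Euler identity contributes
  \<open>d f\<^sub>i\<^sub>j\<close>.
\<close>

lemma poincare_2:
  assumes f: "\<And>i j. \<lbrakk>i \<in> svars n m; j \<in> svars n m\<rbrakk> \<Longrightarrow> f i j \<in> Lam_hom n m (int d)"
    and skew: "\<And>i j. \<lbrakk>i \<in> svars n m; j \<in> svars n m\<rbrakk> \<Longrightarrow> f i j = - sscale (vsign i j) (f j i)"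
    and closed: "\<And>i j k. \<lbrakk>i \<in> svars n m; j \<in> svars n m; k \<in> svars n m\<rbrakk> \<Longrightarrow>
      pd i (f j k) - sscale (vsign i j) (pd j (f i k))
        + sscale (koszul_sign (vpar i + vpar j) (vpar k)) (pd k (f i j)) = 0"
    and ij: "i \<in> svars n m" "j \<in> svars n m"
  defines "T \<equiv> \<lambda>k. sscale (1 / of_nat (d + 2)) (\<Sum>i\<in>svars n m. mul i (f i k))"
  shows "pd i (T j) - sscale (vsign i j) (pd j (T i)) = f i j"
proof -
  let ?V = "svars n m"
  let ?S = "\<lambda>i j. \<Sum>k\<in>?V. sscale (vsign i k) (mul k (pd i (f k j)))"
  have "?S i j - sscale (vsign i j) (?S j i) = (\<Sum>k\<in>?V. mul k (pd k (f i j)))"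
    unfolding spoly.scale_sum_right sum_subtractf[symmetric]
  proof (intro sum.cong refl)
    fix k assume k: "k \<in> ?V"
    have "pd k (f i j) = sscale (vsign k i) (pd i (f k j)) -
        sscale (koszul_sign (vpar k + vpar i) (vpar j)) (pd j (f k i))"
      using closed[OF k ij] by (simp add: algebra_simps)
    then have "mul k (pd k (f i j)) = sscale (vsign k i) (mul k (pd i (f k j))) -
        sscale (koszul_sign (vpar k + vpar i) (vpar j)) (mul k (pd j (f k i)))"
      by (simp only: mul_diff mul_scale)
    moreover have "koszul_sign (vpar k + vpar i) (vpar j) = vsign i j * vsign j k"
      by (simp only: koszul_sign_add koszul_sign_commute[of "vpar k" "vpar j"] mult.commute)
    ultimately show "sscale (vsign i k) (mul k (pd i (f k j))) -
        sscale (vsign i j) (sscale (vsign j k) (mul k (pd j (f k i)))) = mul k (pd k (f i j))"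
      by (simp only: spoly.scale_scale koszul_sign_commute[of "vpar k" "vpar i"])
  qed
  also have "\<dots> = sscale (of_nat d) (f i j)" using euler[OF f[OF ij]] .
  finally have S: "?S i j - sscale (vsign i j) (?S j i) = sscale (of_nat d) (f i j)" .
  have "pd i (\<Sum>k\<in>?V. mul k (f k j)) - sscale (vsign i j) (pd j (\<Sum>k\<in>?V. mul k (f k i))) =
      (f i j - sscale (vsign i j) (f j i)) + (?S i j - sscale (vsign i j) (?S j i))"
    unfolding pd_sum_mul[OF ij(1)] pd_sum_mul[OF ij(2)] by (simp only: spoly.scale_right_distrib add_diff_add)
  also have "\<dots> = sscale (of_nat (d + 2)) (f i j)"
  proof -
    have "sscale (vsign i j) (f j i) = - f i j" unfolding skew[OF ij] by (simp only: minus_minus)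
    then have D: "f i j - sscale (vsign i j) (f j i) = f i j + f i j" by (simp only: diff_minus_eq_add)
    show ?thesis unfolding S D
      by (rule spoly_eqI, simp only: lookup_add plus_fun_apply lookup_sscale) (simp add: algebra_simps)
  qed
  finally have E: "pd i (\<Sum>k\<in>?V. mul k (f k j)) - sscale (vsign i j) (pd j (\<Sum>k\<in>?V. mul k (f k i))) = \<dots>" .
  have "pd i (T j) - sscale (vsign i j) (pd j (T i)) = sscale (1 / of_nat (d + 2))
      (pd i (\<Sum>k\<in>?V. mul k (f k j)) - sscale (vsign i j) (pd j (\<Sum>k\<in>?V. mul k (f k i))))"
    by (simp only: T_def pd_scale sscale_diff_swap)
  also have "\<dots> = sscale 1 (f i j)"
  proof -
    have "(of_nat (d + 2) :: complex) \<noteq> 0" unfolding of_nat_eq_0_iff by simp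
    then have "1 / of_nat (d + 2) * of_nat (d + 2) = (1 :: complex)" by (metis nonzero_eq_divide_eq)
    then show ?thesis unfolding E spoly.scale_scale by (simp only:)
  qed
  finally show ?thesis by simp
qed

section \<open>Vanishing of the torsion\<close>

text \<open>
  The eigenvalue of the generator of direction \<open>i\<close> under the element
  \<open>\<Sum>\<^sub>k p\<^sub>k q\<^sub>k\<close>. Directions are dual to generators: the
  generator that differentiates with respect to \<open>q\<^sub>k\<close> is
  \<open>p\<^sub>k\<close>.
\<close>

fun weight :: "svar \<Rightarrow> complex" where
  "weight (Inl (Pvar k)) = - 1"
| "weight (Inl (Qvar k)) = 1"
| "weight (Inr j) = 0"

lemma Lam_hom_0_par_1:
  assumes "f \<in> Lam_hom n m 0" "f \<in> Lam_par n m 1"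
  shows "f = 0"
proof (rule spoly_eqI, rule ccontr)
  fix I a assume "coef f I a \<noteq> coef 0 I a"
  then have "card I = 0" "of_nat (card I) = (1 :: bit)"
    using assms unfolding Lam_hom_iff Lam_par_iff by (auto, metis of_nat_eq_0_iff add_is_0 of_nat_add)
  then show False by simp
qed

text \<open>
  The number of even variables among the three is odd, and so is the sum of as many terms
  \<open>\<plusminus>1\<close>.
\<close>

lemma weight_sum_nonzero:
  assumes "vpar i + vpar j + vpar k = 0"
  shows "weight i + weight j + weight k \<noteq> 0"
proof -
  have w: "weight v \<in> (if vpar v = 0 then {- 1, 1} else {0})" for v
    by (cases v rule: weight.cases) auto
  show ?thesis using assms w[of i] w[of j] w[of k]
    by (cases "vpar i"; cases "vpar j"; cases "vpar k") auto
qed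

text \<open>
  The left side of the claim is a constant. If the three parities sum to 1, it is zero because an
  odd constant is zero. Otherwise its product with the total weight is a combination of second
  derivatives of the \<open>a\<close>'s that cancel in pairs since derivatives supercommute, and the
  total weight is nonzero.
\<close>

lemma torsion_closed:
  assumes f: "\<And>i j. \<lbrakk>i \<in> svars n m; j \<in> svars n m\<rbrakk> \<Longrightarrow> f i j \<in> Lam_hom n m 1"
    and par: "\<And>i j. \<lbrakk>i \<in> svars n m; j \<in> svars n m\<rbrakk> \<Longrightarrow> f i j \<in> Lam_par n m (vpar i + vpar j)"
    and eq: "\<And>i j k. \<lbrakk>i \<in> svars n m; j \<in> svars n m; k \<in> svars n m\<rbrakk> \<Longrightarrow>
      sscale (- weight k) (pd k (f i j)) = sscale (weight i + weight j) (pd k (f i j))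
        + (pd k (pd i (a j)) - sscale (vsign i j) (pd k (pd j (a i))))"
    and ijk: "i \<in> svars n m" "j \<in> svars n m" "k \<in> svars n m"
  shows "pd i (f j k) - sscale (vsign i j) (pd j (f i k))
        + sscale (koszul_sign (vpar i + vpar j) (vpar k)) (pd k (f i j)) = 0"
proof (cases "vpar i + vpar j + vpar k = 0")
  case False
  then have odd: "vpar i + vpar j + vpar k = 1" by (cases "vpar i + vpar j + vpar k") auto
  have z: "pd k (f i j) = 0" if "i \<in> svars n m" "j \<in> svars n m" "vpar i + vpar j + vpar k = 1" for i j k
    using Lam_hom_0_par_1 pd_hom[OF f[OF that(1,2)], of k] pd_par[OF par[OF that(1,2)], of k] that(3) by simp
  have "pd i (f j k) = 0" "pd j (f i k) = 0" "pd k (f i j) = 0"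
    using odd ijk by (auto intro!: z simp: add_ac)
  then show ?thesis by (simp only: spoly.scale_zero_right diff_0_right add_0_right)
next
  case True
  define W where "W = weight i + weight j + weight k"
  have "W \<noteq> 0" unfolding W_def using weight_sum_nonzero[OF True] .
  have e: "(weight i + weight j + weight k) * coef (pd k (f i j)) I b =
      vsign i j * coef (pd k (pd j (a i))) I b - coef (pd k (pd i (a j))) I b"
    if "i \<in> svars n m" "j \<in> svars n m" "k \<in> svars n m" for i j k I b
    using arg_cong[OF eq[OF that], of "\<lambda>g. coef g I b"]
    by (simp add: lookup_add lookup_minus algebra_simps)
  have c: "coef (pd i (pd j g)) I b = vsign i j * coef (pd j (pd i g)) I b" for i j g I b
    unfolding pd_commute[of i j] by simp
  show ?thesis
  proof (rule spoly_eqI)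
    fix I b
    define x y z where "x = coef (pd i (f j k)) I b" and "y = coef (pd j (f i k)) I b"
      and "z = coef (pd k (f i j)) I b"
    have "W * x = vsign j k * coef (pd i (pd k (a j))) I b - coef (pd i (pd j (a k))) I b"
      "W * y = vsign i k * coef (pd j (pd k (a i))) I b - vsign j i * coef (pd i (pd j (a k))) I b"
      "W * z = vsign i j * (vsign k j * coef (pd j (pd k (a i))) I b) - vsign k i * coef (pd i (pd k (a j))) I b"
      unfolding W_def x_def y_def z_def
      using e[OF ijk(2,3,1), of I b] e[OF ijk(1,3,2), of I b] e[OF ijk, of I b]
        c[of j i "a k" I b] c[of k j "a i" I b] c[of k i "a j" I b]
      by (simp_all add: add_ac)
    then have "W * (x - vsign i j * y + koszul_sign (vpar i + vpar j) (vpar k) * z) = 0"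
      unfolding koszul_sign_add
      by (cases "vpar i"; cases "vpar j"; cases "vpar k")
        (simp_all add: koszul_sign_def distrib_left right_diff_distrib)
    then have "x - vsign i j * y + koszul_sign (vpar i + vpar j) (vpar k) * z = 0"
      using \<open>W \<noteq> 0\<close> by simp
    then show "coef (pd i (f j k) - sscale (vsign i j) (pd j (f i k))
        + sscale (koszul_sign (vpar i + vpar j) (vpar k)) (pd k (f i j))) I b = coef 0 I b"
      unfolding x_def y_def z_def by (simp add: lookup_add lookup_minus)
  qed
qed

section \<open>Generators and the bracket with linear functions\<close>

abbreviation one :: spoly where "one \<equiv> sconst 1"

fun dual :: "svar \<Rightarrow> svar" where
  "dual (Inl (Pvar k)) = Inl (Qvar k)"
| "dual (Inl (Qvar k)) = Inl (Pvar k)"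
| "dual (Inr j) = Inr j"

fun dual_sign :: "svar \<Rightarrow> complex" where
  "dual_sign (Inl (Pvar k)) = - 1"
| "dual_sign (Inl (Qvar k)) = 1"
| "dual_sign (Inr j) = 1"

text \<open>
  The linear function whose bracket is the derivative in the direction \<open>i\<close>.
\<close>

definition gen :: "svar \<Rightarrow> spoly" where
  "gen i = sscale (dual_sign i) (mul (dual i) one)"

definition hyperbolic :: "nat \<Rightarrow> spoly" where
  "hyperbolic n = (\<Sum>k<n. mul (Inl (Pvar k)) (mul (Inl (Qvar k)) one))"

lemma dual_dual [simp]: "dual (dual i) = i"
  by (cases i rule: dual.cases) auto

lemma dual_in_svars [simp]: "dual i \<in> svars n m \<longleftrightarrow> i \<in> svars n m"
  by (cases i rule: dual.cases) (auto simp: svars_def even_vars_def)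

lemma vpar_dual [simp]: "vpar (dual i) = vpar i"
  by (cases i rule: dual.cases) auto

lemma weight_dual: "weight (dual i) = - weight i"
  by (cases i rule: dual.cases) auto

lemma dual_sign_square: "dual_sign i * dual_sign i = 1"
  by (cases i rule: dual.cases) auto

lemma mul_one_eq_gen: "mul i one = sscale (dual_sign (dual i)) (gen (dual i))"
  by (simp add: gen_def dual_sign_square)

lemma coef_one: "coef one I a = (if I = {} \<and> a = 0 then 1 else 0)"
  by (auto simp: sconst_def lookup_one when_def)

lemma one_hom: "one \<in> Lam_hom n m 0"
  by (auto simp: Lam_hom_iff coef_one in_vars_def mdeg_def)

lemma one_par: "one \<in> Lam_par n m 0"
  by (auto simp: Lam_par_iff coef_one in_vars_def)

lemma pd_one: "pd i one = 0"
proof -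
  have "pd i one \<in> Lam_hom 0 0 (0 - 1)" by (rule pd_hom[OF one_hom])
  then show ?thesis by (intro spoly_eqI) (auto simp: Lam_hom_iff)
qed

lemma pd_mul_one: "pd i (mul j one) = (if i = j then one else 0)"
  unfolding pd_mul pd_one mul_0 by (simp only: spoly.scale_zero_right add_0_right)

lemma gen_hom: "i \<in> svars n m \<Longrightarrow> gen i \<in> Lam_hom n m 1"
  using mul_hom[OF one_hom, of "dual i" n m] by (simp add: gen_def spoly.subspace_scale[OF subspace_Lam_hom])

lemma gen_par: "i \<in> svars n m \<Longrightarrow> gen i \<in> Lam_par n m (vpar i)"
proof -
  assume "i \<in> svars n m"
  then have "mul (dual i) one \<in> Lam_par n m (0 + vpar (dual i))"
    by (intro mul_par one_par) (simp only: dual_in_svars)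
  then show ?thesis
    by (simp only: gen_def add_0_left vpar_dual spoly.subspace_scale[OF subspace_Lam_par])
qed

lemma smult_one: "f \<in> Lam n m \<Longrightarrow> one \<star> f = f"
proof
  \<comment> \<open>the product is a sum over subsets of \<open>K\<close>, which is zero by convention for infinite \<open>K\<close>; so \<open>f\<close> must lie in \<open>\<Lambda>(2n,m)\<close>\<close>
  fix K assume f: "f \<in> Lam n m"
  show "(one \<star> f) K = f K"
  proof (cases "finite K")
    case True
    have "(one \<star> f) K = (\<Sum>I\<in>Pow K. if I = {} then f K else 0)"
      unfolding smult_poly_def sconst_def by (intro sum.cong) auto
    then show ?thesis using True by simp
  next
    case False
    then have "f K = 0" using f finite_subset[of K "{..<m}"] unfolding Lam_def by auto
    then show ?thesis using False by (simp add: smult_poly_def)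
  qed
qed

lemma smult_zero: "0 \<star> f = 0"
  by (intro ext) (simp add: smult_poly_def)

lemma sscale_conv_mult: "sscale c f I = Poly_Mapping.single 0 c * f I"
  by (simp add: sscale_def mult_map_scale_conv_mult)

lemma smult_scale_left: "sscale c f \<star> g = sscale c (f \<star> g)"
  by (intro ext) (simp add: smult_poly_def sscale_conv_mult sum_distrib_left mult_ac)

lemma smult_add_left: "(f + g) \<star> h = f \<star> h + g \<star> h"
  by (intro ext) (simp add: smult_poly_def sum.distrib distrib_left distrib_right)

lemma parity_twist_add: "parity_twist (f + g) = parity_twist f + parity_twist g"
  by (intro ext) (simp add: parity_twist_def distrib_left)

lemma parity_twist_scale: "parity_twist (sscale c f) = sscale c (parity_twist f)"
  by (intro ext) (simp add: parity_twist_def sscale_conv_mult mult_ac)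

lemma poisson_pd:
  "poisson n m f g =
     (\<Sum>i<n. pd (Inl (Pvar i)) f \<star> pd (Inl (Qvar i)) g - pd (Inl (Qvar i)) f \<star> pd (Inl (Pvar i)) g)
     - (\<Sum>j<m. pd (Inr j) (parity_twist f) \<star> pd (Inr j) g)"
  by (simp only: poisson_def pd.simps)

lemma poisson_add_left: "poisson n m (f + g) h = poisson n m f h + poisson n m g h"
  unfolding poisson_pd pd_add smult_add_left parity_twist_add add_diff_add sum.distrib ..

lemma poisson_scale_left: "poisson n m (sscale c f) h = sscale c (poisson n m f h)"
  unfolding poisson_pd pd_scale smult_scale_left parity_twist_scale
    spoly.scale_right_diff_distrib spoly.scale_sum_right ..

lemma poisson_sum_left: "poisson n m (\<Sum>s\<in>S. f s) h = (\<Sum>s\<in>S. poisson n m (f s) h)"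
proof -
  have "poisson n m 0 h = 0"
    using poisson_scale_left[of n m 0 0 h] by (simp only: spoly.scale_zero_left)
  then show ?thesis
    by (induction S rule: infinite_finite_induct)
      (simp_all only: sum.infinite sum.empty sum.insert not_False_eq_True poisson_add_left)
qed

lemma of_nat_bit_eq_0_iff: "(of_nat k :: bit) = 0 \<longleftrightarrow> even k"
  by (induction k) auto

lemma parity_twist_par: "f \<in> Lam_par n m b \<Longrightarrow> parity_twist f = (if b = 0 then f else - f)"
proof (rule spoly_eqI)
  fix I a assume f: "f \<in> Lam_par n m b"
  show "coef (parity_twist f) I a = coef (if b = 0 then f else - f) I a"
  proof (cases "coef f I a = 0")
    case False
    then have "of_nat (card I) = b" using f unfolding Lam_par_iff by blast
    then have "b = 0 \<longleftrightarrow> even (card I)" using of_nat_bit_eq_0_iff by metis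
    then show ?thesis by (simp add: parity_twist_def lookup_sign_mult)
  qed (auto simp: parity_twist_def lookup_sign_mult)
qed

lemma pd_Lam: "f \<in> Lam n m \<Longrightarrow> pd i f \<in> Lam n m"
  unfolding Lam_iff using coef_pd_nonzero[of i f _ _ n m] by blast

lemma poisson_gen:
  assumes f: "f \<in> Lam n m" and i: "i \<in> svars n m"
  shows "poisson n m (gen i) f = pd i f"
proof -
  have t: "(if b then sscale c one else 0) \<star> pd v f = (if b then sscale c (pd v f) else 0)" for b c v
    using smult_one[OF pd_Lam[OF f]] by (simp add: smult_scale_left smult_zero)
  have g: "pd v (gen i) = (if v = dual i then sscale (dual_sign i) one else 0)" for v
    unfolding gen_def pd_scale pd_mul_one by (simp add: spoly.scale_zero_right del: zero_fun_apply)
  have tw: "parity_twist (gen i) = sscale (if vpar i = 0 then 1 else - 1) (gen i)"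
    unfolding parity_twist_par[OF gen_par[OF i]] by simp
  have tt: "sscale c (if b then g else 0) = (if b then sscale c g else 0)" for c b and g :: spoly
    by simp
  show ?thesis
    unfolding poisson_pd tw pd_scale g tt spoly.scale_scale t
    using i by (cases i rule: dual.cases) (auto simp: svars_def even_vars_def sum_negf)
qed

lemma hyperbolic_hom: "hyperbolic n \<in> Lam_hom n m 2"
  unfolding hyperbolic_def
proof (intro spoly.subspace_sum[OF subspace_Lam_hom])
  fix k assume "k \<in> {..<n}"
  then have "Inl (Pvar k) \<in> svars n m" "Inl (Qvar k) \<in> svars n m" by (auto simp: svars_def even_vars_def)
  then show "mul (Inl (Pvar k)) (mul (Inl (Qvar k)) one) \<in> Lam_hom n m 2"
    using mul_hom[OF mul_hom[OF one_hom]] by fastforce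
qed

lemma hyperbolic_par: "hyperbolic n \<in> Lam_par n m 0"
  unfolding hyperbolic_def
proof (intro spoly.subspace_sum[OF subspace_Lam_par])
  fix k assume "k \<in> {..<n}"
  then have "Inl (Pvar k) \<in> svars n m" "Inl (Qvar k) \<in> svars n m" by (auto simp: svars_def even_vars_def)
  then show "mul (Inl (Pvar k)) (mul (Inl (Qvar k)) one) \<in> Lam_par n m 0"
    using mul_par[OF mul_par[OF one_par]] by fastforce
qed

lemma pd_hyperbolic:
  assumes "i \<in> svars n m"
  shows "pd i (hyperbolic n) = sscale (weight i) (gen i)"
proof -
  have "pd i (hyperbolic n) = (\<Sum>k<n. (if i = Inl (Pvar k) then mul (Inl (Qvar k)) one else 0)
      + (if i = Inl (Qvar k) then mul (Inl (Pvar k)) one else 0))"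
    unfolding hyperbolic_def pd_sum
  proof (intro sum.cong refl)
    fix k
    show "pd i (mul (Inl (Pvar k)) (mul (Inl (Qvar k)) one)) =
      (if i = Inl (Pvar k) then mul (Inl (Qvar k)) one else 0)
      + (if i = Inl (Qvar k) then mul (Inl (Pvar k)) one else 0)"
      unfolding pd_mul[of i "Inl (Pvar k)"] pd_mul_one
      by (cases "i = Inl (Qvar k)")
        (simp_all only: mul_0 spoly.scale_zero_right if_True if_False vpar.simps koszul_sign_def
          spoly.scale_one zero_neq_one simp_thms)
  qed
  also have "\<dots> = sscale (weight i) (gen i)"
    using assms by (cases i rule: dual.cases) (auto simp: gen_def svars_def even_vars_def sum.delta)
  finally show ?thesis .
qed

lemma hom_0_const:
  assumes "f \<in> Lam_hom n m 0"
  shows "f = sscale (coef f {} 0) one"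
proof (rule spoly_eqI)
  fix I a
  show "coef f I a = coef (sscale (coef f {} 0) one) I a"
  proof (cases "coef f I a = 0")
    case False
    then have "in_vars n m I a" "mdeg a = 0" "card I = 0"
      using assms unfolding Lam_hom_iff by (blast, fastforce, fastforce)
    then have "I = {}" "a = 0"
      using finite_subset[of I "{..<m}"] by (auto simp: in_vars_def mdeg_def in_keys_iff intro: poly_mapping_eqI)
    then show ?thesis by (simp add: coef_one)
  qed (auto simp: coef_one)
qed

lemma hom_1_expand:
  assumes "f \<in> Lam_hom n m 1"
  shows "f = (\<Sum>i\<in>svars n m. sscale (coef (pd i f) {} 0) (mul i one))"
proof -
  have "(\<Sum>i\<in>svars n m. mul i (pd i f)) = sscale (of_nat 1) f"
    by (rule euler) (use assms in simp)
  moreover have "mul i (pd i f) = sscale (coef (pd i f) {} 0) (mul i one)" for i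
    using hom_0_const[of "pd i f" n m] pd_hom[OF assms, of i] by (metis diff_self mul_scale)
  ultimately show ?thesis by simp
qed

text \<open>
  The bracket of a linear function \<open>f\<close> with
  \<open>\<Sum>\<^sub>k p\<^sub>k q\<^sub>k\<close>, with \<open>f\<close> expanded in the
  variables. This polynomial representative has derivatives that are constants and still visible,
  whereas they vanish in the quotient.
\<close>

definition hyperbolic_action :: "nat \<Rightarrow> nat \<Rightarrow> spoly \<Rightarrow> spoly" where
  "hyperbolic_action n m f = (\<Sum>i\<in>svars n m. sscale (- weight i * coef (pd i f) {} 0) (mul i one))"

lemma poisson_hyperbolic:
  assumes "f \<in> Lam_hom n m 1"
  shows "poisson n m f (hyperbolic n) = hyperbolic_action n m f"
proof -
  have "poisson n m (mul i one) (hyperbolic n) = sscale (- weight i) (mul i one)" if i: "i \<in> svars n m" for i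
  proof -
    have "poisson n m (mul i one) (hyperbolic n) =
        sscale (dual_sign (dual i)) (pd (dual i) (hyperbolic n))"
      unfolding mul_one_eq_gen[of i] poisson_scale_left
      using poisson_gen[OF Lam_homD[OF hyperbolic_hom]] i by simp
    also have "\<dots> = sscale (- weight i) (mul i one)"
      using pd_hyperbolic[of "dual i" n m] i unfolding mul_one_eq_gen[of i]
      by (simp only: dual_in_svars weight_dual spoly.scale_scale mult.commute)
    finally show ?thesis .
  qed
  then show ?thesis
    by (subst hom_1_expand[OF assms])
      (simp add: poisson_sum_left poisson_scale_left hyperbolic_action_def mult.commute)
qed

lemma hyperbolic_action_hom: "hyperbolic_action n m f \<in> Lam_hom n m 1"
proof -
  have "mul i one \<in> Lam_hom n m 1" if "i \<in> svars n m" for i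
    using mul_hom[OF one_hom that] by simp
  then show ?thesis
    unfolding hyperbolic_action_def
    by (intro spoly.subspace_sum[OF subspace_Lam_hom] spoly.subspace_scale[OF subspace_Lam_hom])
qed

lemma pd_hyperbolic_action:
  assumes f: "f \<in> Lam_hom n m 1" and k: "k \<in> svars n m"
  shows "pd k (hyperbolic_action n m f) = sscale (- weight k) (pd k f)"
proof -
  have "pd k (hyperbolic_action n m f) =
      (\<Sum>i\<in>svars n m. if k = i then sscale (- weight i * coef (pd i f) {} 0) one else 0)"
    unfolding hyperbolic_action_def pd_sum pd_scale pd_mul_one
    by (intro sum.cong refl) (simp split: if_split)
  also have "\<dots> = sscale (- weight k * coef (pd k f) {} 0) one"
    using k by (subst sum.delta') (auto simp: finite_svars)
  also have "\<dots> = sscale (- weight k) (pd k f)"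
    using hom_0_const[of "pd k f" n m] pd_hom[OF f, of k] by (metis diff_self spoly.scale_scale)
  finally show ?thesis .
qed

section \<open>Passage to the quotient by the constants\<close>

lemma ham_simps:
  "comp (ham_algebra n m) j = abs_hamiltonian ` Lam_hom n m (j + 2)"
  "par (ham_algebra n m) a = abs_hamiltonian ` Lam_par n m a"
  "brk (ham_algebra n m) = ham_brk n m"
  "smul (ham_algebra n m) = ham_scale"
  by (simp_all add: ham_algebra_def)

lemma ham_abs:
  "abs_hamiltonian f + abs_hamiltonian g = abs_hamiltonian (f + g)"
  "abs_hamiltonian f - abs_hamiltonian g = abs_hamiltonian (f - g)"
  "- abs_hamiltonian f = abs_hamiltonian (- f)"
  "ham_scale c (abs_hamiltonian f) = abs_hamiltonian (sscale c f)"
  "ham_brk n m (abs_hamiltonian f) (abs_hamiltonian g) = abs_hamiltonian (poisson n m f g)"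
  by (simp_all only: plus_hamiltonian.abs_eq minus_hamiltonian.abs_eq uminus_hamiltonian.abs_eq
      ham_scale.abs_eq ham_brk.abs_eq)

lemma ham_abs_0: "abs_hamiltonian 0 = 0"
  by (simp only: zero_hamiltonian_def)

lemma ham_abs_sum: "(\<Sum>s\<in>S. abs_hamiltonian (f s)) = abs_hamiltonian (\<Sum>s\<in>S. f s)"
  by (induction S rule: infinite_finite_induct)
    (simp_all only: sum.infinite sum.empty sum.insert not_False_eq_True ham_abs_0 ham_abs)

text \<open>
  In nonzero degree a class modulo constants has only one homogeneous representative; so equations
  between classes become equations between polynomials, to which the Poincare lemmas apply.
\<close>

lemma ham_abs_inj:
  assumes f: "f \<in> Lam_hom n m d" and g: "g \<in> Lam_hom n m d" and d: "d \<noteq> 0"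
    and eq: "abs_hamiltonian f = abs_hamiltonian g"
  shows "f = g"
proof -
  obtain c where c: "f - g = sconst c"
    using eq unfolding hamiltonian.abs_eq_iff const_rel_def by blast
  have "f - g \<in> Lam_hom n m d" using spoly.subspace_diff[OF subspace_Lam_hom] f g by blast
  moreover have "mdeg 0 = 0" by (simp add: mdeg_def)
  ultimately have "coef (f - g) {} 0 = 0" using d unfolding Lam_hom_iff by fastforce
  then have "c = 0" unfolding c by (simp add: sconst_def)
  then have "f - g = 0" using c sconst_0 by (simp only:)
  then show ?thesis by (simp only: right_minus_eq)
qed

lemma ham_abs_par:
  assumes f: "f \<in> Lam_hom n m d" and d: "d \<noteq> 0"
    and par: "abs_hamiltonian f \<in> abs_hamiltonian ` Lam_par n m b"
  shows "f \<in> Lam_par n m b"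
proof -
  obtain g c where g: "g \<in> Lam_par n m b" and c: "f - g = sconst c"
    using par unfolding image_iff hamiltonian.abs_eq_iff const_rel_def by blast
  have "coef f I a = coef g I a" if "I \<noteq> {} \<or> a \<noteq> 0" for I a
  proof -
    have "coef (f - g) I a = 0" unfolding c using that by (auto simp: sconst_def lookup_single when_def)
    then show ?thesis by (simp add: lookup_minus)
  qed
  moreover have "I \<noteq> {} \<or> a \<noteq> 0" if "coef f I a \<noteq> 0" for I a
  proof -
    have "int (mdeg a + card I) = d" using f that unfolding Lam_hom_iff by blast
    then show ?thesis using d by (auto simp: mdeg_def)
  qed
  ultimately show ?thesis using g unfolding Lam_par_iff by metis
qed

text \<open>
  Degree -2 consists of the constants, which are divided out, and there are no polynomials of
  negative degree.
\<close>

lemma ham_comp_trivial: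
  assumes "j < - 1"
  shows "comp (ham_algebra n m) j = {0}"
proof -
  have "abs_hamiltonian f = 0" if f: "f \<in> Lam_hom n m (j + 2)" for f
  proof (cases "j = -2")
    case True
    then have e: "f = sscale (coef f {} 0) one" using f hom_0_const[of f n m] by simp
    have "const_rel f 0" unfolding const_rel_def by (subst e) (metis diff_0_right sscale_sconst)
    then have "abs_hamiltonian f = abs_hamiltonian 0" unfolding hamiltonian.abs_eq_iff .
    then show ?thesis unfolding ham_abs_0 .
  next
    case False
    then have "coef f I a = 0" for I a using f assms unfolding Lam_hom_iff by (cases "coef f I a = 0") force+
    then have "f = 0" by (intro spoly_eqI) simp
    then show ?thesis by (simp only: ham_abs_0)
  qed
  moreover have "0 \<in> comp (ham_algebra n m) j"
    unfolding ham_simps using ham_abs_0 spoly.subspace_0[OF subspace_Lam_hom] by (metis imageI)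
  ultimately show ?thesis unfolding ham_simps by auto
qed

lemma ham_brk_gen:
  "\<lbrakk>f \<in> Lam_hom n m d; i \<in> svars n m\<rbrakk> \<Longrightarrow>
    ham_brk n m (abs_hamiltonian (gen i)) (abs_hamiltonian f) = abs_hamiltonian (pd i f)"
  unfolding ham_abs using poisson_gen Lam_homD by metis

lemma ham_span:
  assumes "v \<in> comp (ham_algebra n m) (- 1)"
  shows "\<exists>c. v = (\<Sum>i\<in>svars n m. ham_scale (c i) (abs_hamiltonian (gen i)))"
proof -
  obtain f where f: "f \<in> Lam_hom n m 1" "v = abs_hamiltonian f"
    using assms unfolding ham_simps by auto
  let ?c = "\<lambda>i. coef (pd i f) {} 0"
  have "f = (\<Sum>i\<in>svars n m. sscale (?c i) (mul i one))" by (rule hom_1_expand[OF f(1)])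
  also have "\<dots> = (\<Sum>i\<in>svars n m. sscale (?c (dual i) * dual_sign i) (gen i))"
    by (rule sum.reindex_bij_witness[of _ dual dual]) (simp_all add: mul_one_eq_gen[of "dual _"] mul_one_eq_gen)
  finally have "v = abs_hamiltonian (\<Sum>i\<in>svars n m. sscale (?c (dual i) * dual_sign i) (gen i))"
    using f(2) by (simp only:)
  then show ?thesis unfolding ham_abs ham_abs_sum by (intro exI[of _ "\<lambda>i. ?c (dual i) * dual_sign i"])
qed

lemma ham_transitive:
  assumes j: "0 \<le> j" and v: "v \<in> comp (ham_algebra n m) j"
    and z: "\<And>i. i \<in> svars n m \<Longrightarrow> ham_brk n m (abs_hamiltonian (gen i)) v = 0"
  shows "v = 0"
proof -
  obtain f where f: "f \<in> Lam_hom n m (j + 2)" and vf: "v = abs_hamiltonian f"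
    using v unfolding ham_simps by blast
  have "pd i f = 0" if "i \<in> svars n m" for i
  proof (rule ham_abs_inj)
    show "pd i f \<in> Lam_hom n m (j + 2 - 1)" using pd_hom[OF f] .
    show "abs_hamiltonian (pd i f) = abs_hamiltonian 0"
      using z[OF that] ham_brk_gen[OF f that] vf ham_abs_0 by simp
  qed (use j spoly.subspace_0[OF subspace_Lam_hom] in auto)
  then have "(\<Sum>i\<in>svars n m. mul i (pd i f)) = 0" by (simp add: mul_0)
  moreover have "f \<in> Lam_hom n m (int (nat (j + 2)))" using f j by simp
  ultimately have "sscale (of_nat (nat (j + 2))) f = 0" using euler by metis
  then have "f = 0" using j by (simp only: spoly.scale_eq_0_iff of_nat_eq_0_iff) auto
  then show ?thesis unfolding vf by (simp only: ham_abs_0)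
qed

lemma ham_closed_1_exact:
  assumes j: "1 \<le> j" and F: "\<And>i. i \<in> svars n m \<Longrightarrow> F i \<in> comp (ham_algebra n m) (j - 1)"
    and closed: "\<And>i k. \<lbrakk>i \<in> svars n m; k \<in> svars n m\<rbrakk> \<Longrightarrow>
      ham_brk n m (abs_hamiltonian (gen i)) (F k) =
      ham_scale (vsign i k) (ham_brk n m (abs_hamiltonian (gen k)) (F i))"
  shows "\<exists>v\<in>comp (ham_algebra n m) j. \<forall>i\<in>svars n m. ham_brk n m (abs_hamiltonian (gen i)) v = F i"
proof -
  define d where "d = nat (j + 1)"
  have d: "int d = j - 1 + 2" "int d = j + 1" using j unfolding d_def by auto
  have "\<exists>f. f \<in> Lam_hom n m (int d) \<and> F i = abs_hamiltonian f" if "i \<in> svars n m" for i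
    using F[OF that] unfolding ham_simps d by blast
  then obtain f where f: "\<And>i. i \<in> svars n m \<Longrightarrow> f i \<in> Lam_hom n m (int d)"
    "\<And>i. i \<in> svars n m \<Longrightarrow> F i = abs_hamiltonian (f i)" by metis
  have cl: "pd i (f k) = sscale (vsign i k) (pd k (f i))" if ik: "i \<in> svars n m" "k \<in> svars n m" for i k
  proof (rule ham_abs_inj)
    show "pd i (f k) \<in> Lam_hom n m (int d - 1)" "sscale (vsign i k) (pd k (f i)) \<in> Lam_hom n m (int d - 1)"
      using pd_hom f(1) ik spoly.subspace_scale[OF subspace_Lam_hom] by blast+
    show "abs_hamiltonian (pd i (f k)) = abs_hamiltonian (sscale (vsign i k) (pd k (f i)))"
      using closed[OF ik] ham_brk_gen[OF f(1)] ik by (simp only: f(2) ham_abs(4))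
  qed (use d j in auto)
  let ?v = "sscale (1 / of_nat (d + 1)) (\<Sum>k\<in>svars n m. mul k (f k))"
  have "mul k (f k) \<in> Lam_hom n m (j + 2)" if "k \<in> svars n m" for k
    using mul_hom[OF f(1)[OF that] that] d by (simp add: add.commute)
  then have v: "?v \<in> Lam_hom n m (j + 2)"
    by (intro spoly.subspace_scale[OF subspace_Lam_hom] spoly.subspace_sum[OF subspace_Lam_hom])
  have "ham_brk n m (abs_hamiltonian (gen i)) (abs_hamiltonian ?v) = F i" if "i \<in> svars n m" for i
  proof -
    have "pd i ?v = f i" by (rule poincare_1[OF _ _ that]) (fact f(1), fact cl)
    then show ?thesis using ham_brk_gen[OF v that] f(2)[OF that] by (simp only:)
  qed
  then show ?thesis unfolding ham_simps using v by blast
qed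

lemma ham_two_form_exact:
  assumes d: "1 \<le> d"
    and f: "\<And>i j. \<lbrakk>i \<in> svars n m; j \<in> svars n m\<rbrakk> \<Longrightarrow> f i j \<in> Lam_hom n m (int d)"
    and par: "\<And>i j. \<lbrakk>i \<in> svars n m; j \<in> svars n m\<rbrakk> \<Longrightarrow> f i j \<in> Lam_par n m (vpar i + vpar j)"
    and skew: "\<And>i j. \<lbrakk>i \<in> svars n m; j \<in> svars n m\<rbrakk> \<Longrightarrow> f i j = - sscale (vsign i j) (f j i)"
    and closed: "\<And>i j k. \<lbrakk>i \<in> svars n m; j \<in> svars n m; k \<in> svars n m\<rbrakk> \<Longrightarrow>
      pd i (f j k) - sscale (vsign i j) (pd j (f i k))
        + sscale (koszul_sign (vpar i + vpar j) (vpar k)) (pd k (f i j)) = 0"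
  shows "\<exists>T. (\<forall>i\<in>svars n m. T i \<in> comp (ham_algebra n m) (int d - 1) \<inter> par (ham_algebra n m) (vpar i)) \<and>
    (\<forall>i\<in>svars n m. \<forall>j\<in>svars n m. ham_brk n m (abs_hamiltonian (gen i)) (T j)
       - ham_scale (vsign i j) (ham_brk n m (abs_hamiltonian (gen j)) (T i)) = abs_hamiltonian (f i j))"
proof -
  define t where "t k = sscale (1 / of_nat (d + 2)) (\<Sum>i\<in>svars n m. mul i (f i k))" for k
  have m: "mul i (f i k) \<in> Lam_hom n m (int d + 1)" "mul i (f i k) \<in> Lam_par n m (vpar k)"
    if "i \<in> svars n m" "k \<in> svars n m" for i k
  proof -
    show "mul i (f i k) \<in> Lam_hom n m (int d + 1)" using mul_hom f that by blast
    have "vpar i + vpar k + vpar i = vpar k" by (cases "vpar i"; cases "vpar k") auto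
    then show "mul i (f i k) \<in> Lam_par n m (vpar k)" using mul_par[OF par[OF that] that(1)] by (simp only:)
  qed
  have th: "t k \<in> Lam_hom n m (int d + 1)" if "k \<in> svars n m" for k
    unfolding t_def using m that
    by (intro spoly.subspace_scale[OF subspace_Lam_hom] spoly.subspace_sum[OF subspace_Lam_hom])
  have tp: "t k \<in> Lam_par n m (vpar k)" if "k \<in> svars n m" for k
    unfolding t_def using m that
    by (intro spoly.subspace_scale[OF subspace_Lam_par] spoly.subspace_sum[OF subspace_Lam_par])
  have "ham_brk n m (abs_hamiltonian (gen i)) (abs_hamiltonian (t j))
       - ham_scale (vsign i j) (ham_brk n m (abs_hamiltonian (gen j)) (abs_hamiltonian (t i))) = abs_hamiltonian (f i j)"
    if ij: "i \<in> svars n m" "j \<in> svars n m" for i j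
  proof -
    have "pd i (t j) - sscale (vsign i j) (pd j (t i)) = f i j"
      unfolding t_def by (rule poincare_2[OF _ _ _ ij]) (fact f, fact skew, fact closed)
    then show ?thesis
      unfolding ham_brk_gen[OF th[OF ij(2)] ij(1)] ham_brk_gen[OF th[OF ij(1)] ij(2)]
      unfolding ham_abs
      by (simp only:)
  qed
  moreover have "abs_hamiltonian (t k) \<in> comp (ham_algebra n m) (int d - 1) \<inter> par (ham_algebra n m) (vpar k)"
    if "k \<in> svars n m" for k
    using th[OF that] tp[OF that] unfolding ham_simps by (simp add: add.commute)
  ultimately show ?thesis by (intro exI[of _ "\<lambda>k. abs_hamiltonian (t k)"]) blast
qed

text \<open>
  The values have degree at least 1 as polynomials, so the representatives inherit parity and
  skew-symmetry from the classes.
\<close>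

lemma ham_skew_representatives:
  assumes d: "1 \<le> d"
    and F: "\<And>i j. \<lbrakk>i \<in> svars n m; j \<in> svars n m\<rbrakk> \<Longrightarrow>
      F i j \<in> comp (ham_algebra n m) (d - 2) \<inter> par (ham_algebra n m) (vpar i + vpar j)"
    and skew: "\<And>i j. \<lbrakk>i \<in> svars n m; j \<in> svars n m\<rbrakk> \<Longrightarrow> F i j = - ham_scale (vsign i j) (F j i)"
  shows "\<exists>f. \<forall>i\<in>svars n m. \<forall>j\<in>svars n m.
    f i j \<in> Lam_hom n m d \<and> f i j \<in> Lam_par n m (vpar i + vpar j) \<and>
    f i j = - sscale (vsign i j) (f j i) \<and> F i j = abs_hamiltonian (f i j)"
proof -
  have "\<exists>g. g \<in> Lam_hom n m d \<and> F i j = abs_hamiltonian g" if "i \<in> svars n m" "j \<in> svars n m" for i j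
    using F[OF that] unfolding ham_simps by auto
  then obtain f where f: "\<And>i j. \<lbrakk>i \<in> svars n m; j \<in> svars n m\<rbrakk> \<Longrightarrow> f i j \<in> Lam_hom n m d"
    "\<And>i j. \<lbrakk>i \<in> svars n m; j \<in> svars n m\<rbrakk> \<Longrightarrow> F i j = abs_hamiltonian (f i j)" by metis
  have "f i j \<in> Lam_hom n m d \<and> f i j \<in> Lam_par n m (vpar i + vpar j) \<and>
    f i j = - sscale (vsign i j) (f j i) \<and> F i j = abs_hamiltonian (f i j)"
    if ij: "i \<in> svars n m" "j \<in> svars n m" for i j
  proof (intro conjI f ij)
    show "f i j \<in> Lam_par n m (vpar i + vpar j)"
    proof (rule ham_abs_par[OF f(1)[OF ij]])
      show "abs_hamiltonian (f i j) \<in> abs_hamiltonian ` Lam_par n m (vpar i + vpar j)"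
        using F[OF ij] f(2)[OF ij] unfolding ham_simps by auto
    qed (use d in simp)
    show "f i j = - sscale (vsign i j) (f j i)"
    proof (rule ham_abs_inj[OF f(1)[OF ij]])
      show "- sscale (vsign i j) (f j i) \<in> Lam_hom n m d"
        using f(1)[OF ij(2,1)] by (intro spoly.subspace_neg[OF subspace_Lam_hom] spoly.subspace_scale[OF subspace_Lam_hom])
      show "abs_hamiltonian (f i j) = abs_hamiltonian (- sscale (vsign i j) (f j i))"
        using skew[OF ij] unfolding f(2)[OF ij] f(2)[OF ij(2,1)] ham_abs .
    qed (use d in simp)
  qed
  then show ?thesis by (intro exI[of _ f]) blast
qed

lemma ham_closed_2_exact:
  assumes d: "0 \<le> d"
    and F: "\<And>i j. \<lbrakk>i \<in> svars n m; j \<in> svars n m\<rbrakk> \<Longrightarrow>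
      F i j \<in> comp (ham_algebra n m) d \<inter> par (ham_algebra n m) (vpar i + vpar j)"
    and skew: "\<And>i j. \<lbrakk>i \<in> svars n m; j \<in> svars n m\<rbrakk> \<Longrightarrow> F i j = - ham_scale (vsign i j) (F j i)"
    and closed: "\<And>i j k. \<lbrakk>i \<in> svars n m; j \<in> svars n m; k \<in> svars n m\<rbrakk> \<Longrightarrow>
      ham_brk n m (abs_hamiltonian (gen i)) (F j k)
        - ham_scale (vsign i j) (ham_brk n m (abs_hamiltonian (gen j)) (F i k))
        + ham_scale (koszul_sign (vpar i + vpar j) (vpar k)) (ham_brk n m (abs_hamiltonian (gen k)) (F i j)) = 0"
  shows "\<exists>T. (\<forall>i\<in>svars n m. T i \<in> comp (ham_algebra n m) (d + 1) \<inter> par (ham_algebra n m) (vpar i)) \<and>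
    (\<forall>i\<in>svars n m. \<forall>j\<in>svars n m. ham_brk n m (abs_hamiltonian (gen i)) (T j)
       - ham_scale (vsign i j) (ham_brk n m (abs_hamiltonian (gen j)) (T i)) = F i j)"
proof -
  define D where "D = nat (d + 2)"
  have D: "int D = d + 2" "1 \<le> D" "int D - 1 = d + 1" using d unfolding D_def by auto
  have F': "F i j \<in> comp (ham_algebra n m) (int D - 2) \<inter> par (ham_algebra n m) (vpar i + vpar j)"
    if "i \<in> svars n m" "j \<in> svars n m" for i j using F[OF that] D by simp
  have "\<exists>f. \<forall>i\<in>svars n m. \<forall>j\<in>svars n m.
    f i j \<in> Lam_hom n m (int D) \<and> f i j \<in> Lam_par n m (vpar i + vpar j) \<and>
    f i j = - sscale (vsign i j) (f j i) \<and> F i j = abs_hamiltonian (f i j)"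
    by (rule ham_skew_representatives) (use D(2) in simp, fact F', fact skew)
  then obtain f where f0: "\<forall>i\<in>svars n m. \<forall>j\<in>svars n m.
    f i j \<in> Lam_hom n m (int D) \<and> f i j \<in> Lam_par n m (vpar i + vpar j) \<and>
    f i j = - sscale (vsign i j) (f j i) \<and> F i j = abs_hamiltonian (f i j)" by (elim exE)
  then have f: "\<And>i j. \<lbrakk>i \<in> svars n m; j \<in> svars n m\<rbrakk> \<Longrightarrow> f i j \<in> Lam_hom n m (int D)"
    "\<And>i j. \<lbrakk>i \<in> svars n m; j \<in> svars n m\<rbrakk> \<Longrightarrow> f i j \<in> Lam_par n m (vpar i + vpar j)"
    "\<And>i j. \<lbrakk>i \<in> svars n m; j \<in> svars n m\<rbrakk> \<Longrightarrow> f i j = - sscale (vsign i j) (f j i)"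
    "\<And>i j. \<lbrakk>i \<in> svars n m; j \<in> svars n m\<rbrakk> \<Longrightarrow> F i j = abs_hamiltonian (f i j)"
    by blast+
  have cl: "pd i (f j k) - sscale (vsign i j) (pd j (f i k))
        + sscale (koszul_sign (vpar i + vpar j) (vpar k)) (pd k (f i j)) = 0" (is "?g = 0")
    if ijk: "i \<in> svars n m" "j \<in> svars n m" "k \<in> svars n m" for i j k
  proof (rule ham_abs_inj)
    show "?g \<in> Lam_hom n m (int D - 1)"
      by (intro spoly.subspace_add[OF subspace_Lam_hom] spoly.subspace_diff[OF subspace_Lam_hom]
          spoly.subspace_scale[OF subspace_Lam_hom] pd_hom f(1) ijk)
    show "abs_hamiltonian ?g = abs_hamiltonian 0"
      using closed[OF ijk]
      unfolding f(4)[OF ijk(1,2)] f(4)[OF ijk(1,3)] f(4)[OF ijk(2,3)]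
        ham_brk_gen[OF f(1)[OF ijk(2,3)] ijk(1)] ham_brk_gen[OF f(1)[OF ijk(1,3)] ijk(2)]
        ham_brk_gen[OF f(1)[OF ijk(1,2)] ijk(3)]
      unfolding ham_abs ham_abs_0 .
  qed (use D d spoly.subspace_0[OF subspace_Lam_hom] in auto)
  have "\<exists>T. (\<forall>i\<in>svars n m. T i \<in> comp (ham_algebra n m) (int D - 1) \<inter> par (ham_algebra n m) (vpar i)) \<and>
    (\<forall>i\<in>svars n m. \<forall>j\<in>svars n m. ham_brk n m (abs_hamiltonian (gen i)) (T j)
       - ham_scale (vsign i j) (ham_brk n m (abs_hamiltonian (gen j)) (T i)) = abs_hamiltonian (f i j))"
    by (rule ham_two_form_exact) (fact D(2), fact f(1), fact f(2), fact f(3), fact cl)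
  then show ?thesis unfolding D(3) by (simp only: f(4) cong: ball_cong)
qed

text \<open>
  The two-form consists of linear functions. Its closedness is an identity between constants, which
  \<open>torsion_closed\<close> derives from the derivatives of the equation for the bracket with
  \<open>\<Sum>\<^sub>k p\<^sub>k q\<^sub>k\<close>; that equation has degree 1 and can be read in
  polynomials.
\<close>

lemma ham_torsion_exact:
  assumes F: "\<And>i j. \<lbrakk>i \<in> svars n m; j \<in> svars n m\<rbrakk> \<Longrightarrow>
      F i j \<in> comp (ham_algebra n m) (- 1) \<inter> par (ham_algebra n m) (vpar i + vpar j)"
    and skew: "\<And>i j. \<lbrakk>i \<in> svars n m; j \<in> svars n m\<rbrakk> \<Longrightarrow> F i j = - ham_scale (vsign i j) (F j i)"
    and a: "\<And>i. i \<in> svars n m \<Longrightarrow> a i \<in> comp (ham_algebra n m) 0"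
    and eq: "\<And>i j. \<lbrakk>i \<in> svars n m; j \<in> svars n m\<rbrakk> \<Longrightarrow>
      ham_brk n m (F i j) (abs_hamiltonian (hyperbolic n)) = ham_scale (weight i + weight j) (F i j)
        + (ham_brk n m (abs_hamiltonian (gen i)) (a j)
          - ham_scale (vsign i j) (ham_brk n m (abs_hamiltonian (gen j)) (a i)))"
  shows "\<exists>T. (\<forall>i\<in>svars n m. T i \<in> comp (ham_algebra n m) 0 \<inter> par (ham_algebra n m) (vpar i)) \<and>
    (\<forall>i\<in>svars n m. \<forall>j\<in>svars n m. ham_brk n m (abs_hamiltonian (gen i)) (T j)
       - ham_scale (vsign i j) (ham_brk n m (abs_hamiltonian (gen j)) (T i)) = F i j)"
proof -
  have F': "F i j \<in> comp (ham_algebra n m) (1 - 2) \<inter> par (ham_algebra n m) (vpar i + vpar j)"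
    if "i \<in> svars n m" "j \<in> svars n m" for i j using F[OF that] by simp
  have "\<exists>f. \<forall>i\<in>svars n m. \<forall>j\<in>svars n m.
    f i j \<in> Lam_hom n m 1 \<and> f i j \<in> Lam_par n m (vpar i + vpar j) \<and>
    f i j = - sscale (vsign i j) (f j i) \<and> F i j = abs_hamiltonian (f i j)"
    by (rule ham_skew_representatives) (simp, fact F', fact skew)
  then obtain f where f0: "\<forall>i\<in>svars n m. \<forall>j\<in>svars n m.
    f i j \<in> Lam_hom n m 1 \<and> f i j \<in> Lam_par n m (vpar i + vpar j) \<and>
    f i j = - sscale (vsign i j) (f j i) \<and> F i j = abs_hamiltonian (f i j)" by (elim exE)
  then have f: "\<And>i j. \<lbrakk>i \<in> svars n m; j \<in> svars n m\<rbrakk> \<Longrightarrow> f i j \<in> Lam_hom n m 1"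
    "\<And>i j. \<lbrakk>i \<in> svars n m; j \<in> svars n m\<rbrakk> \<Longrightarrow> f i j \<in> Lam_par n m (vpar i + vpar j)"
    "\<And>i j. \<lbrakk>i \<in> svars n m; j \<in> svars n m\<rbrakk> \<Longrightarrow> f i j = - sscale (vsign i j) (f j i)"
    "\<And>i j. \<lbrakk>i \<in> svars n m; j \<in> svars n m\<rbrakk> \<Longrightarrow> F i j = abs_hamiltonian (f i j)"
    by blast+
  have "\<exists>g. g \<in> Lam_hom n m 2 \<and> a i = abs_hamiltonian g" if "i \<in> svars n m" for i
    using a[OF that] unfolding ham_simps by auto
  then obtain b where b: "\<And>i. i \<in> svars n m \<Longrightarrow> b i \<in> Lam_hom n m 2"
    "\<And>i. i \<in> svars n m \<Longrightarrow> a i = abs_hamiltonian (b i)" by metis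
  have e: "sscale (- weight k) (pd k (f i j)) = sscale (weight i + weight j) (pd k (f i j))
        + (pd k (pd i (b j)) - sscale (vsign i j) (pd k (pd j (b i))))"
    if ijk: "i \<in> svars n m" "j \<in> svars n m" "k \<in> svars n m" for i j k
  proof -
    have "hyperbolic_action n m (f i j) = sscale (weight i + weight j) (f i j)
        + (pd i (b j) - sscale (vsign i j) (pd j (b i)))" (is "_ = ?g")
    proof (rule ham_abs_inj[OF hyperbolic_action_hom])
      have pb: "pd l (b l') \<in> Lam_hom n m 1" if "l' \<in> svars n m" for l l'
        using pd_hom[OF b(1)[OF that], of l] by simp
      show "?g \<in> Lam_hom n m 1"
        by (intro spoly.subspace_add[OF subspace_Lam_hom] spoly.subspace_diff[OF subspace_Lam_hom]
          spoly.subspace_scale[OF subspace_Lam_hom] f(1) pb ijk)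
      show "abs_hamiltonian (hyperbolic_action n m (f i j)) = abs_hamiltonian ?g"
        using eq[OF ijk(1,2)]
        unfolding f(4)[OF ijk(1,2)] b(2)[OF ijk(1)] b(2)[OF ijk(2)]
          ham_brk_gen[OF b(1)[OF ijk(2)] ijk(1)] ham_brk_gen[OF b(1)[OF ijk(1)] ijk(2)]
        unfolding ham_abs poisson_hyperbolic[OF f(1)[OF ijk(1,2)]] .
    qed simp
    from arg_cong[OF this, of "pd k"] show ?thesis
      unfolding pd_hyperbolic_action[OF f(1)[OF ijk(1,2)] ijk(3)] pd_add pd_diff pd_scale .
  qed
  have "\<exists>T. (\<forall>i\<in>svars n m. T i \<in> comp (ham_algebra n m) (int 1 - 1) \<inter> par (ham_algebra n m) (vpar i)) \<and>
    (\<forall>i\<in>svars n m. \<forall>j\<in>svars n m. ham_brk n m (abs_hamiltonian (gen i)) (T j)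
       - ham_scale (vsign i j) (ham_brk n m (abs_hamiltonian (gen j)) (T i)) = abs_hamiltonian (f i j))"
  proof (rule ham_two_form_exact)
    show "pd i (f j k) - sscale (vsign i j) (pd j (f i k))
        + sscale (koszul_sign (vpar i + vpar j) (vpar k)) (pd k (f i j)) = 0"
      if "i \<in> svars n m" "j \<in> svars n m" "k \<in> svars n m" for i j k
      by (rule torsion_closed[OF _ _ _ that]) (fact f(1), fact f(2), fact e)
    show "f i j \<in> Lam_hom n m (int 1)" if "i \<in> svars n m" "j \<in> svars n m" for i j
      using f(1)[OF that] by simp
  qed (simp, fact f(2), fact f(3))
  then show ?thesis by (simp add: f(4) cong: ball_cong)
qed

theorem theorem4p4:
  fixes n m :: nat
    and L :: "'a::ab_group_add filtered_superalgebra"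
  assumes "n \<ge> 1"
    and "filtered_deformation 1 (ham_algebra n m) L"
  shows "trivial_deformation 1 (ham_algebra n m) L"
proof -
  obtain \<phi> where L: "filtered_lie_superalgebra L 1" and iso: "gr_iso \<phi> L (ham_algebra n m)"
    using assms(2) unfolding filtered_deformation_def by blast
  interpret filtered_lie_superalgebra L 1 by (rule L)
  interpret deformation L "ham_algebra n m" \<phi>
  proof (intro deformation.intro deformation_axioms.intro L iso)
    show "vector_space (smul (ham_algebra n m))" unfolding ham_simps by (rule vector_space_ham_scale)
  qed
  interpret prolongation L "ham_algebra n m" \<phi> "svars n m" "\<lambda>i. abs_hamiltonian (gen i)" vpar
    "abs_hamiltonian (hyperbolic n)" weight
  proof (unfold_locales, unfold ham_simps(3,4))
    show "finite (svars n m)" by (rule finite_svars)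
    show "abs_hamiltonian (gen i) \<in> comp (ham_algebra n m) (- 1)"
      "abs_hamiltonian (gen i) \<in> par (ham_algebra n m) (vpar i)"
      "ham_brk n m (abs_hamiltonian (gen i)) (abs_hamiltonian (hyperbolic n)) =
        ham_scale (weight i) (abs_hamiltonian (gen i))" if "i \<in> svars n m" for i
      using gen_hom[OF that] gen_par[OF that] ham_brk_gen[OF hyperbolic_hom that] pd_hyperbolic[OF that]
      by (simp_all add: ham_simps ham_abs)
    show "abs_hamiltonian (hyperbolic n) \<in> comp (ham_algebra n m) 0"
      "abs_hamiltonian (hyperbolic n) \<in> par (ham_algebra n m) 0"
      using hyperbolic_hom hyperbolic_par by (simp_all add: ham_simps)
  qed (fact ham_span ham_comp_trivial ham_transitive ham_closed_1_exact ham_closed_2_exact ham_torsion_exact)+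
  show ?thesis by (rule trivial)
qed

end
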